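(* Let $E$ be one of the spaces listed in the context. Let $(\xi_j)_{j\ge1}$ be a stationary sequence of real-valued random variables. Suppose that the extremal index $\theta$ of the sequence $(|\xi_j|)_{j\ge1}$ exists and is positive. Let $(a_n)_{n\ge1}$ be a sequence of positive real numbers such that $nP(|\xi_1|>xa_n)\to\mu(x,\infty)$ for all $x>0$, where $\mu$ is a nonzero measure on $(0,\infty)$ with $\mu(x,\infty)<\infty$ for all $x>0$. Suppose that the variables $\xi_j/a_n$ ($1\le j\le n$, $n\geq 1$) take values in $E$ and that there exists a sequence $(r_n)_n$ of positive integers with $k_n=[n/r_n]\to\infty$ such that $$\lim_{n\to\infty}\Big|E\big(e^{-\sum_{j=1}^nf(\xi_j/a_n)}\big)-\big\{E\big(e^{-\sum_{j=1}^{r_n}f(\xi_j/a_n)}\big)\big\}^{k_n}\Big|=0\qquad\text{for all } f\in C_K^+(E).$$ Let $N_n=\sum_{j=1}^n\delta_{\xi_j/a_n}$ and $N_{r_n,n}=\sum_{j=1}^{r_n}\delta_{\xi_j/a_n}$. Let $N$ be an infinitely divisible point process on $E$ with canonical measure $\lambda$, such that $N(E\cap\{-\infty,\infty\})=0$ almost surely. Let $D$ be the set of fixed atoms of $N$ and $D'=\{x>0:\ x\in D\ \text{or}\ -x\in D\}$. Then $N_n\stackrel d\to N$ if and only if the following two conditions hold: (a) $k_nP(\max_{j\le r_n}|\xi_j|>xa_n)\to\theta\,\mu(x,\infty)$ for every $x>0$ with $x\notin D'$; (b) $k_nP(\max_{j\le r_n}|\xi_j|>xa_n,\ N_{r_n,n}\in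 M)\to\lambda(M\cap M_x)$ for every $x>0$ with $\mu(x,\infty)>0$, and every $M\in\mathcal M_0$ such that $\lambda(\partial M\cap M_x)=0$. In this case, $(|\xi_j|)_j$ is regularly varying (i.e. $x\mapsto P(|\xi_1|>x)$ is regularly varying at infinity) and $\mu(x,\infty)=x^{-\alpha}$ for some $\alpha>0$.
   Context: The space $E$ is one of: (i) $[-b,-a)\cup(a,b]$, $(a,b]$, or $[-b,-a)$, for some $0\le a<b<\infty$; (ii) $[-\infty,-a)\cup(a,\infty]$, $(a,\infty]$, or $[-\infty,-a)$, for some $0\le a<\infty$; with the topology induced from $\overline{\mathbb R}=\mathbb R\cup\{\pm\infty\}$. $\mathcal B$ is the class of relatively compact Borel subsets of $E$. $M_p(E)$ is the set of Radon measures on $E$ taking values in $\mathbb Z_+$ on sets of $\mathcal B$, endowed with the topology of vague convergence ($\mu_n\to\mu$ iff $\mu_n(f)\to\mu(f)$ for all $f\in C_K^+(E)$, where $\mu(f)=\int f\,d\mu$ and $C_K^+(E)$ is the set of continuous compactly supported $f:E\to[0,\infty)$) and its Borel $\sigma$-field $\mathcal M_p(E)$. A point process on $E$ is a random element of $M_p(E)$; $N_n\stackrel d\to N$ means weak convergence of the laws on $M_p(E)$. A point process $N$ is infinitely divisible if for every $n\ge1$ it is equal in distribution to a sum of $n$ i.i.d. point processes; equivalently, there is a (unique) measure $\lambda$ on $M_p(E)$, called the canonical measure of $N$, with $\lambda(\{o\})=0$ ($o$ the null measure), $\int(1-e^{-\mu(B)})\lambda(d\mu)<\infty$ for all $B\in\mathcal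 B$, and $E(e^{-N(f)})=\exp\{-\int_{M_p(E)}(1-e^{-\mu(f)})\lambda(d\mu)\}$ for all measurable $f:E\to[0,\infty)$. A point $x$ is a fixed atom of $N$ if $P(N(\{x\})>0)>0$. Extremal index: a stationary sequence $(\eta_j)_{j\ge1}$ has extremal index $\theta\in[0,1]$ if for every $\tau>0$ there is a sequence $(u_n(\tau))_n$ with $nP(\eta_1>u_n(\tau))\to\tau$, and for every such sequence $P(\max_{j\le n}\eta_j\le u_n(\tau))\to e^{-\theta\tau}$. Notation: $[n/r_n]$ is the integer part; $M_0=M_p(E)\setminus\{o\}$; $\mathcal M_0=\{M\in\mathcal M_p(E): M\subset M_0\}$; for $x>0$, $[-x,x]^c:=\{y\in E:|y|>x\}$ and $M_x=\{\mu\in M_0:\mu([-x,x]^c)>0\}$. $\partial M$ is the topological boundary of $M$.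
   Formalization: The last claim is proved as μ(x,∞) = c·x^{-α} for some c, α > 0 (so c = μ(1,∞)); with constant 1 it fails, since (a_n) is determined only up to a constant factor, e.g. i.i.d. Pareto(α) with a_n = 2n^{1/α}. *)

theory Defs
  imports "HOL-Probability.Probability"
begin

section \<open>The state space\<close>

definition state_space :: "ereal set \<Rightarrow> bool" where
  "state_space E \<longleftrightarrow>
     (\<exists>a b :: real. 0 \<le> a \<and> a < b \<and>
        (E = {- ereal b ..< - ereal a} \<union> {ereal a <.. ereal b} \<or>
         E = {ereal a <.. ereal b} \<or>
         E = {- ereal b ..< - ereal a})) \<or>
     (\<exists>a :: real. 0 \<le> a \<and>
        (E = {- \<infinity> ..< - ereal a} \<union> {ereal a <.. \<infinity>} \<or>
         E = {ereal a <.. \<infinity>} \<or>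
         E = {- \<infinity> ..< - ereal a}))"

abbreviation borel_on :: "ereal set \<Rightarrow> ereal measure" where
  "borel_on E \<equiv> restrict_space borel E"

text \<open>The closure of \<open>B\<close> relative to \<open>E\<close> is \<open>E \<inter> closure B\<close>.\<close>

definition relcompact_borel :: "ereal set \<Rightarrow> ereal set set" where
  "relcompact_borel E = {B \<in> sets borel. B \<subseteq> E \<and> compact (E \<inter> closure B)}"

definition C_K_plus :: "ereal set \<Rightarrow> (ereal \<Rightarrow> real) set" where
  "C_K_plus E = {f. continuous_on E f \<and> (\<forall>x\<in>E. 0 \<le> f x) \<and>
                    compact (E \<inter> closure {x\<in>E. f x \<noteq> 0})}"


section \<open>Integer-valued Radon measures with the vague topology\<close>

text \<open>A measure that is integer-valued on relatively compact Borel sets is finite on compact sets;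
  as \<open>E\<close> is locally compact with countable base, such a measure is Radon.\<close>

definition Mp :: "ereal set \<Rightarrow> ereal measure set" where
  "Mp E = {m. sets m = sets (borel_on E) \<and>
              (\<forall>B\<in>relcompact_borel E. \<exists>k::nat. emeasure m B = of_nat k)}"

definition vague_topology :: "ereal set \<Rightarrow> ereal measure topology" where
  "vague_topology E = topology_generated_by
     {{m \<in> Mp E. (\<integral>x. f x \<partial>m) \<in> U} | f U. f \<in> C_K_plus E \<and> open U}"

definition Mp_borel :: "ereal set \<Rightarrow> ereal measure measure" where
  "Mp_borel E = sigma (Mp E) {U. openin (vague_topology E) U}"

abbreviation null_meas :: "ereal set \<Rightarrow> ereal measure" where
  "null_meas E \<equiv> null_measure (borel_on E)"

definition M0 :: "ereal set \<Rightarrow> ereal measure set" where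
  "M0 E = Mp E - {null_meas E}"

definition M0_sets :: "ereal set \<Rightarrow> ereal measure set set" where
  "M0_sets E = {M \<in> sets (Mp_borel E). M \<subseteq> M0 E}"

definition M_above :: "ereal set \<Rightarrow> real \<Rightarrow> ereal measure set" where
  "M_above E x = {m \<in> M0 E. emeasure m {y\<in>E. \<bar>y\<bar> > ereal x} > 0}"

definition sum_meas :: "ereal set \<Rightarrow> nat set \<Rightarrow> (nat \<Rightarrow> ereal measure) \<Rightarrow> ereal measure" where
  "sum_meas E J m = measure_of E (sets (borel_on E)) (\<lambda>B. \<Sum>j\<in>J. emeasure (m j) B)"

lemma emeasure_sum_meas:
  assumes fin: "finite J" and m: "\<And>j. j \<in> J \<Longrightarrow> sets (m j) = sets (borel_on E)"
    and B: "B \<in> sets (borel_on E)"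
  shows "emeasure (sum_meas E J m) B = (\<Sum>j\<in>J. emeasure (m j) B)"
proof -
  have sp: "sigma_algebra E (sets (borel_on E))"
    using sets.sigma_algebra_axioms[of "borel_on E"] by (simp add: space_restrict_space)
  have "(\<Sum>i. \<Sum>j\<in>J. emeasure (m j) (A i)) = (\<Sum>j\<in>J. emeasure (m j) (\<Union>i. A i))"
    if A: "range A \<subseteq> sets (borel_on E)" "disjoint_family A" for A :: "nat \<Rightarrow> ereal set"
  proof -
    have "(\<Sum>i. \<Sum>j\<in>J. emeasure (m j) (A i)) = (\<Sum>j\<in>J. \<Sum>i. emeasure (m j) (A i))"
      by (rule suminf_sum) (rule summableI)
    also have "\<dots> = (\<Sum>j\<in>J. emeasure (m j) (\<Union>i. A i))"
      by (rule sum.cong[OF refl], rule suminf_emeasure) (use A m in auto)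
    finally show ?thesis .
  qed
  then have "countably_additive (sets (borel_on E)) (\<lambda>B. \<Sum>j\<in>J. emeasure (m j) B)"
    unfolding countably_additive_def by blast
  then show ?thesis
    unfolding sum_meas_def using sp B
    by (intro emeasure_measure_of_sigma) (auto simp: positive_def)
qed

text \<open>\<open>return (borel_on E) x\<close> is the Dirac measure at \<open>x\<close>.\<close>

definition dirac_sum :: "ereal set \<Rightarrow> nat set \<Rightarrow> (nat \<Rightarrow> ereal) \<Rightarrow> ereal measure" where
  "dirac_sum E J x = sum_meas E J (\<lambda>j. return (borel_on E) (x j))"


section \<open>Point processes\<close>

text \<open>A point process on \<open>E\<close> is a measurable map from a probability space to \<open>Mp_borel E\<close>.\<close>

definition pp_law :: "ereal set \<Rightarrow> 'a measure \<Rightarrow> ('a \<Rightarrow> ereal measure) \<Rightarrow> ereal measure measure" where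
  "pp_law E P N = distr P (Mp_borel E) N"

text \<open>Weak convergence of Borel probability measures on a topological space.\<close>

definition weakly_converges ::
  "'a topology \<Rightarrow> (nat \<Rightarrow> 'a measure) \<Rightarrow> 'a measure \<Rightarrow> bool" where
  "weakly_converges T Q Q' \<longleftrightarrow>
     (\<forall>h. continuous_map T euclideanreal h \<and> bounded (h ` topspace T) \<longrightarrow>
          (\<lambda>n. \<integral>m. h m \<partial>Q n) \<longlonglongrightarrow> (\<integral>m. h m \<partial>Q'))"

text \<open>The sum of \<open>n\<close> independent point processes with common law \<open>Q\<close> is realised on the
  \<open>n\<close>-fold product of \<open>Q\<close>.\<close>

definition infinitely_divisible :: "ereal set \<Rightarrow> ereal measure measure \<Rightarrow> bool" where
  "infinitely_divisible E L \<longleftrightarrow>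
     (\<forall>n\<ge>1. \<exists>Q. prob_space Q \<and> sets Q = sets (Mp_borel E) \<and>
        L = distr (Pi\<^sub>M {1..n} (\<lambda>_. Q)) (Mp_borel E) (sum_meas E {1..n}))"

text \<open>The function \<open>t \<mapsto> exp (- t)\<close> on \<open>[0, \<infinity>]\<close>.\<close>

definition exp_neg :: "ennreal \<Rightarrow> real" where
  "exp_neg t = (if t = \<infinity> then 0 else exp (- enn2real t))"

definition canonical_measure ::
  "ereal set \<Rightarrow> ereal measure measure \<Rightarrow> ereal measure measure \<Rightarrow> bool" where
  "canonical_measure E L \<Lambda> \<longleftrightarrow>
     sets \<Lambda> = sets (Mp_borel E) \<and>
     emeasure \<Lambda> {null_meas E} = 0 \<and>
     (\<forall>B\<in>relcompact_borel E. (\<integral>\<^sup>+m. ennreal (1 - exp_neg (emeasure m B)) \<partial>\<Lambda>) < \<infinity>) \<and>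
     (\<forall>f :: ereal \<Rightarrow> real. f \<in> borel_measurable (borel_on E) \<and> (\<forall>x\<in>E. 0 \<le> f x) \<longrightarrow>
        (\<integral>m. exp_neg (\<integral>\<^sup>+x. ennreal (f x) \<partial>m) \<partial>L) =
        exp_neg (\<integral>\<^sup>+m. ennreal (1 - exp_neg (\<integral>\<^sup>+x. ennreal (f x) \<partial>m)) \<partial>\<Lambda>))"

definition fixed_atoms :: "ereal set \<Rightarrow> 'a measure \<Rightarrow> ('a \<Rightarrow> ereal measure) \<Rightarrow> ereal set" where
  "fixed_atoms E P N = {x\<in>E. measure P {\<omega>\<in>space P. emeasure (N \<omega>) {x} > 0} > 0}"


section \<open>Sequences of real random variables, indexed from 1\<close>

definition stationary :: "'a measure \<Rightarrow> (nat \<Rightarrow> 'a \<Rightarrow> real) \<Rightarrow> bool" where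
  "stationary P \<xi> \<longleftrightarrow>
     (\<forall>h m. distr P (Pi\<^sub>M {1..m} (\<lambda>_. borel)) (\<lambda>\<omega>. \<lambda>j\<in>{1..m}. \<xi> (j + h) \<omega>) =
            distr P (Pi\<^sub>M {1..m} (\<lambda>_. borel)) (\<lambda>\<omega>. \<lambda>j\<in>{1..m}. \<xi> j \<omega>))"

definition has_extremal_index :: "'a measure \<Rightarrow> (nat \<Rightarrow> 'a \<Rightarrow> real) \<Rightarrow> real \<Rightarrow> bool" where
  "has_extremal_index P \<eta> \<theta> \<longleftrightarrow>
     \<theta> \<in> {0..1} \<and>
     (\<forall>\<tau>>0.
        (\<exists>u :: nat \<Rightarrow> real. (\<lambda>n. real n * measure P {\<omega>\<in>space P. \<eta> 1 \<omega> > u n}) \<longlonglongrightarrow> \<tau>) \<and>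
        (\<forall>u :: nat \<Rightarrow> real. (\<lambda>n. real n * measure P {\<omega>\<in>space P. \<eta> 1 \<omega> > u n}) \<longlonglongrightarrow> \<tau> \<longrightarrow>
           (\<lambda>n. measure P {\<omega>\<in>space P. Max ((\<lambda>j. \<eta> j \<omega>) ` {1..n}) \<le> u n})
             \<longlonglongrightarrow> exp (- \<theta> * \<tau>)))"

definition regularly_varying :: "(real \<Rightarrow> real) \<Rightarrow> bool" where
  "regularly_varying f \<longleftrightarrow>
     f \<in> borel_measurable borel \<and> (\<forall>\<^sub>F t in at_top. f t > 0) \<and>
     (\<exists>\<rho>. \<forall>x>0. ((\<lambda>t. f (t * x) / f t) \<longlongrightarrow> x powr \<rho>) at_top)"

end

theory Submission
  imports Defs
begin

text \<open>The tail condition alone forces \<open>P(\<bar>\<xi>\<^sub>1\<bar> > x)\<close> to vary regularly and \<open>\<mu>(x, \<infinity>) = c x\<^sup>-\<^sup>\<alpha>\<close>; in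
  particular \<open>\<xi>\<^sub>1\<close> is unbounded, so \<open>E\<close> is one of the three unbounded spaces with \<open>a = 0\<close>.
  The vague topology is induced by countably many integrals, that is, by an embedding into
  \<open>[0, 1]\<^sup>\<nat>\<close>. There Stone--Weierstrass turns convergence of Laplace functionals of finite measures
  into convergence of the mass of continuity sets, without any tightness argument.
  By the mixing condition, \<open>N\<^sub>n \<rightarrow> N\<close> is equivalent to
  \<open>k\<^sub>n E(1 - exp (- N\<^bsub>r\<^sub>n,n\<^esub>(f))) \<rightarrow> \<integral> (1 - exp (- m(f))) \<lambda>(dm)\<close> for all \<open>f\<close>.
  Given this, comparing the maximum with steep ramp functions and using the extremal index yields
  \<open>\<lambda>(M\<^sub>x) = \<theta> \<mu>(x, \<infinity>)\<close> for every \<open>x\<close>; the right-hand side is continuous in \<open>x\<close>, so the block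
  measures restricted to \<open>M\<^sub>x\<close> converge for every \<open>x\<close>, also at fixed atoms. Conversely, integrating
  condition (b) over the level sets of \<open>1 - exp (- m(f))\<close> recovers the displayed limit.\<close>

section \<open>Function algebras and ramps\<close>

text \<open>The indicators of an exceedance and of \<open>M_above E x\<close> are not continuous
  functionals, and \<Lambda> may be infinite, so that only its restrictions to
  \<open>M_above E x\<close> can be compared with finite measures. The way around this is algebraic.
  With g = i * ramp, the product (1 - exp (- m(g))) * exp (- m(f)) is the difference of 1 - exp (-
  m(f + g)) and 1 - exp (- m(f)), two functionals whose limits are given. It replaces the indicator
  times exp (- m(f)) up to an error that does not involve f; this error disappears in the limit as
  soon as the scaled exceedance probabilities of the blocks are known to converge to the
  \<Lambda>-mass of \<open>M_above E x\<close>. The extremal index serves to identify this mass and,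
  through the continuity of the result, to obtain that convergence. The same rule for sums of test
  functions explains why the embedding uses exp (- m(f)) as coordinates: multiplying by a coordinate
  only shifts the test function, so convergence of Laplace functionals passes to all polynomials in
  the coordinates.\<close>

inductive_set gen_alg :: "('a \<Rightarrow> real) set \<Rightarrow> ('a \<Rightarrow> real) set" for G where
  const: "(\<lambda>_. c) \<in> gen_alg G"
| add: "F \<in> gen_alg G \<Longrightarrow> F' \<in> gen_alg G \<Longrightarrow> (\<lambda>x. F x + F' x) \<in> gen_alg G"
| gen_mult: "g \<in> G \<Longrightarrow> F \<in> gen_alg G \<Longrightarrow> (\<lambda>x. g x * F x) \<in> gen_alg G"

lemma gen_alg_scale: "F \<in> gen_alg G \<Longrightarrow> (\<lambda>x. c * F x) \<in> gen_alg G"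
proof (induction rule: gen_alg.induct)
  case (const d)
  show ?case using gen_alg.const[of "c * d" G] by simp
next
  case (add F F')
  then show ?case using gen_alg.add[OF add.IH] by (simp add: distrib_left)
next
  case (gen_mult g F)
  then show ?case using gen_alg.gen_mult[OF gen_mult.hyps(1) gen_mult.IH] by (simp add: mult.left_commute)
qed

text \<open>The rules of \<open>gen_alg\<close> multiply by one generator at a time, which suits the
  later inductions, where a generator is absorbed by a test function. Closure under all products is
  an induction on the left factor.\<close>

lemma gen_alg_mult:
  assumes "F \<in> gen_alg G" "F' \<in> gen_alg G"
  shows "(\<lambda>x. F x * F' x) \<in> gen_alg G"
  using assms(1)
proof (induction rule: gen_alg.induct)
  case (const c)
  show ?case using gen_alg_scale[OF assms(2)] .
next
  case (add F F')
  then show ?case using gen_alg.add[OF add.IH] by (simp add: distrib_right)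
next
  case (gen_mult g F)
  then show ?case using gen_alg.gen_mult[OF gen_mult.hyps(1) gen_mult.IH] by (simp add: mult.assoc)
qed

lemma gen_alg_continuous:
  assumes "\<And>g. g \<in> G \<Longrightarrow> continuous_on S g" and "F \<in> gen_alg G"
  shows "continuous_on S F"
  using assms(2) by (induction rule: gen_alg.induct) (auto intro: continuous_intros assms(1))

lemma gen_alg_dense:
  fixes G :: "('a::t2_space \<Rightarrow> real) set"
  assumes S: "compact S" and cont: "\<And>g. g \<in> G \<Longrightarrow> continuous_on S g"
    and sep: "\<And>x y. x \<in> S \<Longrightarrow> y \<in> S \<Longrightarrow> x \<noteq> y \<Longrightarrow> \<exists>g\<in>G. g x \<noteq> g y"
    and f: "continuous_on S f" and e: "e > 0"
  shows "\<exists>F\<in>gen_alg G. \<forall>x\<in>S. \<bar>f x - F x\<bar> < e"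
proof -
  have G: "g \<in> gen_alg G" if "g \<in> G" for g
    using gen_alg.gen_mult[OF that gen_alg.const[of 1]] by simp
  interpret function_ring_on "gen_alg G" S
  proof
    fix x y assume "x \<in> S" "y \<in> S" "x \<noteq> y"
    then show "\<exists>f\<in>gen_alg G. f x \<noteq> f y" using sep G by blast
  qed (use S gen_alg_continuous[OF cont] in \<open>auto intro: gen_alg.intros gen_alg_mult\<close>)
  show ?thesis using Stone_Weierstrass_basic[OF f e] by blast
qed

section \<open>Clamps and ramps on the extended real line\<close>

definition eclamp :: "real \<Rightarrow> real \<Rightarrow> ereal \<Rightarrow> real" where
  "eclamp p q y = real_of_ereal (max (ereal p) (min (ereal q) y))"

lemma ereal_eclamp: "ereal (eclamp p q y) = max (ereal p) (min (ereal q) y)"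
  unfolding eclamp_def by (cases y) (auto simp: max_def min_def)

lemma eclamp_bounds: "p \<le> q \<Longrightarrow> p \<le> eclamp p q y" "p \<le> q \<Longrightarrow> eclamp p q y \<le> q"
  by (cases y; auto simp: eclamp_def max_def min_def)+

text \<open>\<open>real_of_ereal\<close> sends both infinities to 0 and is discontinuous there;
  after clamping, its argument is finite, so continuity holds on the whole extended line.\<close>

lemma continuous_on_eclamp: "continuous_on A (eclamp p q)"
  unfolding eclamp_def
  by (rule continuous_on_compose2[OF continuous_on_real])
    (auto intro!: continuous_on_max continuous_on_min continuous_on_const continuous_on_id
      simp del: max_less_iff_conj, auto simp: max_def min_def split: if_splits)

definition ramp :: "real \<Rightarrow> real \<Rightarrow> ereal \<Rightarrow> real" where
  "ramp p q y = (eclamp p q \<bar>y\<bar> - p) / (q - p)"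

lemma ramp_bounds: "p < q \<Longrightarrow> 0 \<le> ramp p q y" "p < q \<Longrightarrow> ramp p q y \<le> 1"
  using eclamp_bounds[of p q "\<bar>y\<bar>"] by (auto simp: ramp_def)

lemma continuous_on_ramp: "continuous_on A (ramp p q)"
proof -
  have "continuous_on A (\<lambda>y. eclamp p q \<bar>y\<bar>)"
    by (rule continuous_on_compose2[OF continuous_on_eclamp[of UNIV]])
      (auto intro: continuous_intros)
  then show ?thesis
    unfolding ramp_def divide_inverse by (intro continuous_intros)
qed

lemma eclamp_less_iff: "p < q \<Longrightarrow> p < eclamp p q y \<longleftrightarrow> ereal p < y"
  by (cases y) (auto simp: eclamp_def max_def min_def)

lemma ramp_pos_iff: "p < q \<Longrightarrow> 0 < ramp p q y \<longleftrightarrow> ereal p < \<bar>y\<bar>"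
  using eclamp_less_iff[of p q "\<bar>y\<bar>"] by (simp add: ramp_def zero_less_divide_iff)

lemma ramp_eq_0: "p < q \<Longrightarrow> \<bar>y\<bar> \<le> ereal p \<Longrightarrow> ramp p q y = 0"
  using ramp_pos_iff[of p q y] ramp_bounds(1)[of p q y] by (simp add: leD order_less_le)

lemma ramp_eq_1: assumes "p < q" "ereal q \<le> \<bar>y\<bar>" shows "ramp p q y = 1"
proof -
  have "ereal (eclamp p q \<bar>y\<bar>) = ereal q"
    using assms by (simp only: ereal_eclamp) (simp add: min_absorb1 max_absorb2)
  then show ?thesis using assms(1) by (simp add: ramp_def)
qed

text \<open>Rational levels strictly between the two points suffice; this is what lets a countable
  family of test functions separate points.\<close>

lemma eclamp_separates:
  assumes "x \<noteq> y"
  shows "\<exists>p q. p \<in> \<rat> \<and> q \<in> \<rat> \<and> p < q \<and> eclamp p q x \<noteq> eclamp p q y"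
proof -
  have *: "\<exists>p q. p \<in> \<rat> \<and> q \<in> \<rat> \<and> p < q \<and> eclamp p q x < eclamp p q y" if xy: "x < y" for x y
  proof -
    obtain u where u: "x < ereal u" "ereal u < y" using ereal_dense2[OF xy] by blast
    obtain v where v: "ereal u < ereal v" "ereal v < y" using ereal_dense2[OF u(2)] by blast
    obtain p where p: "p \<in> \<rat>" "u < p" "p < v" using v(1) Rats_dense_in_real by auto
    obtain q where q: "q \<in> \<rat>" "p < q" "q < v" using p(3) Rats_dense_in_real by auto
    \<comment> \<open>The smaller point is clamped to p, the larger one stays above p.\<close>
    have "x < ereal p" using u(1) p(2) less_ereal.simps(1) less_trans by blast
    then have "\<not> p < eclamp p q x" using eclamp_less_iff[OF q(2)] by (simp add: not_less less_imp_le)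
    moreover have "ereal p < y" using v(2) p(3) less_ereal.simps(1) less_trans by blast
    then have "p < eclamp p q y" using eclamp_less_iff[OF q(2)] by simp
    ultimately show ?thesis using p q by (intro exI[of _ p] exI[of _ q]) auto
  qed
  from assms consider "x < y" | "y < x" by (metis linorder_neqE)
  then show ?thesis by cases (metis * less_irrefl)+
qed

section \<open>Spaces punctured at 0 and their compactly supported functions\<close>

locale punctured_space =
  fixes E :: "ereal set"
  assumes open_E: "open E" and zero_notin: "0 \<notin> E"
    and closed_away: "\<And>e::real. e > 0 \<Longrightarrow> closed (E \<inter> {y. ereal e \<le> \<bar>y\<bar>})"
begin

definition away :: "real \<Rightarrow> ereal set" where
  "away e = E \<inter> {y. ereal e \<le> \<bar>y\<bar>}"

lemma E_borel [measurable]: "E \<in> sets borel"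
  using open_E by simp

text \<open>The extended real line is compact, so closedness suffices. Within \<open>E\<close>,
  relatively compact thus means bounded away from 0, and points at infinity need no special
  care.\<close>

lemma compact_away: "e > 0 \<Longrightarrow> compact (away e)"
  using closed_away compact_eq_closed by (auto simp: away_def)

lemma relcompact_away: "e > 0 \<Longrightarrow> away e \<in> relcompact_borel E"
  using closed_away[of e] compact_away[of e] unfolding relcompact_borel_def away_def
  by (auto simp: closure_closed Int_absorb1)

lemma C_K_plusI:
  assumes "continuous_on E f" "\<And>x. x \<in> E \<Longrightarrow> 0 \<le> f x" "e > 0"
    "\<And>x. x \<in> E \<Longrightarrow> \<bar>x\<bar> < ereal e \<Longrightarrow> f x = 0"
  shows "f \<in> C_K_plus E"
proof -
  have "{x \<in> E. f x \<noteq> 0} \<subseteq> away e" 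
  proof
    fix x assume "x \<in> {x \<in> E. f x \<noteq> 0}"
    then show "x \<in> away e" using assms(4)[of x] unfolding away_def by (simp add: not_less) (meson not_less)
  qed
  then have "closure {x \<in> E. f x \<noteq> 0} \<subseteq> away e"
    using closed_away[OF assms(3)] unfolding away_def by (rule closure_minimal)
  then have "E \<inter> closure {x \<in> E. f x \<noteq> 0} = closure {x \<in> E. f x \<noteq> 0}"
    unfolding away_def by blast
  then have "compact (E \<inter> closure {x \<in> E. f x \<noteq> 0})"
    by (simp add: compact_eq_closed)
  then show ?thesis using assms(1,2) unfolding C_K_plus_def by blast
qed

text \<open>On the compact support the distance from 0 attains its minimum, which is positive
  because 0 is not in \<open>E\<close>; any e below it works. Together with \<open>C_K_plusI\<close>
  this replaces compact support by vanishing near 0.\<close>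

lemma C_K_plusD:
  assumes "f \<in> C_K_plus E"
  obtains e :: real where "e > 0" "\<And>x. x \<in> E \<Longrightarrow> \<bar>x\<bar> < ereal e \<Longrightarrow> f x = 0"
proof -
  let ?K = "E \<inter> closure {x \<in> E. f x \<noteq> 0}"
  have sub: "x \<in> ?K" if "x \<in> E" "f x \<noteq> 0" for x
    using that closure_subset[of "{x \<in> E. f x \<noteq> 0}"] by blast
  show ?thesis
  proof (cases "?K = {}")
    case True
    show ?thesis
    proof (rule that[of 1])
      fix x assume "x \<in> E"
      then show "f x = 0" using sub[of x] True by blast
    qed simp
  next
    case False
    have K: "compact ?K" using assms by (simp add: C_K_plus_def)
    have "continuous_on ?K (\<lambda>x::ereal. \<bar>x\<bar>)" by (intro continuous_intros)
    from continuous_attains_inf[OF K False this]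
    obtain x0 where x0: "x0 \<in> ?K" "\<And>y. y \<in> ?K \<Longrightarrow> \<bar>x0\<bar> \<le> \<bar>y\<bar>" by blast
    have "x0 \<noteq> 0" using x0(1) zero_notin by blast
    then have "0 < \<bar>x0\<bar>" by (cases x0) auto
    then obtain e where e: "0 < ereal e" "ereal e < \<bar>x0\<bar>" using ereal_dense2[of 0 "\<bar>x0\<bar>"] by blast
    show ?thesis
    proof (rule that[of e])
      fix x assume "x \<in> E" "\<bar>x\<bar> < ereal e"
      have "\<not> \<bar>x0\<bar> \<le> \<bar>x\<bar>"
        using order.strict_trans[OF \<open>\<bar>x\<bar> < ereal e\<close> e(2)] by (simp only: not_le)
      then show "f x = 0" using sub[OF \<open>x \<in> E\<close>] x0(2)[of x] by blast
    qed (use e in simp)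
  qed
qed

lemma C_K_plus_bounded:
  assumes "f \<in> C_K_plus E"
  obtains c :: real where "c > 0" "\<And>x. x \<in> E \<Longrightarrow> 0 \<le> f x" "\<And>x. x \<in> E \<Longrightarrow> f x \<le> c"
proof -
  obtain e :: real where e: "e > 0" "\<And>x. x \<in> E \<Longrightarrow> \<bar>x\<bar> < ereal e \<Longrightarrow> f x = 0"
    using C_K_plusD[OF assms] by blast
  have f: "continuous_on E f" "\<And>x. x \<in> E \<Longrightarrow> 0 \<le> f x" using assms by (auto simp: C_K_plus_def)
  have "bounded (f ` away e)"
    by (intro compact_imp_bounded compact_continuous_image compact_away e continuous_on_subset[OF f(1)])
      (auto simp: away_def)
  then obtain c where c: "\<And>x. x \<in> away e \<Longrightarrow> \<bar>f x\<bar> \<le> c" "c > 0" unfolding bounded_pos by auto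
  have "f x \<le> c" if "x \<in> E" for x
    using c e that by (cases "\<bar>x\<bar> < ereal e") (auto simp: away_def not_less abs_le_iff)
  then show ?thesis using that c f by blast
qed

lemma C_K_plus_measurable: "f \<in> C_K_plus E \<Longrightarrow> f \<in> borel_measurable (borel_on E)"
  unfolding C_K_plus_def by (auto intro: borel_measurable_continuous_on_restrict)

lemma C_K_plus_zero: "(\<lambda>_. 0) \<in> C_K_plus E"
  by (rule C_K_plusI[of _ 1]) auto

lemma C_K_plus_add: assumes "f \<in> C_K_plus E" "g \<in> C_K_plus E" shows "(\<lambda>x. f x + g x) \<in> C_K_plus E"
proof -
  obtain e e' :: real where e: "e > 0" "\<And>x. x \<in> E \<Longrightarrow> \<bar>x\<bar> < ereal e \<Longrightarrow> f x = 0"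
    "e' > 0" "\<And>x. x \<in> E \<Longrightarrow> \<bar>x\<bar> < ereal e' \<Longrightarrow> g x = 0"
    using C_K_plusD assms by metis
  show ?thesis
    by (rule C_K_plusI[of _ "min e e'"]) (use assms e in \<open>auto simp: C_K_plus_def intro!: continuous_intros\<close>)
qed

lemma C_K_plus_scale: assumes "f \<in> C_K_plus E" "c \<ge> 0" shows "(\<lambda>x. c * f x) \<in> C_K_plus E"
proof -
  obtain e :: real where e: "e > 0" "\<And>x. x \<in> E \<Longrightarrow> \<bar>x\<bar> < ereal e \<Longrightarrow> f x = 0"
    using C_K_plusD assms by metis
  show ?thesis
    by (rule C_K_plusI[of _ e]) (use assms e in \<open>auto simp: C_K_plus_def intro!: continuous_intros\<close>)
qed

lemma ramp_C_K_plus: "0 < p \<Longrightarrow> p < q \<Longrightarrow> ramp p q \<in> C_K_plus E"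
  by (rule C_K_plusI[of _ p]) (auto intro: continuous_on_ramp ramp_bounds ramp_eq_0)

lemma Mp_D:
  assumes "m \<in> Mp E"
  shows "sets m = sets (borel_on E)" "space m = E" "e > 0 \<Longrightarrow> \<exists>k::nat. emeasure m (away e) = of_nat k"
    "away e \<in> sets m"
proof -
  show *: "sets m = sets (borel_on E)" using assms by (auto simp: Mp_def)
  show "space m = E" using sets_eq_imp_space_eq[OF *] by (simp add: space_restrict_space)
  show "e > 0 \<Longrightarrow> \<exists>k::nat. emeasure m (away e) = of_nat k"
    using assms relcompact_away by (auto simp: Mp_def)
  show "away e \<in> sets m" unfolding * away_def
    by (subst Int_commute, rule sets_restrict_space_iff[THEN iffD2]) auto
qed

lemma C_K_plus_integrable:
  assumes m: "m \<in> Mp E" and f: "f \<in> C_K_plus E"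
  shows "integrable m f"
proof -
  obtain e :: real where e: "e > 0" "\<And>x. x \<in> E \<Longrightarrow> \<bar>x\<bar> < ereal e \<Longrightarrow> f x = 0"
    using C_K_plusD[OF f] by blast
  obtain c :: real where c: "c > 0" "\<And>x. x \<in> E \<Longrightarrow> 0 \<le> f x" "\<And>x. x \<in> E \<Longrightarrow> f x \<le> c"
    using C_K_plus_bounded[OF f] by blast
  have mf: "f \<in> borel_measurable m"
    using C_K_plus_measurable[OF f] measurable_cong_sets[OF Mp_D(1)[OF m] refl] by blast
  have fin: "emeasure m (away e) < \<infinity>"
    using Mp_D(3)[OF m e(1)] by (auto simp: ennreal_of_nat_eq_real_of_nat)
  show ?thesis
  proof (rule Bochner_Integration.integrable_bound)
    show "integrable m (\<lambda>x. c * indicator (away e) x)"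
      using fin Mp_D(4)[OF m] by (intro integrable_mult_right) (auto intro!: integrable_real_indicator)
    show "AE x in m. norm (f x) \<le> norm (c * indicator (away e) x :: real)"
      using c e(2) Mp_D(2)[OF m] by (intro AE_I2) (auto simp: away_def indicator_def)
  qed fact
qed

lemma integral_C_K_plus_nonneg: "m \<in> Mp E \<Longrightarrow> f \<in> C_K_plus E \<Longrightarrow> 0 \<le> (\<integral>x. f x \<partial>m)"
  by (rule Bochner_Integration.integral_nonneg) (auto simp: Mp_D(2) C_K_plus_def)

end

section \<open>The vague topology\<close>

lemma borel_measurable_exp_uminus:
  fixes u :: "'a \<Rightarrow> real"
  shows "u \<in> borel_measurable M \<Longrightarrow> (\<lambda>x. exp (- u x)) \<in> borel_measurable M"
  by measurable

section \<open>A countable family of test functions and the embedding it induces\<close>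

context punctured_space
begin

text \<open>A cutoff away from 0 times a monomial in clamps with rational levels. Subtracting p
  makes every factor nonnegative, so each product stays in \<open>C_K_plus E\<close>; with constants
  and sums, the monomials make up the algebra that Stone-Weierstrass needs.\<close>

definition test_fun :: "nat \<Rightarrow> (rat \<times> rat) list \<Rightarrow> ereal \<Rightarrow> real" where
  "test_fun n L y = ramp (1 / (real n + 2)) (1 / (real n + 1)) y *
     (\<Prod>(p, q)\<leftarrow>L. eclamp (real_of_rat p) (real_of_rat q) y - real_of_rat p)"

definition base_fun :: "nat \<Rightarrow> ereal \<Rightarrow> real" where
  "base_fun i = case_prod test_fun (from_nat i)"

lemma base_funE: obtains i where "test_fun n L = base_fun i"
  using that[of "to_nat (n, L)"] by (simp add: base_fun_def)

lemma test_fun_C_K_plus: "test_fun n L \<in> C_K_plus E"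
proof (rule C_K_plusI)
  have lt: "1 / (real n + 2) < 1 / (real n + 1)" by (simp add: field_simps)
  \<comment> \<open>The maximum with p is outermost in \<open>eclamp\<close>, so the bound also
    holds for q < p; the list may contain such pairs.\<close>
  have eclamp_ge: "p \<le> eclamp p q y" for p q y
    by (cases y) (auto simp: eclamp_def max_def min_def)
  have "continuous_on E (\<lambda>y. \<Prod>(p, q)\<leftarrow>L. eclamp (real_of_rat p) (real_of_rat q) y - real_of_rat p)"
    by (induction L) (auto intro!: continuous_intros continuous_on_eclamp)
  then show "continuous_on E (test_fun n L)"
    unfolding test_fun_def by (intro continuous_on_mult continuous_on_ramp)
  show "0 \<le> test_fun n L x" for x
    unfolding test_fun_def using ramp_bounds(1)[OF lt] eclamp_ge
    by (intro mult_nonneg_nonneg prod_list_nonneg) auto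
  show "test_fun n L x = 0" if "\<bar>x\<bar> < ereal (1 / (real n + 2))" for x
    using ramp_eq_0[OF lt, of x] that unfolding test_fun_def by simp
qed simp

text \<open>The exponential confines the coordinates to [0, 1] and turns sums of test functions into
  products of coordinates.\<close>

definition embed :: "ereal measure \<Rightarrow> nat \<Rightarrow> real" where
  "embed m = (\<lambda>i. exp (- (\<integral>x. base_fun i x \<partial>m)))"

lemma base_fun_C_K_plus: "base_fun i \<in> C_K_plus E"
  unfolding base_fun_def by (simp split: prod.split add: test_fun_C_K_plus)

lemma embed_bounds: "m \<in> Mp E \<Longrightarrow> embed m i \<in> {0..1}"
  using integral_C_K_plus_nonneg[OF _ base_fun_C_K_plus] by (simp add: embed_def)

abbreviation embed_top :: "ereal measure topology" where
  "embed_top \<equiv> pullback_topology (Mp E) embed euclidean"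

lemma topspace_embed_top: "topspace embed_top = Mp E"
  by (simp add: topspace_pullback_topology)

lemma topspace_vague: "topspace (vague_topology E) = Mp E"
proof -
  have "{m \<in> Mp E. (\<integral>x. (\<lambda>_. 0) x \<partial>m) \<in> (UNIV :: real set)} \<in>
    {{m \<in> Mp E. (\<integral>x. f x \<partial>m) \<in> U} | f U. f \<in> C_K_plus E \<and> open U}"
    using C_K_plus_zero open_UNIV by blast
  then show ?thesis
    unfolding vague_topology_def topology_generated_by_topspace by auto
qed

lemma vague_open_subset: "openin (vague_topology E) U \<Longrightarrow> U \<subseteq> Mp E"
  using openin_subset topspace_vague by metis

lemma continuous_map_real_iff:
  "continuous_map X euclideanreal h \<longleftrightarrow> (\<forall>U. open U \<longrightarrow> openin X {x \<in> topspace X. h x \<in> U})"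
  by (auto simp: continuous_map_def)

lemma vague_continuous_integral:
  "f \<in> C_K_plus E \<Longrightarrow> continuous_map (vague_topology E) euclideanreal (\<lambda>m. \<integral>x. f x \<partial>m)"
  unfolding continuous_map_real_iff topspace_vague
  unfolding vague_topology_def by (auto intro!: topology_generated_by_Basis)

text \<open>The coordinates of \<open>embed\<close> are strictly positive, so - ln recovers the
  integral continuously.\<close>

lemma embed_continuous_base: "continuous_map embed_top euclideanreal (\<lambda>m. \<integral>x. base_fun i x \<partial>m)"
proof -
  have 1: "continuous_map embed_top euclideanreal ((\<lambda>y. y i) \<circ> embed)"
    by (rule continuous_map_pullback) (simp only: continuous_map_iff_continuous2 continuous_on_product_coordinates)
  have 2: "((\<lambda>y. y i) \<circ> embed) ` topspace embed_top \<subseteq> {0<..}"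
    by (rule image_subsetI) (simp only: comp_def embed_def greaterThan_iff exp_gt_zero)
  have 3: "continuous_map embed_top (top_of_set {0<..}) ((\<lambda>y. y i) \<circ> embed)"
    using 1 2 by (simp only: continuous_map_in_subtopology image_subset_iff_funcset)
  have 4: "continuous_map (top_of_set {0<..}) euclideanreal (\<lambda>x::real. - ln x)"
    unfolding continuous_map_iff_continuous
    by (rule continuous_on_minus, rule continuous_on_ln, rule continuous_on_id) simp
  have 5: "(\<lambda>x. - ln x) \<circ> ((\<lambda>y. y i) \<circ> embed) = (\<lambda>m. \<integral>x. base_fun i x \<partial>m)"
    by (rule ext) (simp only: comp_def embed_def ln_exp minus_minus)
  show ?thesis using continuous_map_compose[OF 3 4] unfolding 5 .
qed

lemma embed_continuous_test: "continuous_map embed_top euclideanreal (\<lambda>m. \<integral>x. test_fun n L x \<partial>m)"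
  using base_funE[of n L] embed_continuous_base by metis

text \<open>The induction varies the list \<open>L\<close>: a generator is absorbed as one more
  entry of \<open>L\<close>, so only constants and sums remain to be treated.\<close>

lemma embed_continuous_gen_alg:
  assumes "F \<in> gen_alg {\<lambda>y. eclamp (real_of_rat p) (real_of_rat q) y - real_of_rat p | p q. True}"
  shows "(\<forall>m\<in>Mp E. integrable m (\<lambda>x. F x * test_fun n L x)) \<and>
    continuous_map embed_top euclideanreal (\<lambda>m. \<integral>x. F x * test_fun n L x \<partial>m)"
  using assms
proof (induction arbitrary: L rule: gen_alg.induct)
  case (const c)
  show ?case
    using C_K_plus_integrable[OF _ test_fun_C_K_plus]
      continuous_map_real_mult_left[OF embed_continuous_test] by simp
next
  case (add F F')
  have int: "integrable m (\<lambda>x. F x * test_fun n L x)" "integrable m (\<lambda>x. F' x * test_fun n L x)"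
    if "m \<in> Mp E" for m
    using add.IH that by blast+
  have "continuous_map embed_top euclideanreal
    (\<lambda>m. (\<integral>x. F x * test_fun n L x \<partial>m) + (\<integral>x. F' x * test_fun n L x \<partial>m))"
    using add.IH by (intro continuous_map_add) blast+
  then have "continuous_map embed_top euclideanreal
    (\<lambda>m. \<integral>x. F x * test_fun n L x + F' x * test_fun n L x \<partial>m)"
    by (rule continuous_map_eq) (simp add: topspace_embed_top int)
  with int show ?case by (simp add: distrib_right)
next
  case (gen_mult g F)
  then obtain p q where g: "g = (\<lambda>y. eclamp (real_of_rat p) (real_of_rat q) y - real_of_rat p)" by blast
  have "(\<lambda>x. F x * test_fun n ((p, q) # L) x) = (\<lambda>x. g x * F x * test_fun n L x)"
    by (simp add: g test_fun_def fun_eq_iff)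
  then show ?case using gen_mult.IH[of "(p, q) # L"] by metis
qed

text \<open>For a cutoff g that is 1 wherever f is nonzero, f = f * g, and Stone-Weierstrass on a
  compact set outside which g vanishes replaces f by some F. The error is a small multiple of the
  integral of g, which is itself continuous and hence locally bounded.\<close>

lemma embed_continuous_integral:
  assumes f: "f \<in> C_K_plus E"
  shows "continuous_map embed_top euclideanreal (\<lambda>m. \<integral>x. f x \<partial>m)"
  unfolding continuous_map_real_iff topspace_embed_top
proof (intro allI impI)
  fix U :: "real set" assume U: "open U"
  obtain e :: real where e: "e > 0" "\<And>x. x \<in> E \<Longrightarrow> \<bar>x\<bar> < ereal e \<Longrightarrow> f x = 0"
    using C_K_plusD[OF f] by blast
  \<comment> \<open>This makes the cutoff \<open>g\<close> equal to 1 wherever |x| is at least e,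
    hence wherever f is nonzero.\<close>
  obtain n :: nat where n: "1 / (real n + 1) < e"
    using e(1) reals_Archimedean[of e] by (auto simp: inverse_eq_divide add.commute)
  define G where "G = {\<lambda>y. eclamp (real_of_rat p) (real_of_rat q) y - real_of_rat p | p q. True}"
  define g where "g = test_fun n []"
  define S where "S = away (1 / (real n + 2))"
  have lt: "1 / (real n + 2) < 1 / (real n + 1)" by (simp add: field_simps)
  have g_ramp: "g = ramp (1 / (real n + 2)) (1 / (real n + 1))"
    by (simp add: g_def test_fun_def fun_eq_iff)
  have gC: "g \<in> C_K_plus E" unfolding g_def by (rule test_fun_C_K_plus)
  have fS: "continuous_on S f"
    using f by (auto simp: C_K_plus_def S_def away_def intro: continuous_on_subset)
  have dense: "\<exists>F\<in>gen_alg G. \<forall>x\<in>S. \<bar>f x - F x\<bar> < d" if "d > 0" for d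
  proof (rule gen_alg_dense[OF _ _ _ fS that])
    show "compact S" unfolding S_def by (rule compact_away) simp
    show "continuous_on S h" if "h \<in> G" for h
      using that unfolding G_def by (auto intro!: continuous_intros continuous_on_eclamp)
    show "\<exists>h\<in>G. h x \<noteq> h y" if xy: "x \<noteq> y" for x y
    proof -
      obtain p q where "p \<in> \<rat>" "q \<in> \<rat>" "eclamp p q x \<noteq> eclamp p q y"
        using eclamp_separates[OF xy] by blast
      then obtain p' q' where "eclamp (real_of_rat p') (real_of_rat q') x \<noteq> eclamp (real_of_rat p') (real_of_rat q') y"
        by (metis Rats_cases)
      then show ?thesis unfolding G_def
        by (intro bexI[of _ "\<lambda>y. eclamp (real_of_rat p') (real_of_rat q') y - real_of_rat p'"]) auto
    qed
  qed
  have f_eq: "f x = f x * g x" if "x \<in> E" for x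
  proof (cases "\<bar>x\<bar> < ereal e")
    case False
    then have 1: "ereal e \<le> \<bar>x\<bar>" by (simp only: not_less)
    have "ereal (1 / (real n + 1)) \<le> ereal e" using n by simp
    from order_trans[OF this 1] have "ereal (1 / (real n + 1)) \<le> \<bar>x\<bar>" .
    then show ?thesis using ramp_eq_1[OF lt] g_ramp by simp
  qed (use e that in simp)
  have g_off: "g x = 0" if "x \<in> E" "x \<notin> S" for x
    using that ramp_eq_0[OF lt, of x] by (auto simp: g_ramp S_def away_def)
  have g0: "g x \<ge> 0" for x using ramp_bounds(1)[OF lt] by (simp add: g_ramp)
  show "openin embed_top {m \<in> Mp E. (\<integral>x. f x \<partial>m) \<in> U}"
  proof (subst openin_subopen, intro ballI)
    fix m0 assume "m0 \<in> {m \<in> Mp E. (\<integral>x. f x \<partial>m) \<in> U}"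
    then have m0: "m0 \<in> Mp E" and "(\<integral>x. f x \<partial>m0) \<in> U" by auto
    then obtain d where d: "d > 0" "\<And>t. dist t (\<integral>x. f x \<partial>m0) < d \<Longrightarrow> t \<in> U"
      using U[unfolded open_dist, rule_format, of "\<integral>x. f x \<partial>m0"] by blast
    \<comment> \<open>The set \<open>V\<close> below keeps the integral of g under \<open>c\<close>.
      With precision d / (4 * c), replacing f by F * g then costs at most d / 4 at m and at m0; the
      remaining d / 2 is the allowed move of the integral of F * g.\<close>
    define c where "c = (\<integral>x. g x \<partial>m0) + 1"
    have c: "c \<ge> 1" unfolding c_def using integral_C_K_plus_nonneg[OF m0 gC] by simp
    obtain F where F: "F \<in> gen_alg G" "\<And>x. x \<in> S \<Longrightarrow> \<bar>f x - F x\<bar> < d / (4 * c)"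
      using dense[of "d / (4 * c)"] d c by auto
    have FI: "integrable m (\<lambda>x. F x * g x)" if "m \<in> Mp E" for m
      using embed_continuous_gen_alg[of F n "[]"] F that unfolding g_def G_def by blast
    have Fc: "continuous_map embed_top euclideanreal (\<lambda>m. \<integral>x. F x * g x \<partial>m)"
      using embed_continuous_gen_alg[of F n "[]"] F unfolding g_def G_def by blast
    have gc: "continuous_map embed_top euclideanreal (\<lambda>m. \<integral>x. g x \<partial>m)"
      unfolding g_def by (rule embed_continuous_test)
    have bound: "\<bar>(\<integral>x. f x \<partial>m) - (\<integral>x. F x * g x \<partial>m)\<bar> \<le> d / (4 * c) * (\<integral>x. g x \<partial>m)"
      if m: "m \<in> Mp E" for m
    proof -
      have "\<bar>(\<integral>x. f x \<partial>m) - (\<integral>x. F x * g x \<partial>m)\<bar> = \<bar>\<integral>x. f x - F x * g x \<partial>m\<bar>"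
        using C_K_plus_integrable[OF m f] FI[OF m] by simp
      also have "\<dots> \<le> (\<integral>x. \<bar>f x - F x * g x\<bar> \<partial>m)" by (rule integral_abs_bound)
      also have "\<dots> \<le> (\<integral>x. d / (4 * c) * g x \<partial>m)"
      proof (rule integral_mono)
        fix x assume "x \<in> space m"
        then have x: "x \<in> E" using Mp_D(2)[OF m] by simp
        have "f x - F x * g x = (f x - F x) * g x"
          unfolding left_diff_distrib f_eq[OF x, symmetric] ..
        then have "\<bar>f x - F x * g x\<bar> = \<bar>f x - F x\<bar> * g x"
          using g0[of x] by (simp only: abs_mult abs_of_nonneg)
        also have "\<dots> \<le> d / (4 * c) * g x"
          using mult_right_mono[OF less_imp_le[OF F(2)] g0, of x x] g_off[OF x] by (cases "x \<in> S") auto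
        finally show "\<bar>f x - F x * g x\<bar> \<le> d / (4 * c) * g x" .
      qed (use C_K_plus_integrable[OF m] FI[OF m] f gC in auto)
      finally show ?thesis by simp
    qed
    define V where "V = {m \<in> Mp E. (\<integral>x. g x \<partial>m) \<in> {..<c}} \<inter>
      {m \<in> Mp E. (\<integral>x. F x * g x \<partial>m) \<in> ball (\<integral>x. F x * g x \<partial>m0) (d / 2)}"
    have "openin embed_top V"
      unfolding V_def using gc[unfolded continuous_map_real_iff] Fc[unfolded continuous_map_real_iff]
      unfolding topspace_embed_top by (intro openin_Int) (blast intro: open_lessThan open_ball)+
    moreover have "m0 \<in> V" unfolding V_def c_def using m0 d(1) by simp
    moreover have "m \<in> {m \<in> Mp E. (\<integral>x. f x \<partial>m) \<in> U}" if "m \<in> V" for m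
    proof -
      have m: "m \<in> Mp E" "(\<integral>x. g x \<partial>m) < c"
        "\<bar>(\<integral>x. F x * g x \<partial>m) - (\<integral>x. F x * g x \<partial>m0)\<bar> < d / 2"
        using that by (auto simp: V_def dist_real_def abs_minus_commute)
      have "d / (4 * c) * (\<integral>x. g x \<partial>m) \<le> d / (4 * c) * c" "d / (4 * c) * (\<integral>x. g x \<partial>m0) \<le> d / (4 * c) * c"
        using m(2) c d(1) by (intro mult_left_mono; simp add: c_def)+
      moreover have "d / (4 * c) * c = d / 4" using c by simp
      ultimately have "\<bar>(\<integral>x. f x \<partial>m) - (\<integral>x. F x * g x \<partial>m)\<bar> \<le> d / 4"
         "\<bar>(\<integral>x. f x \<partial>m0) - (\<integral>x. F x * g x \<partial>m0)\<bar> \<le> d / 4"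
        using bound[OF m(1)] bound[OF m0] by linarith+
      then have "dist (\<integral>x. f x \<partial>m) (\<integral>x. f x \<partial>m0) < d"
        using m(3) unfolding dist_real_def by linarith
      then show ?thesis using m(1) d(2) by blast
    qed
    ultimately show "\<exists>V. openin embed_top V \<and> m0 \<in> V \<and> V \<subseteq> {m \<in> Mp E. (\<integral>x. f x \<partial>m) \<in> U}"
      by blast
  qed
qed

text \<open>The vague topology is the coarsest one that makes all the integrals continuous, and they
  are continuous for the topology pulled back along \<open>embed\<close>. Measurability and the
  portmanteau argument both rest on this.\<close>

lemma vague_openE:
  assumes "openin (vague_topology E) U"
  obtains W where "open W" "U = {m \<in> Mp E. embed m \<in> W}"
proof -
  have "continuous_map embed_top (vague_topology E) (\<lambda>m. m)"
    unfolding vague_topology_def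
  proof (rule continuous_on_generated_topo)
    fix V assume "V \<in> {{m \<in> Mp E. (\<integral>x. f x \<partial>m) \<in> U} | f U. f \<in> C_K_plus E \<and> open U}"
    then obtain f U where "V = {m \<in> Mp E. (\<integral>x. f x \<partial>m) \<in> U}" "f \<in> C_K_plus E" "open U" by blast
    then show "openin embed_top ((\<lambda>m. m) -` V \<inter> topspace embed_top)"
      using embed_continuous_integral[of f] unfolding continuous_map_real_iff topspace_embed_top
      by (auto intro: back_subst[of "openin embed_top"])
  next
    show "(\<lambda>m. m) ` topspace embed_top \<subseteq>
        \<Union> {{m \<in> Mp E. (\<integral>x. f x \<partial>m) \<in> U} | f U. f \<in> C_K_plus E \<and> open U}"
      using topspace_vague unfolding vague_topology_def topology_generated_by_topspace
      by (simp add: topspace_embed_top)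
  qed
  then have "openin embed_top {m \<in> topspace embed_top. m \<in> U}"
    using assms unfolding continuous_map_def by blast
  moreover have "{m \<in> topspace embed_top. m \<in> U} = U"
    using openin_subset[OF assms] by (auto simp: topspace_embed_top topspace_vague)
  ultimately obtain W where W: "open W" "U = embed -` W \<inter> Mp E"
    by (auto simp: openin_pullback_topology)
  show ?thesis by (rule that[OF W(1)]) (use W(2) in blast)
qed

section \<open>The Borel field of the vague topology\<close>

lemma space_Mp_borel [simp]: "space (Mp_borel E) = Mp E"
  unfolding Mp_borel_def by (rule space_measure_of) (auto dest: vague_open_subset)

lemma sets_Mp_borel: "sets (Mp_borel E) = sigma_sets (Mp E) {U. openin (vague_topology E) U}"
  unfolding Mp_borel_def by (rule sets_measure_of) (auto dest: vague_open_subset)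

lemma vague_open_sets: "openin (vague_topology E) U \<Longrightarrow> U \<in> sets (Mp_borel E)"
  by (auto simp: sets_Mp_borel)

lemma vague_closed_sets: "closedin (vague_topology E) U \<Longrightarrow> U \<in> sets (Mp_borel E)"
proof -
  assume U: "closedin (vague_topology E) U"
  then have "Mp E - (Mp E - U) = U" "openin (vague_topology E) (Mp E - U)"
    by (auto simp: closedin_def topspace_vague)
  then show ?thesis using sets.compl_sets[OF vague_open_sets] space_Mp_borel by metis
qed

lemma vague_continuous_measurable:
  assumes "continuous_map (vague_topology E) euclideanreal h"
  shows "h \<in> borel_measurable (Mp_borel E)"
proof (rule borel_measurableI)
  fix U :: "real set" assume "open U"
  then show "h -` U \<inter> space (Mp_borel E) \<in> sets (Mp_borel E)"
    using vague_open_sets[of "{x \<in> Mp E. h x \<in> U}"] assms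
    unfolding continuous_map_real_iff topspace_vague by (simp add: vimage_def Int_def conj_commute)
qed

lemma measurable_integral [measurable]:
  "f \<in> C_K_plus E \<Longrightarrow> (\<lambda>m. \<integral>x. f x \<partial>m) \<in> borel_measurable (Mp_borel E)"
  by (rule vague_continuous_measurable[OF vague_continuous_integral])

text \<open>A vaguely open set may be an uncountable union of basic ones, which measurability of the
  integrals alone does not reach. Through \<open>embed\<close> it is the preimage of an open set in
  a countable product, where measurability can be checked coordinatewise.\<close>

lemma measurable_Mp_borel:
  assumes "\<And>\<omega>. \<omega> \<in> space P \<Longrightarrow> X \<omega> \<in> Mp E"
    and "\<And>f. f \<in> C_K_plus E \<Longrightarrow> (\<lambda>\<omega>. \<integral>x. f x \<partial>X \<omega>) \<in> borel_measurable P"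
  shows "X \<in> measurable P (Mp_borel E)"
  unfolding Mp_borel_def
proof (rule measurable_measure_of)
  show "{U. openin (vague_topology E) U} \<subseteq> Pow (Mp E)"
    by (auto dest: vague_open_subset)
  show "X \<in> space P \<rightarrow> Mp E" using assms(1) by blast
  fix U assume "U \<in> {U. openin (vague_topology E) U}"
  then have U: "openin (vague_topology E) U" by simp
  obtain W where W: "open W" "U = {m \<in> Mp E. embed m \<in> W}" by (rule vague_openE[OF U])
  have "(\<lambda>\<omega>. embed (X \<omega>)) \<in> borel_measurable P"
    unfolding embed_def
    by (rule measurable_coordinatewise_then_product)
      (rule borel_measurable_exp_uminus[OF assms(2)[OF base_fun_C_K_plus]])
  from measurable_sets[OF this borel_open[OF W(1)]]
  have "(\<lambda>\<omega>. embed (X \<omega>)) -` W \<inter> space P \<in> sets P" .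
  moreover have "X -` U \<inter> space P = (\<lambda>\<omega>. embed (X \<omega>)) -` W \<inter> space P"
    using W(2) assms(1) by auto
  ultimately show "X -` U \<inter> space P \<in> sets P" by simp
qed

lemma embed_measurable: "embed \<in> borel_measurable (Mp_borel E)"
  unfolding embed_def
  by (rule measurable_coordinatewise_then_product)
    (rule borel_measurable_exp_uminus[OF measurable_integral[OF base_fun_C_K_plus]])

end

section \<open>Convergence of Laplace functionals\<close>

lemma layer_cake:
  assumes "finite_measure Q" and h: "h \<in> borel_measurable Q"
    and h01: "\<And>m. m \<in> space Q \<Longrightarrow> 0 \<le> h m \<and> h m \<le> (1::real)"
  shows "ennreal (\<integral>m. h m \<partial>Q) =
    (\<integral>\<^sup>+t. ennreal (measure Q {m \<in> space Q. h m > t}) * indicator {0<..<1} t \<partial>lborel)"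
proof -
  interpret finite_measure Q by fact
  interpret pair_sigma_finite lborel Q ..
  have [measurable]: "h \<in> borel_measurable Q" by (rule h)
  have "ennreal (\<integral>m. h m \<partial>Q) = (\<integral>\<^sup>+m. ennreal (h m) \<partial>Q)"
    using h01 by (intro nn_integral_eq_integral[symmetric] integrable_const_bound[of _ 1]) auto
  also have "\<dots> = (\<integral>\<^sup>+m. (\<integral>\<^sup>+t. indicator {t. t < h m} t * indicator {0<..<1} t \<partial>lborel) \<partial>Q)"
  proof (rule nn_integral_cong)
    fix m assume m: "m \<in> space Q"
    have "(\<integral>\<^sup>+t. indicator {t. t < h m} t * indicator {0<..<1::real} t \<partial>lborel) =
        (\<integral>\<^sup>+t. indicator {0<..<h m} t \<partial>lborel)"
      using h01[OF m] by (intro nn_integral_cong) (auto simp: indicator_def)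
    also have "\<dots> = ennreal (h m)" using h01[OF m] by simp
    finally show "ennreal (h m) = (\<integral>\<^sup>+t. indicator {t. t < h m} t * indicator {0<..<1} t \<partial>lborel)" by simp
  qed
  also have "\<dots> = (\<integral>\<^sup>+t. (\<integral>\<^sup>+m. indicator {t. t < h m} t * indicator {0<..<1} t \<partial>Q) \<partial>lborel)"
    by (rule Fubini') (simp add: indicator_def)
  also have "\<dots> = (\<integral>\<^sup>+t. ennreal (measure Q {m \<in> space Q. h m > t}) * indicator {0<..<1} t \<partial>lborel)"
  proof (rule nn_integral_cong)
    fix t :: real
    have "(\<integral>\<^sup>+m. indicator {t. t < h m} t * indicator {0<..<1} t \<partial>Q) =
        (\<integral>\<^sup>+m. indicator {m \<in> space Q. h m > t} m * indicator {0<..<1} t \<partial>Q)"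
      by (intro nn_integral_cong) (auto simp: indicator_def)
    also have "\<dots> = emeasure Q {m \<in> space Q. h m > t} * indicator {0<..<1} t"
      by (subst nn_integral_multc) auto
    finally show "(\<integral>\<^sup>+m. indicator {t. t < h m} t * indicator {0<..<1} t \<partial>Q) =
        ennreal (measure Q {m \<in> space Q. h m > t}) * indicator {0<..<1} t"
      by (simp add: emeasure_eq_measure)
  qed
  finally show ?thesis .
qed

text \<open>By the layer cake formula the integral is one over levels t in (0, 1). Only countably
  many levels carry mass under \<open>Q'\<close>, so the assumed convergence holds for almost every
  t, and the bound \<open>C\<close> dominates.\<close>

lemma integral_tendsto_of_level_sets:
  fixes Q :: "nat \<Rightarrow> 'a measure"
  assumes fin: "\<And>n. finite_measure (Q n)" "finite_measure Q'"
    and sets: "\<And>n. sets (Q n) = sets Q'"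
    and h: "h \<in> borel_measurable Q'"
    and h01: "\<And>m. m \<in> space Q' \<Longrightarrow> 0 \<le> h m \<and> h m \<le> (1::real)"
    and C: "\<And>n. measure (Q n) (space Q') \<le> C"
    and lim: "\<And>t. t > 0 \<Longrightarrow> measure Q' {m \<in> space Q'. h m = t} = 0 \<Longrightarrow>
      (\<lambda>n. measure (Q n) {m \<in> space Q'. h m > t}) \<longlonglongrightarrow> measure Q' {m \<in> space Q'. h m > t}"
  shows "(\<lambda>n. \<integral>m. h m \<partial>Q n) \<longlonglongrightarrow> (\<integral>m. h m \<partial>Q')"
proof -
  interpret Q': finite_measure Q' by (rule fin)
  have sp: "space (Q n) = space Q'" for n by (rule sets_eq_imp_space_eq[OF sets])
  have hn: "h \<in> borel_measurable (Q n)" for n using h measurable_cong_sets[OF sets refl] by blast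
  have meas: "(\<lambda>t. ennreal (measure R {m \<in> space Q'. h m > t}) * indicator {0<..<1} t) \<in> borel_measurable lborel"
    if "finite_measure R" "sets R = sets Q'" for R
  proof -
    interpret R: finite_measure R by fact
    have spR: "space R = space Q'" by (rule sets_eq_imp_space_eq[OF that(2)])
    have hR: "h \<in> borel_measurable R" using h measurable_cong_sets[OF that(2) refl] by blast
    have "mono (\<lambda>t. - measure R {m \<in> space Q'. h m > t})"
    proof (rule monoI)
      fix s t :: real assume "s \<le> t"
      then have "measure R {m \<in> space Q'. h m > t} \<le> measure R {m \<in> space Q'. h m > s}"
        using hR unfolding spR[symmetric] by (intro R.finite_measure_mono) auto
      then show "- measure R {m \<in> space Q'. h m > s} \<le> - measure R {m \<in> space Q'. h m > t}" by simp
    qed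
    then have "(\<lambda>t. - measure R {m \<in> space Q'. h m > t}) \<in> borel_measurable borel"
      by (rule borel_measurable_mono)
    then have "(\<lambda>t. - (- measure R {m \<in> space Q'. h m > t})) \<in> borel_measurable borel"
      by (rule borel_measurable_uminus)
    then have [measurable]: "(\<lambda>t. measure R {m \<in> space Q'. h m > t}) \<in> borel_measurable borel" by simp
    show ?thesis by measurable
  qed
  interpret D: finite_measure "distr Q' borel h"
    by (rule Q'.finite_measure_distr[OF h])
  let ?A = "{t. measure (distr Q' borel h) {t} \<noteq> 0}"
  have "countable ?A" by (rule D.countable_support)
  then have "?A \<in> null_sets lborel" by (rule countable_imp_null_set_lborel)
  then have AE: "AE t in lborel. t \<notin> ?A" by (rule AE_not_in)
  have "(\<lambda>n. \<integral>\<^sup>+t. ennreal (measure (Q n) {m \<in> space Q'. h m > t}) * indicator {0<..<1} t \<partial>lborel)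
    \<longlonglongrightarrow> (\<integral>\<^sup>+t. ennreal (measure Q' {m \<in> space Q'. h m > t}) * indicator {0<..<1} t \<partial>lborel)"
  proof (rule nn_integral_dominated_convergence[where w="\<lambda>t. ennreal C * indicator {0<..<1} t"])
    show "(\<integral>\<^sup>+t. ennreal C * indicator {0<..<1::real} t \<partial>lborel) < \<infinity>"
      by (subst nn_integral_cmult) auto
    show "AE t in lborel. ennreal (measure (Q n) {m \<in> space Q'. h m > t}) * indicator {0<..<1} t
        \<le> ennreal C * indicator {0<..<1} t" for n
    proof (intro AE_I2 mult_right_mono ennreal_leI)
      interpret F: finite_measure "Q n" by (rule fin)
      fix t
      have "measure (Q n) {m \<in> space Q'. h m > t} \<le> measure (Q n) (space Q')"
        using hn unfolding sp[of n, symmetric] by (intro F.finite_measure_mono) auto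
      then show "measure (Q n) {m \<in> space Q'. h m > t} \<le> C" using C[of n] by simp
    qed simp
    show "AE t in lborel. (\<lambda>n. ennreal (measure (Q n) {m \<in> space Q'. h m > t}) * indicator {0<..<1} t)
        \<longlonglongrightarrow> ennreal (measure Q' {m \<in> space Q'. h m > t}) * indicator {0<..<1} t"
      using AE
    proof eventually_elim
      case (elim t)
      have "measure (distr Q' borel h) {t} = measure Q' (h -` {t} \<inter> space Q')"
        using h by (intro measure_distr) auto
      also have "h -` {t} \<inter> space Q' = {m \<in> space Q'. h m = t}" by auto
      finally have 0: "measure Q' {m \<in> space Q'. h m = t} = 0" using elim by simp
      show ?case
        using lim[OF _ 0] by (cases "t \<in> {0<..<1}") (auto simp: tendsto_ennrealI)
    qed
  qed (use meas fin sets in auto)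
  moreover have "ennreal (\<integral>m. h m \<partial>Q n) =
      (\<integral>\<^sup>+t. ennreal (measure (Q n) {m \<in> space Q'. h m > t}) * indicator {0<..<1} t \<partial>lborel)" for n
    using layer_cake[OF fin(1) hn, of n] h01 unfolding sp by blast
  moreover have "ennreal (\<integral>m. h m \<partial>Q') =
      (\<integral>\<^sup>+t. ennreal (measure Q' {m \<in> space Q'. h m > t}) * indicator {0<..<1} t \<partial>lborel)"
    using layer_cake[OF fin(2) h] h01 by blast
  ultimately have "(\<lambda>n. ennreal (\<integral>m. h m \<partial>Q n)) \<longlonglongrightarrow> ennreal (\<integral>m. h m \<partial>Q')" by simp
  then show ?thesis
    by (rule tendsto_ennrealD)
      (use h01 in \<open>auto intro!: Bochner_Integration.integral_nonneg always_eventually simp: sp\<close>)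
qed

text \<open>Frontiers at different levels are therefore disjoint, and a finite measure charges only
  countably many of them.\<close>

lemma frontier_of_level_set:
  assumes "continuous_map X euclideanreal h"
  shows "X frontier_of {x \<in> topspace X. h x > t} \<subseteq> {x \<in> topspace X. h x = t}"
proof -
  have "openin X {x \<in> topspace X. h x \<in> {t<..}}"
    using assms unfolding continuous_map_def open_openin[symmetric] by (meson open_greaterThan)
  then have 1: "X interior_of {x \<in> topspace X. h x > t} = {x \<in> topspace X. h x > t}"
    by (simp add: interior_of_openin)
  have "closedin X {x \<in> topspace X. h x \<in> {t..}}"
    using assms by (rule closedin_continuous_map_preimage) simp
  then have "X closure_of {x \<in> topspace X. h x > t} \<subseteq> {x \<in> topspace X. h x \<ge> t}"
    by (intro closure_of_minimal) auto
  then show ?thesis unfolding frontier_of_def 1 by auto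
qed

section \<open>Portmanteau argument for finite measures through the embedding\<close>

locale laplace_convergence = punctured_space +
  fixes Q :: "nat \<Rightarrow> ereal measure measure" and Q' :: "ereal measure measure"
  assumes fin: "\<And>n. finite_measure (Q n)" and fin': "finite_measure Q'"
    and sets_Q: "\<And>n. sets (Q n) = sets (Mp_borel E)" and sets_Q': "sets Q' = sets (Mp_borel E)"
    and laplace: "\<And>f. f \<in> C_K_plus E \<Longrightarrow>
      (\<lambda>n. \<integral>m. exp (- (\<integral>x. f x \<partial>m)) \<partial>Q n) \<longlonglongrightarrow> (\<integral>m. exp (- (\<integral>x. f x \<partial>m)) \<partial>Q')"
begin

lemma space_Q [simp]: "space (Q n) = Mp E" "space Q' = Mp E"
  using sets_eq_imp_space_eq[OF sets_Q] sets_eq_imp_space_eq[OF sets_Q'] by simp_all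

lemma meas_Q: "h \<in> borel_measurable (Mp_borel E) \<Longrightarrow> h \<in> borel_measurable (Q n)"
  "h \<in> borel_measurable (Mp_borel E) \<Longrightarrow> h \<in> borel_measurable Q'"
  using measurable_cong_sets[OF sets_Q refl] measurable_cong_sets[OF sets_Q' refl] by blast+

lemma integrable_Q:
  fixes h :: "ereal measure \<Rightarrow> real"
  assumes "h \<in> borel_measurable (Mp_borel E)" "\<And>m. m \<in> Mp E \<Longrightarrow> \<bar>h m\<bar> \<le> B"
  shows "integrable (Q n) h" "integrable Q' h"
  using assms meas_Q
  by (auto intro!: finite_measure.integrable_const_bound[OF fin, of _ B]
      finite_measure.integrable_const_bound[OF fin', of _ B])

text \<open>Testing with f = 0 shows that no mass is lost. The total masses need not be 1, which
  matters for the block laws.\<close>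

lemma mass_tendsto: "(\<lambda>n. measure (Q n) (Mp E)) \<longlonglongrightarrow> measure Q' (Mp E)"
  using laplace[OF C_K_plus_zero] finite_measure.emeasure_finite[OF fin]
    finite_measure.emeasure_finite[OF fin'] by (simp add: measure_def)

definition cube :: "(nat \<Rightarrow> real) set" where
  "cube = {y. \<forall>i. y i \<in> {0..1}}"

lemma compact_cube: "compact cube"
proof -
  have "compactin (product_topology (\<lambda>i::nat. euclideanreal) UNIV) (PiE UNIV (\<lambda>i. {0..1}))"
    by (subst compactin_PiE) auto
  moreover have "PiE UNIV (\<lambda>i. {0..1}) = cube" by (auto simp: cube_def PiE_UNIV_domain)
  ultimately show ?thesis by (simp add: euclidean_product_topology)
qed

lemma embed_cube: "m \<in> Mp E \<Longrightarrow> embed m \<in> cube"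
  unfolding cube_def using embed_bounds by blast

lemma continuous_embed_measurable:
  "continuous_on UNIV (g :: (nat \<Rightarrow> real) \<Rightarrow> real) \<Longrightarrow> (\<lambda>m. g (embed m)) \<in> borel_measurable (Mp_borel E)"
  by (rule measurable_compose[OF embed_measurable borel_measurable_continuous_onI])

lemma continuous_embed_bounded:
  assumes "continuous_on UNIV (g :: (nat \<Rightarrow> real) \<Rightarrow> real)"
  obtains B where "B > 0" "\<And>m. m \<in> Mp E \<Longrightarrow> \<bar>g (embed m)\<bar> \<le> B"
proof -
  have "bounded (g ` cube)"
    by (intro compact_imp_bounded compact_continuous_image compact_cube continuous_on_subset[OF assms]) simp
  then obtain B where "B > 0" "\<And>y. y \<in> cube \<Longrightarrow> \<bar>g y\<bar> \<le> B" unfolding bounded_pos by auto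
  then show ?thesis using that embed_cube by blast
qed

abbreviation "coords \<equiv> {\<lambda>y::nat \<Rightarrow> real. y i | i. True}"

lemma laplace_measurable: "f \<in> C_K_plus E \<Longrightarrow> (\<lambda>m. exp (- (\<integral>x. f x \<partial>m))) \<in> borel_measurable (Mp_borel E)"
  by (rule borel_measurable_exp_uminus[OF measurable_integral])

lemma gen_alg_coords_continuous: "F \<in> gen_alg coords \<Longrightarrow> continuous_on UNIV F"
  by (rule gen_alg_continuous[of coords]) auto

text \<open>Multiplication by the i-th coordinate is multiplication by the exponential of minus the
  integral of \<open>base_fun i\<close>, so it replaces f by \<open>base_fun i + f\<close>. Keeping
  f arbitrary closes the induction.\<close>

lemma gen_alg_coords_tendsto:
  assumes "F \<in> gen_alg coords"
  shows "\<forall>f\<in>C_K_plus E. (\<lambda>n. \<integral>m. F (embed m) * exp (- (\<integral>x. f x \<partial>m)) \<partial>Q n) \<longlonglongrightarrow>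
    (\<integral>m. F (embed m) * exp (- (\<integral>x. f x \<partial>m)) \<partial>Q')"
  using assms
proof (induction rule: gen_alg.induct)
  case (const c)
  show ?case using laplace by (auto intro: tendsto_mult_left)
next
  case (add F F')
  show ?case
  proof
    fix f assume f: "f \<in> C_K_plus E"
    have int: "integrable (Q n) (\<lambda>m. G (embed m) * exp (- (\<integral>x. f x \<partial>m)))"
      "integrable Q' (\<lambda>m. G (embed m) * exp (- (\<integral>x. f x \<partial>m)))" if "G \<in> gen_alg coords" for G n
    proof -
      note G = gen_alg_coords_continuous[OF that]
      obtain B where B: "B > 0" "\<And>m. m \<in> Mp E \<Longrightarrow> \<bar>G (embed m)\<bar> \<le> B"
        using continuous_embed_bounded[OF G] by blast
      have "\<bar>G (embed m) * exp (- (\<integral>x. f x \<partial>m))\<bar> \<le> B" if "m \<in> Mp E" for m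
      proof -
        have "\<bar>G (embed m)\<bar> * exp (- (\<integral>x. f x \<partial>m)) \<le> B * 1"
          using B that integral_C_K_plus_nonneg[OF that f] by (intro mult_mono) auto
        then show ?thesis by (simp add: abs_mult)
      qed
      then show "integrable (Q n) (\<lambda>m. G (embed m) * exp (- (\<integral>x. f x \<partial>m)))"
        "integrable Q' (\<lambda>m. G (embed m) * exp (- (\<integral>x. f x \<partial>m)))"
        using borel_measurable_times[OF continuous_embed_measurable[OF G] laplace_measurable[OF f]]
        by (intro integrable_Q[of _ B]; simp)+
    qed
    show "(\<lambda>n. \<integral>m. (F (embed m) + F' (embed m)) * exp (- (\<integral>x. f x \<partial>m)) \<partial>Q n) \<longlonglongrightarrow>
      (\<integral>m. (F (embed m) + F' (embed m)) * exp (- (\<integral>x. f x \<partial>m)) \<partial>Q')"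
      using add.IH f int[OF add.hyps(1)] int[OF add.hyps(2)]
      by (auto simp: distrib_right intro!: tendsto_add)
  qed
next
  case (gen_mult g F)
  show ?case
  proof
    fix f assume f: "f \<in> C_K_plus E"
    obtain i where g: "g = (\<lambda>y. y i)" using gen_mult.hyps by blast
    let ?f = "\<lambda>x. base_fun i x + f x"
    have "?f \<in> C_K_plus E" by (rule C_K_plus_add[OF base_fun_C_K_plus f])
    moreover have "g (embed m) * F (embed m) * exp (- (\<integral>x. f x \<partial>m)) = F (embed m) * exp (- (\<integral>x. ?f x \<partial>m))"
      if "m \<in> Mp E" for m
      using C_K_plus_integrable[OF that f] C_K_plus_integrable[OF that base_fun_C_K_plus]
      by (simp add: g embed_def exp_add[symmetric] mult_ac)
    then have "(\<integral>m. g (embed m) * F (embed m) * exp (- (\<integral>x. f x \<partial>m)) \<partial>R) =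
      (\<integral>m. F (embed m) * exp (- (\<integral>x. ?f x \<partial>m)) \<partial>R)" if "space R = Mp E" for R
      using that by (intro Bochner_Integration.integral_cong) auto
    ultimately show "(\<lambda>n. \<integral>m. g (embed m) * F (embed m) * exp (- (\<integral>x. f x \<partial>m)) \<partial>Q n) \<longlonglongrightarrow>
        (\<integral>m. g (embed m) * F (embed m) * exp (- (\<integral>x. f x \<partial>m)) \<partial>Q')"
      using gen_mult.IH by simp
  qed
qed

lemma continuous_embed_tendsto:
  assumes g: "continuous_on UNIV (g :: (nat \<Rightarrow> real) \<Rightarrow> real)"
  shows "(\<lambda>n. \<integral>m. g (embed m) \<partial>Q n) \<longlonglongrightarrow> (\<integral>m. g (embed m) \<partial>Q')"
proof (rule LIMSEQ_I)
  fix d :: real assume d: "d > 0"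
  \<comment> \<open>\<open>c\<close> exceeds the mass of \<open>Q'\<close> and eventually that of
    \<open>Q n\<close>, so precision d / (4 * c) costs at most d / 4 in each integral.\<close>
  define c where "c = measure Q' (Mp E) + 1"
  have c: "c \<ge> 1" by (simp add: c_def)
  have dc: "d / (4 * c) > 0" using d c by simp
  obtain F where F: "F \<in> gen_alg coords" "\<And>y. y \<in> cube \<Longrightarrow> \<bar>g y - F y\<bar> < d / (4 * c)"
  proof -
    have "\<exists>F\<in>gen_alg coords. \<forall>y\<in>cube. \<bar>g y - F y\<bar> < d / (4 * c)"
    proof (rule gen_alg_dense[OF compact_cube _ _ continuous_on_subset[OF g] dc])
      show "\<exists>h\<in>coords. h x \<noteq> h y" if "x \<noteq> y" for x y :: "nat \<Rightarrow> real"
        using that by (auto simp: fun_eq_iff)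
    qed (auto intro: continuous_on_subset[OF continuous_on_product_coordinates])
    then show ?thesis using that by blast
  qed
  note Fc = gen_alg_coords_continuous[OF F(1)]
  obtain B where B: "\<And>m. m \<in> Mp E \<Longrightarrow> \<bar>g (embed m)\<bar> \<le> B" using continuous_embed_bounded[OF g] by blast
  obtain B' where B': "\<And>m. m \<in> Mp E \<Longrightarrow> \<bar>F (embed m)\<bar> \<le> B'" using continuous_embed_bounded[OF Fc] by blast
  note int_g = integrable_Q[OF continuous_embed_measurable[OF g] B]
    and int_F = integrable_Q[OF continuous_embed_measurable[OF Fc] B']
  have close: "\<bar>(\<integral>m. g (embed m) \<partial>R) - (\<integral>m. F (embed m) \<partial>R)\<bar> \<le> d / (4 * c) * measure R (Mp E)"
    if R: "finite_measure R" "space R = Mp E" "integrable R (\<lambda>m. g (embed m))" "integrable R (\<lambda>m. F (embed m))" for R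
  proof -
    interpret R: finite_measure R by fact
    have "\<bar>(\<integral>m. g (embed m) \<partial>R) - (\<integral>m. F (embed m) \<partial>R)\<bar> = \<bar>\<integral>m. g (embed m) - F (embed m) \<partial>R\<bar>"
      using R by simp
    also have "\<dots> \<le> (\<integral>m. \<bar>g (embed m) - F (embed m)\<bar> \<partial>R)" by (rule integral_abs_bound)
    also have "\<dots> \<le> (\<integral>m. d / (4 * c) \<partial>R)"
      using R F(2) embed_cube by (intro integral_mono) (auto intro: less_imp_le)
    finally show ?thesis using R(2) by (simp add: mult.commute)
  qed
  have "(\<lambda>n. \<integral>m. F (embed m) \<partial>Q n) \<longlonglongrightarrow> (\<integral>m. F (embed m) \<partial>Q')"
    using gen_alg_coords_tendsto[OF F(1)] C_K_plus_zero by fastforce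
  then have "\<forall>\<^sub>F n in sequentially. dist (\<integral>m. F (embed m) \<partial>Q n) (\<integral>m. F (embed m) \<partial>Q') < d / 4"
    using d by (intro tendstoD) simp_all
  moreover have "\<forall>\<^sub>F n in sequentially. measure (Q n) (Mp E) < c"
    by (rule order_tendstoD(2)[OF mass_tendsto]) (simp add: c_def)
  ultimately have "\<forall>\<^sub>F n in sequentially. norm ((\<integral>m. g (embed m) \<partial>Q n) - (\<integral>m. g (embed m) \<partial>Q')) < d"
  proof eventually_elim
    case (elim n)
    have "d / (4 * c) * measure (Q n) (Mp E) \<le> d / (4 * c) * c" "d / (4 * c) * measure Q' (Mp E) \<le> d / (4 * c) * c"
      using elim(2) dc by (intro mult_left_mono; simp add: c_def)+
    moreover have "d / (4 * c) * c = d / 4" using c by simp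
    ultimately have "\<bar>(\<integral>m. g (embed m) \<partial>Q n) - (\<integral>m. F (embed m) \<partial>Q n)\<bar> \<le> d / 4"
      "\<bar>(\<integral>m. g (embed m) \<partial>Q') - (\<integral>m. F (embed m) \<partial>Q')\<bar> \<le> d / 4"
      using close[OF fin _ int_g(1) int_F(1), of n] close[OF fin' _ int_g(2) int_F(2)] by auto
    then show ?case using elim(1) d unfolding dist_real_def real_norm_def by linarith
  qed
  then show "\<exists>n0. \<forall>n\<ge>n0. norm ((\<integral>m. g (embed m) \<partial>Q n) - (\<integral>m. g (embed m) \<partial>Q')) < d"
    unfolding eventually_sequentially .
qed

text \<open>Continuous minorants of the indicator of an open set W of sequences, composed with
  \<open>embed\<close>, converge on \<open>Mp E\<close> to the indicator of U. Dominated convergence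
  under \<open>Q'\<close> selects one minorant that already captures more than
  \<open>measure Q' U - e\<close>. Only points \<open>embed m\<close> are ever evaluated, so limit
  points outside the image do no harm.\<close>

lemma open_lower_bound:
  assumes U: "openin (vague_topology E) U" and e: "e > 0"
  shows "\<forall>\<^sub>F n in sequentially. measure Q' U - e < measure (Q n) U"
proof -
  interpret Q': finite_measure Q' by (rule fin')
  have [measurable]: "U \<in> sets (Mp_borel E)" by (rule vague_open_sets[OF U])
  obtain W0 where W0: "open W0" "U = {m \<in> Mp E. embed m \<in> W0}" using vague_openE[OF U] by blast
  \<comment> \<open>As \<open>infdist y {} = 0\<close>, the complement must be nonempty; \<open>\<lambda>_. 2\<close> lies outside the cube.\<close>
  define W where "W = W0 - {\<lambda>_. 2}"
  have W: "open W" "- W \<noteq> {}" unfolding W_def using W0(1) by auto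
  have UW: "m \<in> U \<longleftrightarrow> embed m \<in> W" if "m \<in> Mp E" for m
  proof -
    have "embed m \<noteq> (\<lambda>_. 2)"
    proof
      assume "embed m = (\<lambda>_. 2)"
      then show False using embed_bounds[OF that, of 0] by simp
    qed
    then show ?thesis using that W0(2) by (simp add: W_def)
  qed
  define \<phi> where "\<phi> j y = min 1 (real j * infdist y (- W))" for j and y :: "nat \<Rightarrow> real"
  have \<phi>c: "continuous_on UNIV (\<phi> j)" for j unfolding \<phi>_def by (intro continuous_intros)
  have \<phi>01: "0 \<le> \<phi> j y" "\<phi> j y \<le> 1" for j y by (auto simp: \<phi>_def infdist_nonneg)
  have \<phi>off: "\<phi> j y = 0" if "y \<notin> W" for j y using that by (simp add: \<phi>_def)
  have \<phi>lim: "(\<lambda>j. \<phi> j (embed m)) \<longlonglongrightarrow> indicator U m" if m: "m \<in> Mp E" for m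
  proof (cases "embed m \<in> W")
    case True
    have "closed (- W)" using W(1) by (simp add: closed_Compl)
    then have pos: "infdist (embed m) (- W) > 0"
      using W(2) True by (intro infdist_pos_not_in_closed) auto
    obtain k :: nat where k: "1 < real k * infdist (embed m) (- W)"
      using pos ex_less_of_nat_mult by blast
    have "\<forall>\<^sub>F j in sequentially. \<phi> j (embed m) = 1"
      using eventually_ge_at_top[of k]
    proof eventually_elim
      case (elim j)
      then have "real k * infdist (embed m) (- W) \<le> real j * infdist (embed m) (- W)"
        using pos by (intro mult_right_mono) auto
      then show ?case using k by (simp add: \<phi>_def)
    qed
    then show ?thesis using UW[OF m] True by (simp add: tendsto_eventually)
  next
    case False
    then show ?thesis using UW[OF m] \<phi>off by simp
  qed
  have "(\<lambda>j. \<integral>m. \<phi> j (embed m) \<partial>Q') \<longlonglongrightarrow> (\<integral>m. indicator U m \<partial>Q')"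
  proof (rule integral_dominated_convergence[where w="\<lambda>_. 1"])
    show "AE m in Q'. (\<lambda>j. \<phi> j (embed m)) \<longlonglongrightarrow> indicator U m"
      by (intro AE_I2 \<phi>lim) simp
    show "indicat_real U \<in> borel_measurable Q'" by (rule meas_Q) measurable
    show "(\<lambda>m. \<phi> j (embed m)) \<in> borel_measurable Q'" for j
      by (rule meas_Q[OF continuous_embed_measurable[OF \<phi>c]])
  qed (use \<phi>01 in auto)
  moreover have "(\<integral>m. indicat_real U m \<partial>Q') = measure Q' U"
    using vague_open_sets[OF U] sets_Q' vague_open_subset[OF U] by (simp add: Int_absorb1 Int_absorb2)
  ultimately have "(\<lambda>j. \<integral>m. \<phi> j (embed m) \<partial>Q') \<longlonglongrightarrow> measure Q' U" by simp
  then have "\<forall>\<^sub>F j in sequentially. measure Q' U - e < (\<integral>m. \<phi> j (embed m) \<partial>Q')"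
    by (rule order_tendstoD(1)) (use e in simp)
  then obtain j where "measure Q' U - e < (\<integral>m. \<phi> j (embed m) \<partial>Q')"
    by (auto simp: eventually_sequentially)
  from order_tendstoD(1)[OF continuous_embed_tendsto[OF \<phi>c] this]
  show ?thesis
  proof eventually_elim
    case (elim n)
    interpret F: finite_measure "Q n" by (rule fin)
    have "(\<integral>m. \<phi> j (embed m) \<partial>Q n) \<le> (\<integral>m. indicat_real U m \<partial>Q n)"
    proof (rule integral_mono)
      show "integrable (Q n) (\<lambda>m. \<phi> j (embed m))"
        by (rule integrable_Q[OF continuous_embed_measurable[OF \<phi>c], of _ 1]) (use \<phi>01 in simp)
      show "integrable (Q n) (indicat_real U)"
        by (rule integrable_Q[of _ 1]) (auto simp: indicator_def)
      fix m assume "m \<in> space (Q n)"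
      then show "\<phi> j (embed m) \<le> indicat_real U m"
        using UW[of m] \<phi>off \<phi>01 by (cases "m \<in> U") auto
    qed
    also have "(\<integral>m. indicat_real U m \<partial>Q n) = measure (Q n) U"
      using vague_open_sets[OF U] sets_Q vague_open_subset[OF U] by (simp add: Int_absorb1 Int_absorb2)
    finally show ?case using elim by linarith
  qed
qed

lemma set_lower_bound:
  assumes M: "M \<in> sets (Mp_borel E)" and fr: "measure Q' (vague_topology E frontier_of M) = 0" and e: "e > 0"
  shows "\<forall>\<^sub>F n in sequentially. measure Q' M - e < measure (Q n) M"
proof -
  interpret Q': finite_measure Q' by (rule fin')
  let ?I = "vague_topology E interior_of M" and ?F = "vague_topology E frontier_of M"
  have Ms: "M \<subseteq> Mp E" using sets.sets_into_space[OF M] by simp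
  have I: "openin (vague_topology E) ?I" "?I \<subseteq> M" by (auto simp: interior_of_subset)
  have F: "?F \<in> sets (Mp_borel E)" by (rule vague_closed_sets[OF closedin_frontier_of])
  have "M \<subseteq> ?I \<union> ?F"
    using closure_of_subset[of M "vague_topology E"] Ms by (auto simp: frontier_of_def topspace_vague)
  then have "measure Q' M \<le> measure Q' (?I \<union> ?F)"
    using sets.Un[OF vague_open_sets[OF I(1)] F] unfolding sets_Q'[symmetric] by (rule Q'.finite_measure_mono)
  also have "\<dots> \<le> measure Q' ?I + measure Q' ?F"
    using F vague_open_sets[OF I(1)] sets_Q' by (intro measure_Un_le) auto
  finally have le: "measure Q' M \<le> measure Q' ?I" using fr by simp
  from open_lower_bound[OF I(1) e] show ?thesis
  proof eventually_elim
    case (elim n)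
    have "measure (Q n) ?I \<le> measure (Q n) M"
      using I(2) M sets_Q by (intro finite_measure.finite_measure_mono[OF fin]) auto
    then show ?case using elim le by linarith
  qed
qed

text \<open>The lower bound is applied to M and to its complement, which has the same frontier.
  Convergence of the total masses turns the second bound into an upper one; complement and total
  mass each use half of e.\<close>

lemma set_tendsto:
  assumes M: "M \<in> sets (Mp_borel E)" and fr: "measure Q' (vague_topology E frontier_of M) = 0"
  shows "(\<lambda>n. measure (Q n) M) \<longlonglongrightarrow> measure Q' M"
proof (rule tendstoI)
  fix e :: real assume e: "e > 0"
  have compl: "Mp E - M \<in> sets (Mp_borel E)" using sets.compl_sets[OF M] by simp
  have fr': "measure Q' (vague_topology E frontier_of (Mp E - M)) = 0"
    using fr frontier_of_complement[of "vague_topology E" M] by (simp add: topspace_vague)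
  have c: "measure R (Mp E - M) = measure R (Mp E) - measure R M"
    if "finite_measure R" "sets R = sets (Mp_borel E)" for R
    using finite_measure.finite_measure_compl[OF that(1), of M] that(2) M sets_eq_imp_space_eq[OF that(2)] by simp
  have "\<forall>\<^sub>F n in sequentially. measure (Q n) (Mp E) < measure Q' (Mp E) + e / 2"
    by (rule order_tendstoD(2)[OF mass_tendsto]) (use e in simp)
  with set_lower_bound[OF M fr e] set_lower_bound[OF compl fr' half_gt_zero[OF e]]
  show "\<forall>\<^sub>F n in sequentially. dist (measure (Q n) M) (measure Q' M) < e"
  proof eventually_elim
    case (elim n)
    then show ?case unfolding c[OF fin sets_Q] c[OF fin' sets_Q'] dist_real_def by linarith
  qed
qed

lemma unit_integral_tendsto:
  assumes h: "continuous_map (vague_topology E) euclideanreal h"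
    and h01: "\<And>m. m \<in> Mp E \<Longrightarrow> 0 \<le> h m \<and> h m \<le> 1"
  shows "(\<lambda>n. \<integral>m. h m \<partial>Q n) \<longlonglongrightarrow> (\<integral>m. h m \<partial>Q')"
proof -
  interpret Q': finite_measure Q' by (rule fin')
  have hm: "h \<in> borel_measurable (Mp_borel E)" by (rule vague_continuous_measurable[OF h])
  obtain C where C: "\<And>n. measure (Q n) (Mp E) \<le> C"
    by (rule BseqE[OF convergent_imp_Bseq[OF convergentI[OF mass_tendsto]]]) auto
  show ?thesis
  proof (rule integral_tendsto_of_level_sets[OF fin fin'])
    fix t :: real assume 0: "measure Q' {m \<in> space Q'. h m = t} = 0"
    have m: "{m \<in> Mp E. h m > t} \<in> sets (Mp_borel E)" "{m \<in> Mp E. h m = t} \<in> sets (Mp_borel E)"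
      using measurable_sets[OF hm, of "{t<..}"] measurable_sets[OF hm, of "{t}"]
      by (simp_all add: vimage_def Int_def conj_commute)
    have "measure Q' (vague_topology E frontier_of {m \<in> Mp E. h m > t}) \<le> measure Q' {m \<in> Mp E. h m = t}"
      using frontier_of_level_set[OF h, of t] m(2) sets_Q'
      by (intro Q'.finite_measure_mono) (auto simp: topspace_vague)
    then have "measure Q' (vague_topology E frontier_of {m \<in> Mp E. h m > t}) = 0"
      using 0 by (simp add: measure_le_0_iff)
    from set_tendsto[OF m(1) this]
    show "(\<lambda>n. measure (Q n) {m \<in> space Q'. h m > t}) \<longlonglongrightarrow> measure Q' {m \<in> space Q'. h m > t}" by simp
  qed (use sets_Q sets_Q' meas_Q(2)[OF hm] h01 C in auto)
qed

end

text \<open>An affine change of scale carries a bounded functional into [0, 1]; it commutes with the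
  integrals because all the measures are probabilities.\<close>

lemma (in punctured_space) weakly_convergesI:
  assumes P: "\<And>n. prob_space (Q n)" "prob_space Q'"
    and sets: "\<And>n. sets (Q n) = sets (Mp_borel E)" "sets Q' = sets (Mp_borel E)"
    and laplace: "\<And>f. f \<in> C_K_plus E \<Longrightarrow>
      (\<lambda>n. \<integral>m. exp (- (\<integral>x. f x \<partial>m)) \<partial>Q n) \<longlonglongrightarrow> (\<integral>m. exp (- (\<integral>x. f x \<partial>m)) \<partial>Q')"
  shows "weakly_converges (vague_topology E) Q Q'"
  unfolding weakly_converges_def
proof (intro allI impI, elim conjE)
  fix h assume h: "continuous_map (vague_topology E) euclideanreal h"
    and "bounded (h ` topspace (vague_topology E))"
  then obtain B where B: "B > 0" "\<And>m. m \<in> Mp E \<Longrightarrow> \<bar>h m\<bar> \<le> B"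
    unfolding bounded_pos topspace_vague by auto
  interpret laplace_convergence E Q Q'
    by (intro laplace_convergence.intro laplace_convergence_axioms.intro punctured_space_axioms
        P[THEN prob_space.finite_measure] sets laplace)
  interpret Q': prob_space Q' by (rule P)
  define g where "g m = (h m * (1 / B) + 1) * (1 / 2)" for m
  have gc: "continuous_map (vague_topology E) euclideanreal g"
    unfolding g_def by (intro continuous_map_real_mult_right continuous_map_add h) simp
  have g01: "0 \<le> g m \<and> g m \<le> 1" if "m \<in> Mp E" for m
  proof -
    have "\<bar>h m / B\<bar> \<le> 1" using B(2)[OF that] B(1) by simp
    then have "-1 \<le> h m * (1 / B)" "h m * (1 / B) \<le> 1" unfolding abs_le_iff by simp_all
    moreover have "0 \<le> (u + 1) * (1 / 2) \<and> (u + 1) * (1 / 2) \<le> 1" if "-1 \<le> u" "u \<le> 1" for u :: real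
      using that by simp
    ultimately show ?thesis unfolding g_def by blast
  qed
  have lim: "(\<lambda>n. \<integral>m. g m \<partial>Q n) \<longlonglongrightarrow> (\<integral>m. g m \<partial>Q')" by (rule unit_integral_tendsto[OF gc g01])
  have hg: "h m = B * (2 * g m - 1)" for m using B(1) by (simp add: g_def field_simps)
  have eq: "(\<integral>m. h m \<partial>R) = B * (2 * (\<integral>m. g m \<partial>R) - 1)"
    if "prob_space R" "integrable R g" for R
  proof -
    interpret prob_space R by fact
    show ?thesis unfolding hg using that(2) by (simp add: prob_space)
  qed
  have gm: "g \<in> borel_measurable (Mp_borel E)" by (rule vague_continuous_measurable[OF gc])
  have int: "integrable (Q n) g" "integrable Q' g" for n
    using integrable_Q[OF gm, of 1] g01 by auto
  show "(\<lambda>n. \<integral>m. h m \<partial>Q n) \<longlonglongrightarrow> (\<integral>m. h m \<partial>Q')"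
    unfolding eq[OF P(1) int(1)] eq[OF P(2) int(2)] by (intro tendsto_mult tendsto_diff tendsto_const lim)
qed

section \<open>Regular variation\<close>

text \<open>With L = - ln (1 - x) the power is exp (- k L), and L exp (- L) \<le> x \<le> L. As k
  tends to infinity, convergence of k L forces L to 0 and convergence of k x forces x to 0, so the
  two products have the same limit.\<close>

lemma power_tendsto_exp_iff:
  fixes x :: "nat \<Rightarrow> real" and k :: "nat \<Rightarrow> nat"
  assumes k: "filterlim k at_top sequentially" and x: "\<And>n. 0 \<le> x n" "\<And>n. x n \<le> 1"
  shows "(\<lambda>n. (1 - x n) ^ k n) \<longlonglongrightarrow> exp (- c) \<longleftrightarrow> (\<lambda>n. real (k n) * x n) \<longlonglongrightarrow> c"
proof
  have k': "filterlim (\<lambda>n. real (k n)) at_top sequentially"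
    by (rule filterlim_compose[OF filterlim_real_sequentially k])
  have k0: "\<forall>\<^sub>F n in sequentially. 0 < k n"
  proof -
    have "\<forall>\<^sub>F n in sequentially. 1 \<le> k n" using k unfolding filterlim_at_top by blast
    then show ?thesis by eventually_elim simp
  qed
  define L where "L n = - ln (1 - x n)" for n
  have L: "x n \<le> L n" "L n * exp (- L n) \<le> x n" "1 - x n = exp (- L n)" "0 \<le> L n" if "x n < 1" for n
  proof -
    show e: "1 - x n = exp (- L n)" using that by (simp add: L_def)
    show "x n \<le> L n" using exp_ge_add_one_self[of "- L n"] e by simp
    then show "0 \<le> L n" using x(1)[of n] by simp
    \<comment> \<open>From 1 + L \<le> exp L: L exp (- L) \<le> 1 - exp (- L) = x.\<close>
    have "(1 + L n) * exp (- L n) \<le> exp (L n) * exp (- L n)"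
      using exp_ge_add_one_self[of "L n"] by (intro mult_right_mono) auto
    also have "\<dots> = 1" by (simp add: exp_minus)
    finally show "L n * exp (- L n) \<le> x n" using e by (simp add: distrib_right)
  qed
  {
    \<comment> \<open>The positive limit excludes x = 1, where the logarithm carries no
      information.\<close>
    assume lim: "(\<lambda>n. (1 - x n) ^ k n) \<longlonglongrightarrow> exp (- c)"
    have "\<forall>\<^sub>F n in sequentially. 0 < (1 - x n) ^ k n"
      by (rule order_tendstoD(1)[OF lim]) simp
    with k0 have lt: "\<forall>\<^sub>F n in sequentially. x n < 1"
    proof eventually_elim
      case (elim n)
      then have "x n \<noteq> 1" by (auto simp: zero_power)
      then show ?case using x(2)[of n] by simp
    qed
    have "(\<lambda>n. - ln ((1 - x n) ^ k n)) \<longlonglongrightarrow> - ln (exp (- c))"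
      by (intro tendsto_minus tendsto_ln lim) simp
    moreover have "\<forall>\<^sub>F n in sequentially. - ln ((1 - x n) ^ k n) = real (k n) * L n"
      using lt by eventually_elim (simp add: L_def ln_realpow)
    ultimately have kL: "(\<lambda>n. real (k n) * L n) \<longlonglongrightarrow> c"
      by (simp add: tendsto_cong)
    have "(\<lambda>n. real (k n) * L n * inverse (real (k n))) \<longlonglongrightarrow> c * 0"
      by (intro tendsto_mult kL tendsto_inverse_0_at_top k')
    moreover have "\<forall>\<^sub>F n in sequentially. real (k n) * L n * inverse (real (k n)) = L n"
      using k0 by eventually_elim simp
    ultimately have L0: "L \<longlonglongrightarrow> 0" by (simp add: tendsto_cong)
    have "(\<lambda>n. real (k n) * L n * exp (- L n)) \<longlonglongrightarrow> c * exp (- 0)"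
      by (intro tendsto_mult kL tendsto_exp tendsto_minus L0)
    then have lower: "(\<lambda>n. real (k n) * L n * exp (- L n)) \<longlonglongrightarrow> c" by simp
    show "(\<lambda>n. real (k n) * x n) \<longlonglongrightarrow> c"
    proof (rule tendsto_sandwich[OF _ _ lower kL])
      show "\<forall>\<^sub>F n in sequentially. real (k n) * L n * exp (- L n) \<le> real (k n) * x n"
        using lt by eventually_elim (simp add: L(2) mult_left_mono mult.assoc)
      show "\<forall>\<^sub>F n in sequentially. real (k n) * x n \<le> real (k n) * L n"
        using lt by eventually_elim (simp add: L(1) mult_left_mono)
    qed
  }
  {
    assume kx: "(\<lambda>n. real (k n) * x n) \<longlonglongrightarrow> c"
    have "(\<lambda>n. real (k n) * x n * inverse (real (k n))) \<longlonglongrightarrow> c * 0"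
      by (intro tendsto_mult kx tendsto_inverse_0_at_top k')
    moreover have "\<forall>\<^sub>F n in sequentially. real (k n) * x n * inverse (real (k n)) = x n"
      using k0 by eventually_elim simp
    ultimately have x0: "x \<longlonglongrightarrow> 0" by (simp add: tendsto_cong)
    have lt: "\<forall>\<^sub>F n in sequentially. x n < 1" by (rule order_tendstoD(2)[OF x0]) simp
    have "(\<lambda>n. real (k n) * x n / (1 - x n)) \<longlonglongrightarrow> c / (1 - 0)"
      by (intro tendsto_divide kx tendsto_diff tendsto_const x0) simp
    then have upper: "(\<lambda>n. real (k n) * x n / (1 - x n)) \<longlonglongrightarrow> c" by simp
    have kL: "(\<lambda>n. real (k n) * L n) \<longlonglongrightarrow> c"
    proof (rule tendsto_sandwich[OF _ _ kx upper])
      show "\<forall>\<^sub>F n in sequentially. real (k n) * x n \<le> real (k n) * L n"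
        using lt by eventually_elim (simp add: L(1) mult_left_mono)
      show "\<forall>\<^sub>F n in sequentially. real (k n) * L n \<le> real (k n) * x n / (1 - x n)"
        using lt
      proof eventually_elim
        case (elim n)
        have "real (k n) * L n * (1 - x n) \<le> real (k n) * x n"
          using L(2)[OF elim] by (simp add: L(3)[OF elim] mult_left_mono mult.assoc)
        then show ?case using elim by (simp add: pos_le_divide_eq)
      qed
    qed
    have "(\<lambda>n. exp (- (real (k n) * L n))) \<longlonglongrightarrow> exp (- c)" by (intro tendsto_exp tendsto_minus kL)
    moreover have "\<forall>\<^sub>F n in sequentially. exp (- (real (k n) * L n)) = (1 - x n) ^ k n"
      using lt by eventually_elim (simp add: L(3) exp_of_nat_mult[symmetric])
    ultimately show "(\<lambda>n. (1 - x n) ^ k n) \<longlonglongrightarrow> exp (- c)" by (simp add: tendsto_cong)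
  }
qed

text \<open>Cauchy's functional equation: enclosing n * u between consecutive integers bounds n * |h
  u - u * h 1| by h 1 for every n, which forces equality.\<close>

lemma additive_mono_linear:
  fixes h :: "real \<Rightarrow> real"
  assumes add: "\<And>u v. h (u + v) = h u + h v" and mono: "mono h"
  shows "h u = u * h 1"
proof -
  have h0: "h 0 = 0" using add[of 0 0] by simp
  have hn: "h (real n * v) = real n * h v" for n v
    by (induction n) (simp_all add: h0 add distrib_right)
  have c: "h 1 \<ge> 0" using monoD[OF mono, of 0 1] h0 by simp
  have pos: "h u = u * h 1" if u: "u \<ge> 0" for u
  proof -
    have bd: "real n * \<bar>h u - u * h 1\<bar> \<le> h 1" for n
    proof -
      define i where "i = nat \<lfloor>real n * u\<rfloor>"
      have "real i = of_int \<lfloor>real n * u\<rfloor>" unfolding i_def using u by (simp add: of_nat_nat)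
      then have i: "real i \<le> real n * u" "real n * u \<le> real (Suc i)" by linarith+
      have "h (real i) \<le> h (real n * u)" "h (real n * u) \<le> h (real (Suc i))"
        using i by (auto intro: monoD[OF mono])
      then have 1: "real i * h 1 \<le> real n * h u" "real n * h u \<le> real (Suc i) * h 1"
        using hn[of i 1] hn[of n u] hn[of "Suc i" 1] by simp_all
      have 2: "real i * h 1 \<le> real n * u * h 1" "real n * u * h 1 \<le> real (Suc i) * h 1"
        using i c by (auto intro: mult_right_mono)
      have 3: "real (Suc i) * h 1 = real i * h 1 + h 1" by (simp add: distrib_right)
      have "\<bar>real n * h u - real n * u * h 1\<bar> \<le> h 1" using 1 2 3 by linarith
      then show ?thesis by (simp add: right_diff_distrib[symmetric] abs_mult mult.assoc)
    qed
    show ?thesis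
    proof (rule ccontr)
      assume "h u \<noteq> u * h 1"
      then have "0 < \<bar>h u - u * h 1\<bar>" by simp
      then obtain n where "h 1 < real n * \<bar>h u - u * h 1\<bar>" using ex_less_of_nat_mult by blast
      then show False using bd[of n] by simp
    qed
  qed
  show ?thesis
  proof (cases "u \<ge> 0")
    case False
    then have "h (- u) = - u * h 1" by (intro pos) simp
    then show ?thesis using add[of u "- u"] h0 by simp
  qed (rule pos)
qed

text \<open>The first index \<open>n\<close> with \<open>t < a (n + 1)\<close> satisfies \<open>a n \<le> t < a (n + 1)\<close>, whether or not
  \<open>a\<close> is monotone; this carries the limits along \<open>a\<close> over to limits along all reals.\<close>

lemma tail_regular_variation:
  fixes U T :: "real \<Rightarrow> real" and a :: "nat \<Rightarrow> real"
  assumes U: "antimono U" "\<And>x. U x \<ge> 0" and a: "\<And>n. 1 \<le> n \<Longrightarrow> a n > 0"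
    and tail: "\<And>x. x > 0 \<Longrightarrow> (\<lambda>n. real n * U (x * a n)) \<longlonglongrightarrow> T x"
    and vanish: "(T \<longlongrightarrow> 0) at_top" and x0: "x0 > 0" "T x0 > 0"
  shows "\<exists>C>0. \<exists>\<alpha>>0. (\<forall>x>0. T x = C * x powr (- \<alpha>)) \<and>
      (\<forall>x>0. ((\<lambda>t. U (t * x) / U t) \<longlongrightarrow> x powr (- \<alpha>)) at_top)"
    and "\<And>z. U z > 0"
proof -
  have U0: "(\<lambda>n. U (x * a n)) \<longlonglongrightarrow> 0" if "x > 0" for x
  proof -
    have "(\<lambda>n. real n * U (x * a n) * inverse (real n)) \<longlonglongrightarrow> T x * 0"
      by (intro tendsto_mult tail that tendsto_inverse_0_at_top filterlim_real_sequentially)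
    moreover have "\<forall>\<^sub>F n in sequentially. real n * U (x * a n) * inverse (real n) = U (x * a n)"
      using eventually_gt_at_top[of 0] by eventually_elim simp
    ultimately show ?thesis by (simp add: tendsto_cong)
  qed
  have Upos: "\<forall>\<^sub>F n in sequentially. 0 < U (x0 * a n)"
    using order_tendstoD(1)[OF tail[OF x0(1)] x0(2)]
    by eventually_elim (metis U(2) mult_zero_right order_less_irrefl order_less_le)
  \<comment> \<open>If a n \<le> B infinitely often, then U (x0 / 2 * a n) tends to 0 but is
    infinitely often at least U (x0 * (B / 2)), which must vanish. As U (x0 * a n) is eventually
    positive, a n \<le> B / 2 eventually.\<close>
  have halve: "U (x0 * (B / 2)) = 0 \<and> (\<exists>\<^sub>F n in sequentially. a n \<le> B / 2)"
    if B: "\<exists>\<^sub>F n in sequentially. a n \<le> B" for B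
  proof -
    have z: "U (x0 * (B / 2)) = 0"
    proof (rule ccontr)
      assume "U (x0 * (B / 2)) \<noteq> 0"
      then have "0 < U (x0 * (B / 2))" using U(2)[of "x0 * (B / 2)"] by simp
      then have "\<forall>\<^sub>F n in sequentially. U (x0 / 2 * a n) < U (x0 * (B / 2))"
        using order_tendstoD(2)[OF U0[of "x0 / 2"]] x0(1) by simp
      then have "\<forall>\<^sub>F n in sequentially. \<not> a n \<le> B"
      proof eventually_elim
        case (elim n)
        show ?case
        proof
          assume "a n \<le> B"
          then have "x0 / 2 * a n \<le> x0 * (B / 2)" using x0(1) by simp
          then show False using elim antimonoD[OF U(1)] by (meson leD)
        qed
      qed
      then show False using B by (simp add: frequently_def)
    qed
    from Upos have "\<forall>\<^sub>F n in sequentially. a n \<le> B / 2"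
    proof eventually_elim
      case (elim n)
      show ?case
      proof (rule ccontr)
        assume "\<not> a n \<le> B / 2"
        then have "x0 * (B / 2) \<le> x0 * a n" using x0(1) by simp
        then show False using elim antimonoD[OF U(1), of "x0 * (B / 2)" "x0 * a n"] z by simp
      qed
    qed
    then have "\<exists>\<^sub>F n in sequentially. a n \<le> B / 2" by (rule eventually_frequently[OF sequentially_bot])
    with z show ?thesis by simp
  qed
  \<comment> \<open>Otherwise repeated halving makes U vanish at x0 * A / 2 ^ (k + 1) for every k,
    although U is positive at x0 * a n for some n with a n > 0.\<close>
  have a_lim: "filterlim a at_top sequentially"
  proof (rule ccontr)
    assume "\<not> ?thesis"
    then obtain A where "\<not> (\<forall>\<^sub>F n in sequentially. A < a n)" unfolding filterlim_at_top_dense by blast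
    then have A: "\<exists>\<^sub>F n in sequentially. a n \<le> A" by (simp add: not_eventually not_less)
    have pow: "\<exists>\<^sub>F n in sequentially. a n \<le> A / 2 ^ k" for k
    proof (induction k)
      case (Suc k)
      then show ?case using halve[OF Suc.IH] by (simp add: field_simps)
    qed (use A in simp)
    obtain n where n: "0 < U (x0 * a n)" "1 \<le> n"
      using eventually_happens[OF eventually_conj[OF Upos eventually_ge_at_top[of 1]]] by auto
    obtain k where k: "A / a n < 2 ^ k" using real_arch_pow[of 2 "A / a n"] by auto
    then have "A / 2 ^ k < a n" using a[OF n(2)] by (simp add: field_simps)
    moreover have "A / 2 ^ k > 0"
    proof -
      have "\<exists>n. 1 \<le> n \<and> a n \<le> A"
        using A unfolding frequently_sequentially by blast
      then obtain n where "1 \<le> n" "a n \<le> A" by blast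
      then have "0 < A" using a[of n] by simp
      then show ?thesis by simp
    qed
    ultimately have "A / 2 ^ k / 2 \<le> a n" by simp
    then have "x0 * (A / 2 ^ k / 2) \<le> x0 * a n" using x0(1) by (intro mult_left_mono) auto
    from antimonoD[OF U(1) this] show False using halve[OF pow[of k]] n(1) by simp
  qed
  have Uall: "U z > 0" for z
  proof -
    have "filterlim (\<lambda>n. a n * x0) at_top sequentially"
      using filterlim_at_top_mult_tendsto_pos[OF tendsto_const x0(1) a_lim] by simp
    then have "\<forall>\<^sub>F n in sequentially. z < a n * x0" unfolding filterlim_at_top_dense by blast
    then obtain n where "0 < U (x0 * a n)" "z < x0 * a n"
      using eventually_happens[OF eventually_conj[OF Upos]] by (auto simp: mult.commute)
    then show ?thesis using antimonoD[OF U(1), of z "x0 * a n"] by simp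
  qed
  then show "\<And>z. U z > 0" .
  define n where "n t = (LEAST n. t < a (Suc n))" for t
  have "\<exists>i. t < a (Suc i)" for t
  proof -
    have "\<forall>\<^sub>F i in sequentially. t < a (Suc i)"
      using filterlim_compose[OF a_lim filterlim_Suc] unfolding filterlim_at_top_dense by blast
    then show ?thesis by (auto simp: eventually_sequentially)
  qed
  then have n1: "t < a (Suc (n t))" for t unfolding n_def by (rule LeastI_ex)
  \<comment> \<open>For \<open>n t = 0\<close> minimality says nothing about
    \<open>a 0\<close>.\<close>
  have n2: "a (n t) \<le> t" if "n t \<ge> 1" for t
  proof -
    have "n t - 1 < (LEAST n. t < a (Suc n))" using that by (simp add: n_def[symmetric])
    from not_less_Least[OF this] show ?thesis using that by simp
  qed
  have n_lim: "filterlim n at_top at_top"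
    unfolding filterlim_at_top
  proof
    fix K
    have "\<forall>\<^sub>F t in at_top. \<forall>i\<in>{..K}. a i < t"
      by (intro eventually_ball_finite) (auto intro: eventually_gt_at_top)
    then show "\<forall>\<^sub>F t in at_top. K \<le> n t"
    proof eventually_elim
      case (elim t)
      show ?case
      proof (rule ccontr)
        assume "\<not> K \<le> n t"
        then have "a (Suc (n t)) < t" using elim by simp
        then show False using n1[of t] by simp
      qed
    qed
  qed
  \<comment> \<open>As U is antitone, its value is enclosed by those along a (n t) and a (n t + 1);
    the factor n / (n + 1) corrects the index of the latter.\<close>
  have nU: "((\<lambda>t. real (n t) * U (t * x)) \<longlongrightarrow> T x) at_top" if x: "x > 0" for x
  proof (rule tendsto_sandwich)
    have nS: "filterlim (\<lambda>t. Suc (n t)) at_top at_top" by (rule filterlim_compose[OF filterlim_Suc n_lim])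
    have *: "((\<lambda>i. real i / real (Suc i)) \<longlongrightarrow> 1) sequentially" by (rule LIMSEQ_n_over_Suc_n)
    have "((\<lambda>t. real (n t) / real (Suc (n t)) * (real (Suc (n t)) * U (x * a (Suc (n t))))) \<longlongrightarrow> 1 * T x) at_top"
      by (intro tendsto_mult filterlim_compose[OF * n_lim] filterlim_compose[OF tail[OF x] nS])
    then show "((\<lambda>t. real (n t) * U (x * a (Suc (n t)))) \<longlongrightarrow> T x) at_top" by simp
    show "((\<lambda>t. real (n t) * U (x * a (n t))) \<longlongrightarrow> T x) at_top"
      by (rule filterlim_compose[OF tail[OF x] n_lim])
    show "\<forall>\<^sub>F t in at_top. real (n t) * U (x * a (Suc (n t))) \<le> real (n t) * U (t * x)"
    proof (intro always_eventually allI mult_left_mono antimonoD[OF U(1)])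
      show "t * x \<le> x * a (Suc (n t))" for t using n1[of t] x by (simp add: mult.commute)
    qed simp
    have "\<forall>\<^sub>F t in at_top. n t \<ge> 1" using n_lim unfolding filterlim_at_top by blast
    then show "\<forall>\<^sub>F t in at_top. real (n t) * U (t * x) \<le> real (n t) * U (x * a (n t))"
    proof eventually_elim
      case (elim t)
      have "x * a (n t) \<le> t * x" using n2[OF elim] x by (simp add: mult.commute)
      then show ?case by (intro mult_left_mono antimonoD[OF U(1)]) auto
    qed
  qed
  \<comment> \<open>T is so far known to be positive only at x0; normalising there gives
    \<open>\<phi> 1 = 1\<close>.\<close>
  define \<phi> where "\<phi> y = T (x0 * y) / T x0" for y
  have \<phi>lim: "((\<lambda>t. U (t * y) / U t) \<longlongrightarrow> \<phi> y) at_top" if y: "y > 0" for y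
  proof -
    have "((\<lambda>s. real (n s) * U (s * (x0 * y)) / (real (n s) * U (s * x0))) \<longlongrightarrow> \<phi> y) at_top"
      unfolding \<phi>_def using x0 y by (intro tendsto_divide nU) auto
    moreover have "\<forall>\<^sub>F s in at_top. n s \<ge> 1" using n_lim unfolding filterlim_at_top by blast
    then have "\<forall>\<^sub>F s in at_top. real (n s) * U (s * (x0 * y)) / (real (n s) * U (s * x0)) =
        U (s * x0 * y) / U (s * x0)"
      by eventually_elim (simp add: mult.assoc)
    ultimately have 1: "((\<lambda>s. U (s * x0 * y) / U (s * x0)) \<longlongrightarrow> \<phi> y) at_top"
      by (simp add: tendsto_cong)
    \<comment> \<open>The substitution t = s * x0 removes x0 from the ratio.\<close>
    have "filterlim (\<lambda>t. (1 / x0) * t) at_top at_top"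
      using x0(1) by (intro filterlim_tendsto_pos_mult_at_top[OF tendsto_const _ filterlim_ident]) simp
    from filterlim_compose[OF 1 this] show ?thesis using x0(1) by simp
  qed
  have \<phi>mult: "\<phi> (x * y) = \<phi> x * \<phi> y" if "x > 0" "y > 0" for x y
  proof (rule tendsto_unique[OF trivial_limit_at_top_linorder \<phi>lim])
    have "filterlim (\<lambda>t. x * t) at_top at_top"
      using that by (intro filterlim_tendsto_pos_mult_at_top[OF tendsto_const _ filterlim_ident])
    then have "((\<lambda>t. U (x * t * y) / U (x * t)) \<longlongrightarrow> \<phi> y) at_top"
      by (rule filterlim_compose[OF \<phi>lim[OF that(2)]])
    from tendsto_mult[OF \<phi>lim[OF that(1)] this]
    show "((\<lambda>t. U (t * (x * y)) / U t) \<longlongrightarrow> \<phi> x * \<phi> y) at_top"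
    proof (rule Lim_transform_eventually)
      show "\<forall>\<^sub>F t in at_top. U (t * x) / U t * (U (x * t * y) / U (x * t)) = U (t * (x * y)) / U t"
        using Uall by (intro always_eventually) (simp add: mult_ac less_imp_neq[THEN not_sym])
    qed
  qed (use that in simp)
  have \<phi>1: "\<phi> 1 = 1" using x0 by (simp add: \<phi>_def)
  have \<phi>nonneg: "\<phi> y \<ge> 0" if "y > 0" for y
    by (rule tendsto_lowerbound[OF \<phi>lim[OF that]]) (use U(2) in auto)
  have \<phi>pos: "\<phi> y > 0" if "y > 0" for y
  proof -
    have "\<phi> y * \<phi> (1 / y) = 1" using \<phi>mult[of y "1 / y"] that \<phi>1 by simp
    then have "\<phi> y \<noteq> 0" by auto
    then show ?thesis using \<phi>nonneg[OF that] by simp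
  qed
  have \<phi>anti: "\<phi> y \<le> \<phi> x" if "0 < x" "x \<le> y" for x y
  proof (rule tendsto_le[OF trivial_limit_at_top_linorder \<phi>lim \<phi>lim])
    show "\<forall>\<^sub>F t in at_top. U (t * y) / U t \<le> U (t * x) / U t"
      using eventually_gt_at_top[of 0]
    proof eventually_elim
      case (elim t)
      then have "t * x \<le> t * y" using that by simp
      then show ?case by (intro divide_right_mono antimonoD[OF U(1)] U(2))
    qed
  qed (use that in simp_all)
  \<comment> \<open>Logarithmic coordinates turn the multiplicative antitone \<phi> into an additive
    monotone function; the exponent \<alpha> will be \<open>h 1\<close>.\<close>
  define h where "h u = - ln (\<phi> (exp u))" for u
  have "h u = u * h 1" for u
  proof (rule additive_mono_linear)
    show "h (u + v) = h u + h v" for u v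
      using \<phi>pos[of "exp u"] \<phi>pos[of "exp v"] by (simp add: h_def exp_add \<phi>mult ln_mult)
    show "mono h"
    proof (rule monoI)
      fix u v :: real assume "u \<le> v"
      then have "\<phi> (exp v) \<le> \<phi> (exp u)" by (intro \<phi>anti) auto
      then show "h u \<le> h v" unfolding h_def using \<phi>pos[of "exp v"] by simp
    qed
  qed
  then have \<phi>powr: "\<phi> y = y powr (- h 1)" if "y > 0" for y
  proof -
    have "ln (\<phi> y) = - h 1 * ln y"
      using \<open>h (ln y) = ln y * h 1\<close> that by (simp add: h_def[of "ln y"] mult.commute)
    then show ?thesis using \<phi>pos[OF that] that by (simp add: powr_def) (metis exp_ln)
  qed
  have Teq: "T x = T x0 * x0 powr h 1 * x powr (- h 1)" if "x > 0" for x
  proof -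
    have "T x = T x0 * \<phi> (x / x0)" using x0 by (simp add: \<phi>_def)
    also have "\<phi> (x / x0) = x0 powr h 1 * x powr (- h 1)"
      using that x0(1) by (simp add: \<phi>powr powr_divide powr_minus_divide)
    finally show ?thesis by simp
  qed
  \<comment> \<open>A zero exponent would make T constant and positive, against its vanishing at
    infinity.\<close>
  have "h 1 \<noteq> 0"
  proof
    assume "h 1 = 0"
    have "\<forall>\<^sub>F x in at_top. T x = T x0"
      using eventually_gt_at_top[of 0]
    proof eventually_elim
      case (elim x)
      then show ?case using Teq[OF elim] \<open>h 1 = 0\<close> x0 by simp
    qed
    then have "(T \<longlongrightarrow> T x0) at_top" by (rule tendsto_eventually)
    then show False using tendsto_unique[OF trivial_limit_at_top_linorder _ vanish] x0(2) by force
  qed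
  moreover have "h 1 \<ge> 0"
    unfolding h_def using \<phi>anti[of 1 "exp 1"] \<phi>1 \<phi>pos[of "exp 1"] by simp
  ultimately have "h 1 > 0" by simp
  moreover have "T x0 * x0 powr h 1 > 0" using x0 by simp
  ultimately show "\<exists>C>0. \<exists>\<alpha>>0. (\<forall>x>0. T x = C * x powr (- \<alpha>)) \<and>
      (\<forall>x>0. ((\<lambda>t. U (t * x) / U t) \<longlongrightarrow> x powr (- \<alpha>)) at_top)"
    using Teq \<phi>lim \<phi>powr by (intro exI[of _ "T x0 * x0 powr h 1"] exI[of _ "h 1"] conjI) auto
qed

section \<open>Canonical measures\<close>

context punctured_space
begin

lemma space_borel_on [simp]: "space (borel_on E) = E"
  by (simp add: space_restrict_space)

text \<open>As an image of the counting measure, the sum of Dirac masses gets its values and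
  integrals from the rules for \<open>distr\<close>.\<close>

lemma dirac_sum_eq_distr:
  assumes J: "finite J" and x: "\<And>j. j \<in> J \<Longrightarrow> x j \<in> E"
  shows "dirac_sum E J x = distr (count_space J) (borel_on E) x"
proof (rule measure_eqI)
  show "sets (dirac_sum E J x) = sets (distr (count_space J) (borel_on E) x)"
    unfolding dirac_sum_def sum_meas_def using sets.sigma_sets_eq[of "borel_on E"]
      sets.space_closed[of "borel_on E"] by simp
  fix B assume "B \<in> sets (dirac_sum E J x)"
  then have B: "B \<in> sets (borel_on E)"
    unfolding dirac_sum_def sum_meas_def using sets.sigma_sets_eq[of "borel_on E"]
      sets.space_closed[of "borel_on E"] by simp
  have "emeasure (dirac_sum E J x) B = (\<Sum>j\<in>J. emeasure (return (borel_on E) (x j)) B)"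
    unfolding dirac_sum_def using J B by (intro emeasure_sum_meas) auto
  also have "\<dots> = (\<Sum>j\<in>J. indicator B (x j))" using B by simp
  also have "\<dots> = (\<integral>\<^sup>+j. indicator B (x j) \<partial>count_space J)"
    using J by (simp add: nn_integral_count_space_finite)
  also have "\<dots> = (\<integral>\<^sup>+y. indicator B y \<partial>distr (count_space J) (borel_on E) x)"
    using x B by (subst nn_integral_distr) (auto simp: Pi_iff)
  also have "\<dots> = emeasure (distr (count_space J) (borel_on E) x) B"
    using B by simp
  finally show "emeasure (dirac_sum E J x) B = emeasure (distr (count_space J) (borel_on E) x) B" .
qed

lemma dirac_sum_Mp:
  assumes J: "finite J" and x: "\<And>j. j \<in> J \<Longrightarrow> x j \<in> E"
  shows "dirac_sum E J x \<in> Mp E"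
proof -
  have eq: "dirac_sum E J x = distr (count_space J) (borel_on E) x"
    by (rule dirac_sum_eq_distr[OF J]) (rule x)
  have "\<exists>k::nat. emeasure (distr (count_space J) (borel_on E) x) B = of_nat k"
    if "B \<in> relcompact_borel E" for B
  proof -
    from that have "B \<in> sets (borel_on E)"
      by (auto simp: relcompact_borel_def sets_restrict_space_iff)
    then have "emeasure (distr (count_space J) (borel_on E) x) B = of_nat (card (x -` B \<inter> J))"
    using x J by (subst emeasure_distr) (auto simp: Pi_iff)
    then show ?thesis by blast
  qed
  then show ?thesis unfolding eq Mp_def by simp
qed

lemma integral_dirac_sum:
  assumes J: "finite J" and x: "\<And>j. j \<in> J \<Longrightarrow> x j \<in> E"
    and f: "f \<in> C_K_plus E"
  shows "(\<integral>y. f y \<partial>dirac_sum E J x) = (\<Sum>j\<in>J. f (x j))"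
proof -
  have eq: "dirac_sum E J x = distr (count_space J) (borel_on E) x"
    by (rule dirac_sum_eq_distr[OF J]) (rule x)
  have "(\<integral>y. f y \<partial>dirac_sum E J x) = (\<integral>j. f (x j) \<partial>count_space J)"
    unfolding eq using x C_K_plus_measurable[OF f] by (subst integral_distr) (auto simp: Pi_iff)
  then show ?thesis using J by (simp add: lebesgue_integral_count_space_finite)
qed

lemma integral_pos_iff:
  assumes m: "m \<in> Mp E" and f: "f \<in> C_K_plus E"
  shows "0 < (\<integral>x. f x \<partial>m) \<longleftrightarrow> 0 < emeasure m {x \<in> E. f x \<noteq> 0}"
proof -
  have f0: "AE x in m. 0 \<le> f x" using f by (intro AE_I2) (auto simp: Mp_D[OF m] C_K_plus_def)
  have mf: "f \<in> borel_measurable m"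
    by (rule borel_measurable_integrable[OF C_K_plus_integrable[OF m f]])
  have "(\<integral>x. f x \<partial>m) = 0 \<longleftrightarrow> (AE x in m. f x = 0)"
    by (rule integral_nonneg_eq_0_iff_AE[OF C_K_plus_integrable[OF m f] f0])
  also have "\<dots> \<longleftrightarrow> emeasure m {x \<in> space m. f x \<noteq> 0} = 0"
    by (rule AE_iff_measurable[OF _ refl]) (use mf in measurable)
  finally show ?thesis
    using integral_C_K_plus_nonneg[OF m f] by (auto simp: Mp_D[OF m] less_le zero_less_iff_neq_zero)
qed

text \<open>A ramp is positive exactly beyond its lower level, so membership is strict positivity of
  one continuous functional, which makes the set open. The upper level x + 1 is an arbitrary
  choice.\<close>

lemma M_above_eq:
  assumes x: "x > 0"
  shows "M_above E x = {m \<in> Mp E. 0 < (\<integral>y. ramp x (x + 1) y \<partial>m)}"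
proof -
  have "{y \<in> E. ramp x (x + 1) y \<noteq> 0} = {y \<in> E. \<bar>y\<bar> > ereal x}"
  proof -
    have "ramp x (x + 1) y \<noteq> 0 \<longleftrightarrow> ereal x < \<bar>y\<bar>" for y
      using ramp_pos_iff[of x "x + 1" y] ramp_bounds(1)[of x "x + 1" y] by auto
    then show ?thesis by simp
  qed
  then have 1: "0 < (\<integral>y. ramp x (x + 1) y \<partial>m) \<longleftrightarrow> 0 < emeasure m {y \<in> E. \<bar>y\<bar> > ereal x}"
    if "m \<in> Mp E" for m
    using integral_pos_iff[OF that ramp_C_K_plus[OF x, of "x + 1"]] by simp
  show ?thesis unfolding M_above_def M0_def using 1 by auto
qed

lemma openin_M_above:
  assumes x: "x > 0"
  shows "openin (vague_topology E) (M_above E x)"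
proof -
  have C: "ramp x (x + 1) \<in> C_K_plus E" using x by (simp add: ramp_C_K_plus)
  have "openin (vague_topology E) {m \<in> topspace (vague_topology E). (\<integral>y. ramp x (x + 1) y \<partial>m) \<in> {0<..}}"
    by (rule vague_continuous_integral[OF C, unfolded continuous_map_real_iff, rule_format])
      (rule open_greaterThan)
  then show ?thesis unfolding M_above_eq[OF x] topspace_vague by (simp only: greaterThan_iff)
qed

lemma vanish_off_M_above:
  assumes x: "x > 0" and f: "f \<in> C_K_plus E" "\<And>y. y \<in> E \<Longrightarrow> \<bar>y\<bar> \<le> ereal x \<Longrightarrow> f y = 0"
    and m: "m \<in> Mp E" "m \<notin> M_above E x"
  shows "(\<integral>y. f y \<partial>m) = 0"
proof -
  have sub: "{y \<in> E. f y \<noteq> 0} \<subseteq> {y \<in> E. ramp x (x + 1) y \<noteq> 0}"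
  proof
    fix y assume y: "y \<in> {y \<in> E. f y \<noteq> 0}"
    then have "\<not> \<bar>y\<bar> \<le> ereal x" using f(2) by blast
    then have "ereal x < \<bar>y\<bar>" by (simp only: not_le)
    then have "0 < ramp x (x + 1) y" using ramp_pos_iff[of x "x + 1" y] by simp
    then show "y \<in> {y \<in> E. ramp x (x + 1) y \<noteq> 0}" using y by auto
  qed
  have C: "ramp x (x + 1) \<in> C_K_plus E" using x by (simp add: ramp_C_K_plus)
  have "ramp x (x + 1) \<in> borel_measurable m"
    by (rule borel_measurable_integrable[OF C_K_plus_integrable[OF m(1) C]])
  then have s: "{y \<in> E. ramp x (x + 1) y \<noteq> 0} \<in> sets m"
    unfolding Mp_D(2)[OF m(1), symmetric] by measurable
  have "\<not> 0 < emeasure m {y \<in> E. ramp x (x + 1) y \<noteq> 0}"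
    using m integral_pos_iff[OF m(1) C] unfolding M_above_eq[OF x] by blast
  then have "\<not> 0 < emeasure m {y \<in> E. f y \<noteq> 0}"
    using emeasure_mono[OF sub s] by (simp add: zero_less_iff_neq_zero)
  then show ?thesis
    using integral_pos_iff[OF m(1) f(1)] integral_C_K_plus_nonneg[OF m(1) f(1)] by simp
qed

end

section \<open>The Laplace exponent of the canonical measure\<close>

locale canonical = punctured_space +
  fixes L \<Lambda> :: "ereal measure measure"
  assumes L_sets: "sets L = sets (Mp_borel E)"
    and can: "canonical_measure E L \<Lambda>"
begin

lemma sets_Lam: "sets \<Lambda> = sets (Mp_borel E)"
  using can by (simp add: canonical_measure_def)

lemma space_Lam [simp]: "space \<Lambda> = Mp E" "space L = Mp E"
  using sets_eq_imp_space_eq[OF sets_Lam] sets_eq_imp_space_eq[OF L_sets] by simp_all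

lemma meas_Lam: "h \<in> borel_measurable (Mp_borel E) \<Longrightarrow> h \<in> borel_measurable \<Lambda>"
  using measurable_cong_sets[OF sets_Lam refl] by blast

text \<open>Integer values make \<open>m (away e) > 0\<close> the same as \<open>m (away e) \<ge> 1\<close>.\<close>

lemma exp_neg_away:
  assumes m: "m \<in> Mp E" and e: "e > 0" and pos: "emeasure m (away e) \<noteq> 0"
  shows "exp_neg (emeasure m (away e)) \<le> exp (-1)"
proof -
  obtain k :: nat where k: "emeasure m (away e) = of_nat k" using Mp_D(3)[OF m e] by blast
  then have "k \<ge> 1" using pos by (cases k) auto
  have "exp_neg (emeasure m (away e)) = exp (- real k)"
    unfolding k exp_neg_def by (simp add: ennreal_of_nat_eq_real_of_nat)
  then show ?thesis using \<open>k \<ge> 1\<close> by simp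
qed

lemma exp_neg_bounds: "0 \<le> exp_neg t" "exp_neg t \<le> 1"
  by (simp_all add: exp_neg_def)

text \<open>A measure that charges \<open>away e\<close> has mass at least 1 there. With c = 1 - exp
  (-1), the function c * h is hence dominated by 1 - exp (- m(away e)), whose integral is finite for
  a canonical measure, even if \<Lambda> itself is infinite.\<close>

lemma integrable_Lam:
  fixes h :: "ereal measure \<Rightarrow> real"
  assumes h: "h \<in> borel_measurable (Mp_borel E)" "\<And>m. m \<in> Mp E \<Longrightarrow> 0 \<le> h m \<and> h m \<le> 1"
    and e: "e > 0" and off: "\<And>m. m \<in> Mp E \<Longrightarrow> emeasure m (away e) = 0 \<Longrightarrow> h m = 0"
  shows "integrable \<Lambda> h"
proof -
  define c :: real where "c = 1 - exp (-1)"
  have c: "c > 0" by (simp add: c_def)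
  have "integrable \<Lambda> (\<lambda>m. c * h m)"
  proof (rule integrableI_nonneg)
    have "(\<integral>\<^sup>+m. ennreal (c * h m) \<partial>\<Lambda>) \<le> (\<integral>\<^sup>+m. ennreal (1 - exp_neg (emeasure m (away e))) \<partial>\<Lambda>)"
    proof (rule nn_integral_mono, rule ennreal_leI)
      fix m assume "m \<in> space \<Lambda>"
      then have m: "m \<in> Mp E" by simp
      show "c * h m \<le> 1 - exp_neg (emeasure m (away e))"
      proof (cases "emeasure m (away e) = 0")
        case True
        then show ?thesis using off[OF m] exp_neg_bounds by simp
      next
        case False
        have "c * h m \<le> c" using h(2)[OF m] c by simp
        then show ?thesis using exp_neg_away[OF m e False] unfolding c_def by linarith
      qed
    qed
    also have "\<dots> < \<infinity>" using can relcompact_away[OF e] unfolding canonical_measure_def by blast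
    finally show "(\<integral>\<^sup>+m. ennreal (c * h m) \<partial>\<Lambda>) < \<infinity>" .
    show "AE m in \<Lambda>. 0 \<le> c * h m" using h(2) c by (intro AE_I2) simp
    show "(\<lambda>m. c * h m) \<in> borel_measurable \<Lambda>"
      by (rule borel_measurable_times[OF _ meas_Lam[OF h(1)]]) simp
  qed
  then show ?thesis using c by simp
qed

lemma emeasure_away_pos:
  assumes m: "m \<in> Mp E" and f: "f \<in> C_K_plus E" "\<And>y. y \<in> E \<Longrightarrow> \<bar>y\<bar> < ereal e \<Longrightarrow> f y = 0"
    and z: "emeasure m (away e) = 0"
  shows "(\<integral>x. f x \<partial>m) = 0"
proof -
  have "{x \<in> E. f x \<noteq> 0} \<subseteq> away e"
  proof
    fix y assume y: "y \<in> {x \<in> E. f x \<noteq> 0}"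
    then have "\<not> \<bar>y\<bar> < ereal e" using f(2) by blast
    then show "y \<in> away e" using y unfolding away_def by (simp only: not_less) blast
  qed
  from emeasure_mono[OF this Mp_D(4)[OF m]] have "\<not> 0 < emeasure m {x \<in> E. f x \<noteq> 0}"
    using z by (simp add: zero_less_iff_neq_zero)
  then show ?thesis
    using integral_pos_iff[OF m f(1)] integral_C_K_plus_nonneg[OF m f(1)] by simp
qed

lemma M_above_sets: "x > 0 \<Longrightarrow> M_above E x \<in> sets (Mp_borel E)"
  by (rule vague_open_sets[OF openin_M_above])

lemma M_above_finite:
  assumes x: "x > 0"
  shows "emeasure \<Lambda> (M_above E x) < \<infinity>"
proof -
  have "integrable \<Lambda> (indicat_real (M_above E x))"
  proof (rule integrable_Lam[OF _ _ x])
    show "indicat_real (M_above E x) \<in> borel_measurable (Mp_borel E)"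
      using M_above_sets[OF x] by (rule borel_measurable_indicator)
    fix m assume m: "m \<in> Mp E" "emeasure m (away x) = 0"
    have "(\<integral>y. ramp x (x + 1) y \<partial>m) = 0"
      by (rule emeasure_away_pos[OF m(1) ramp_C_K_plus _ m(2)]) (use x in \<open>auto intro: ramp_eq_0\<close>)
    then show "indicat_real (M_above E x) m = 0" unfolding M_above_eq[OF x] by simp
  qed (simp add: indicator_def)
  from integrable_indicator_iff[THEN iffD1, OF this]
  show ?thesis using sets.sets_into_space[OF M_above_sets[OF x]] by (simp add: Int_absorb2)
qed

text \<open>The Laplace exponent - ln E exp (- N(f)) of the limit process, by
  \<open>laplace_L\<close>.\<close>

definition cumulant :: "(ereal \<Rightarrow> real) \<Rightarrow> real" where
  "cumulant f = (\<integral>m. 1 - exp (- (\<integral>x. f x \<partial>m)) \<partial>\<Lambda>)"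

lemma one_minus_laplace_measurable:
  "f \<in> C_K_plus E \<Longrightarrow> (\<lambda>m. 1 - exp (- (\<integral>x. f x \<partial>m))) \<in> borel_measurable (Mp_borel E)"
  by (intro borel_measurable_diff borel_measurable_const borel_measurable_exp_uminus measurable_integral)

lemma cumulant_integrable:
  assumes f: "f \<in> C_K_plus E"
  shows "integrable \<Lambda> (\<lambda>m. 1 - exp (- (\<integral>x. f x \<partial>m)))"
proof -
  obtain e :: real where e: "e > 0" "\<And>x. x \<in> E \<Longrightarrow> \<bar>x\<bar> < ereal e \<Longrightarrow> f x = 0"
    using C_K_plusD[OF f] by blast
  show ?thesis
  proof (rule integrable_Lam[OF one_minus_laplace_measurable[OF f] _ e(1)])
    show "1 - exp (- (\<integral>x. f x \<partial>m)) = 0" if "m \<in> Mp E" "emeasure m (away e) = 0" for m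
      using emeasure_away_pos[OF that(1) f e(2) that(2)] by simp
  qed (use integral_C_K_plus_nonneg[OF _ f] in simp)
qed

lemma laplace_L:
  assumes f: "f \<in> C_K_plus E"
  shows "(\<integral>m. exp (- (\<integral>x. f x \<partial>m)) \<partial>L) = exp (- cumulant f)"
proof -
  have eq: "exp_neg (\<integral>\<^sup>+x. ennreal (f x) \<partial>m) = exp (- (\<integral>x. f x \<partial>m))" if m: "m \<in> Mp E" for m
  proof -
    have "(\<integral>\<^sup>+x. ennreal (f x) \<partial>m) = ennreal (\<integral>x. f x \<partial>m)"
      by (rule nn_integral_eq_integral[OF C_K_plus_integrable[OF m f]])
        (use f in \<open>auto simp: C_K_plus_def Mp_D[OF m]\<close>)
    then show ?thesis using integral_C_K_plus_nonneg[OF m f] by (simp add: exp_neg_def)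
  qed
  have "(\<integral>m. exp_neg (\<integral>\<^sup>+x. ennreal (f x) \<partial>m) \<partial>L) =
        exp_neg (\<integral>\<^sup>+m. ennreal (1 - exp_neg (\<integral>\<^sup>+x. ennreal (f x) \<partial>m)) \<partial>\<Lambda>)"
    using can C_K_plus_measurable[OF f] f unfolding canonical_measure_def C_K_plus_def by blast
  also have "(\<integral>m. exp_neg (\<integral>\<^sup>+x. ennreal (f x) \<partial>m) \<partial>L) = (\<integral>m. exp (- (\<integral>x. f x \<partial>m)) \<partial>L)"
    by (rule Bochner_Integration.integral_cong) (simp_all add: eq)
  also have "(\<integral>\<^sup>+m. ennreal (1 - exp_neg (\<integral>\<^sup>+x. ennreal (f x) \<partial>m)) \<partial>\<Lambda>) =
      (\<integral>\<^sup>+m. ennreal (1 - exp (- (\<integral>x. f x \<partial>m))) \<partial>\<Lambda>)"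
    by (rule nn_integral_cong) (simp add: eq)
  also have "\<dots> = ennreal (cumulant f)"
    unfolding cumulant_def by (rule nn_integral_eq_integral[OF cumulant_integrable[OF f]])
      (use integral_C_K_plus_nonneg[OF _ f] in \<open>auto intro!: AE_I2\<close>)
  also have "exp_neg (ennreal (cumulant f)) = exp (- cumulant f)"
  proof -
    have "0 \<le> cumulant f" unfolding cumulant_def
      by (rule Bochner_Integration.integral_nonneg) (use integral_C_K_plus_nonneg[OF _ f] in simp)
    then show ?thesis by (simp add: exp_neg_def)
  qed
  finally show ?thesis .
qed

definition above_mass :: "real \<Rightarrow> real" where
  "above_mass x = measure \<Lambda> (M_above E x)"

lemma integrable_indicator_M_above: "x > 0 \<Longrightarrow> integrable \<Lambda> (indicat_real (M_above E x))"
  using M_above_finite[of x] M_above_sets[of x] sets_Lam by (intro integrable_real_indicator) auto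

lemma above_mass_eq: "x > 0 \<Longrightarrow> (\<integral>m. indicat_real (M_above E x) m \<partial>\<Lambda>) = above_mass x"
  unfolding above_mass_def
  using sets.sets_into_space[OF M_above_sets[of x]] by (simp add: Int_absorb2)

lemma cumulant_le_above_mass:
  assumes x: "x > 0" and f: "f \<in> C_K_plus E" "\<And>y. y \<in> E \<Longrightarrow> \<bar>y\<bar> \<le> ereal x \<Longrightarrow> f y = 0"
  shows "cumulant f \<le> above_mass x"
  unfolding cumulant_def above_mass_eq[OF x, symmetric]
proof (rule integral_mono[OF cumulant_integrable[OF f(1)] integrable_indicator_M_above[OF x]])
  fix m assume "m \<in> space \<Lambda>"
  then have m: "m \<in> Mp E" by simp
  show "1 - exp (- (\<integral>x. f x \<partial>m)) \<le> indicat_real (M_above E x) m"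
    using vanish_off_M_above[OF x f m] by (cases "m \<in> M_above E x") auto
qed

text \<open>The functions 1 - exp (- i * m(ramp)) lie below the indicator of
  \<open>M_above E x\<close> and converge to it, since the ramp has positive integral exactly on
  that set.\<close>

lemma cumulant_tendsto_above_mass:
  assumes x: "x > 0"
  shows "(\<lambda>i. cumulant (\<lambda>y. real i * ramp x (x + 1) y)) \<longlonglongrightarrow> above_mass x"
  unfolding cumulant_def above_mass_eq[OF x, symmetric]
proof (rule integral_dominated_convergence[where w="indicat_real (M_above E x)"])
  have C: "ramp x (x + 1) \<in> C_K_plus E" using x by (simp add: ramp_C_K_plus)
  have Ci: "(\<lambda>y. real i * ramp x (x + 1) y) \<in> C_K_plus E" for i by (rule C_K_plus_scale[OF C]) simp
  show "indicat_real (M_above E x) \<in> borel_measurable \<Lambda>"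
    by (rule meas_Lam[OF borel_measurable_indicator[OF M_above_sets[OF x]]])
  show "(\<lambda>m. 1 - exp (- (\<integral>y. real i * ramp x (x + 1) y \<partial>m))) \<in> borel_measurable \<Lambda>" for i
    by (rule meas_Lam[OF one_minus_laplace_measurable[OF Ci]])
  show "integrable \<Lambda> (indicat_real (M_above E x))" by (rule integrable_indicator_M_above[OF x])
  have 0: "(\<integral>y. ramp x (x + 1) y \<partial>m) = 0" if "m \<in> Mp E" "m \<notin> M_above E x" for m
    using that integral_C_K_plus_nonneg[OF that(1) C] unfolding M_above_eq[OF x] by auto
  show "AE m in \<Lambda>. (\<lambda>i. 1 - exp (- (\<integral>y. real i * ramp x (x + 1) y \<partial>m))) \<longlonglongrightarrow> indicat_real (M_above E x) m"
  proof (rule AE_I2)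
    fix m assume "m \<in> space \<Lambda>"
    then have m: "m \<in> Mp E" by simp
    show "(\<lambda>i. 1 - exp (- (\<integral>y. real i * ramp x (x + 1) y \<partial>m))) \<longlonglongrightarrow> indicat_real (M_above E x) m"
    proof (cases "m \<in> M_above E x")
      case True
      then have pos: "0 < (\<integral>y. ramp x (x + 1) y \<partial>m)" unfolding M_above_eq[OF x] by simp
      have "filterlim (\<lambda>i. (\<integral>y. ramp x (x + 1) y \<partial>m) * real i) at_top sequentially"
        by (rule filterlim_tendsto_pos_mult_at_top[OF tendsto_const pos filterlim_real_sequentially])
      then have "filterlim (\<lambda>i. - ((\<integral>y. ramp x (x + 1) y \<partial>m) * real i)) at_bot sequentially"
        by (simp only: filterlim_uminus_at_bot minus_minus)
      from tendsto_diff[OF tendsto_const filterlim_compose[OF exp_at_bot this], of 1]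
      show ?thesis using True by (simp add: mult.commute)
    next
      case False
      then show ?thesis using 0[OF m] by simp
    qed
  qed
  show "AE m in \<Lambda>. norm (1 - exp (- (\<integral>y. real i * ramp x (x + 1) y \<partial>m))) \<le> indicat_real (M_above E x) m" for i
  proof (rule AE_I2)
    fix m assume "m \<in> space \<Lambda>"
    then have m: "m \<in> Mp E" by simp
    show "norm (1 - exp (- (\<integral>y. real i * ramp x (x + 1) y \<partial>m))) \<le> indicat_real (M_above E x) m"
      using 0[OF m] integral_C_K_plus_nonneg[OF m C] by (cases "m \<in> M_above E x") auto
  qed
qed

end

section \<open>Point processes of rare events\<close>

locale rare_events = canonical E L \<Lambda> + prob_space P
  for E L \<Lambda> and P :: "'a measure" +
  fixes \<xi> :: "nat \<Rightarrow> 'a \<Rightarrow> real" and a :: "nat \<Rightarrow> real" and r k :: "nat \<Rightarrow> nat"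
  assumes \<xi>: "\<And>j. 1 \<le> j \<Longrightarrow> \<xi> j \<in> borel_measurable P"
    and a_pos: "\<And>n. 1 \<le> n \<Longrightarrow> a n > 0"
    and in_E: "\<And>n j \<omega>. 1 \<le> j \<Longrightarrow> j \<le> n \<Longrightarrow> \<omega> \<in> space P \<Longrightarrow> ereal (\<xi> j \<omega> / a n) \<in> E"
    and k_def: "\<And>n. k n = n div r n" and k_lim: "filterlim k at_top sequentially"
    and prob_L: "prob_space L"
    and mixing: "\<And>f. f \<in> C_K_plus E \<Longrightarrow>
      (\<lambda>n. \<bar>(\<integral>\<omega>. exp (- (\<Sum>j=1..n. f (ereal (\<xi> j \<omega> / a n)))) \<partial>P)
            - (\<integral>\<omega>. exp (- (\<Sum>j=1..r n. f (ereal (\<xi> j \<omega> / a n)))) \<partial>P) ^ k n\<bar>) \<longlonglongrightarrow> 0"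
begin

text \<open>Only the first \<open>n\<close> scaled points are known to lie in \<open>E\<close>, and \<open>r n \<le> n\<close> holds only eventually.\<close>

definition R :: "nat \<Rightarrow> nat" where
  "R n = (if r n \<le> n then r n else 0)"

definition S :: "nat \<Rightarrow> nat \<Rightarrow> (ereal \<Rightarrow> real) \<Rightarrow> 'a \<Rightarrow> real" where
  "S m n f \<omega> = (\<Sum>j=1..m. f (ereal (\<xi> j \<omega> / a n)))"

definition PP :: "nat \<Rightarrow> nat \<Rightarrow> 'a \<Rightarrow> ereal measure" where
  "PP m n \<omega> = dirac_sum E {1..m} (\<lambda>j. ereal (\<xi> j \<omega> / a n))"

text \<open>The existential form gives the empty event for m = 0, where \<open>Max\<close> of the
  empty set would be unspecified.\<close>

definition exceed :: "nat \<Rightarrow> nat \<Rightarrow> real \<Rightarrow> 'a set" where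
  "exceed m n x = {\<omega> \<in> space P. \<exists>j\<in>{1..m}. \<bar>\<xi> j \<omega>\<bar> > x * a n}"

lemma R_le: "R n \<le> n" by (simp add: R_def)

text \<open>Both \<open>n div 0\<close> and \<open>n div r\<close> with r > n are 0, so
  \<open>k n \<ge> 1\<close> rules out both.\<close>

lemma eventually_block: "\<forall>\<^sub>F n in sequentially. 1 \<le> n \<and> 0 < r n \<and> r n \<le> n \<and> R n = r n"
proof -
  have "\<forall>\<^sub>F n in sequentially. 1 \<le> k n" using k_lim unfolding filterlim_at_top by blast
  then show ?thesis
  proof eventually_elim
    case (elim n)
    then have d: "1 \<le> n div r n" using k_def[of n] by simp
    have "r n \<noteq> 0"
    proof
      assume "r n = 0"
      then show False using d by simp
    qed
    moreover have "\<not> n < r n"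
    proof
      assume "n < r n"
      then show False using d by simp
    qed
    ultimately show ?case by (simp add: R_def)
  qed
qed

lemma PP_Mp: "m \<le> n \<Longrightarrow> \<omega> \<in> space P \<Longrightarrow> PP m n \<omega> \<in> Mp E"
  unfolding PP_def by (rule dirac_sum_Mp) (auto intro: in_E)

lemma integral_PP:
  "m \<le> n \<Longrightarrow> \<omega> \<in> space P \<Longrightarrow> f \<in> C_K_plus E \<Longrightarrow> (\<integral>x. f x \<partial>PP m n \<omega>) = S m n f \<omega>"
  unfolding PP_def S_def by (rule integral_dirac_sum) (auto intro: in_E)

lemma S_measurable:
  assumes mn: "m \<le> n" and f: "f \<in> C_K_plus E"
  shows "S m n f \<in> borel_measurable P"
proof -
  have "(\<lambda>\<omega>. f (ereal (\<xi> j \<omega> / a n))) \<in> borel_measurable P" if "j \<in> {1..m}" for j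
  proof (rule measurable_compose[OF _ C_K_plus_measurable[OF f]])
    have [measurable]: "\<xi> j \<in> borel_measurable P" using \<xi> that by simp
    show "(\<lambda>\<omega>. ereal (\<xi> j \<omega> / a n)) \<in> P \<rightarrow>\<^sub>M borel_on E"
    proof (rule measurable_restrict_space2)
      show "(\<lambda>\<omega>. ereal (\<xi> j \<omega> / a n)) \<in> space P \<rightarrow> E" using in_E that mn by auto
      show "(\<lambda>\<omega>. ereal (\<xi> j \<omega> / a n)) \<in> borel_measurable P" by measurable
    qed
  qed
  then show ?thesis unfolding S_def by (rule borel_measurable_sum)
qed

lemma S_nonneg: "m \<le> n \<Longrightarrow> \<omega> \<in> space P \<Longrightarrow> f \<in> C_K_plus E \<Longrightarrow> 0 \<le> S m n f \<omega>"
  using integral_PP[of m n \<omega> f] integral_C_K_plus_nonneg[OF PP_Mp, of m n \<omega> f] by simp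

lemma PP_measurable: "m \<le> n \<Longrightarrow> PP m n \<in> P \<rightarrow>\<^sub>M Mp_borel E"
proof (rule measurable_Mp_borel)
  fix f assume "m \<le> n" "f \<in> C_K_plus E"
  then show "(\<lambda>\<omega>. \<integral>x. f x \<partial>PP m n \<omega>) \<in> borel_measurable P"
    using S_measurable[of m n f] integral_PP[of m n _ f] by (simp cong: measurable_cong)
qed (rule PP_Mp)

lemma exceed_sets: assumes "m \<le> n" shows "exceed m n x \<in> sets P"
proof -
  have "exceed m n x = (\<Union>j\<in>{1..m}. {\<omega> \<in> space P. \<bar>\<xi> j \<omega>\<bar> > x * a n})"
    unfolding exceed_def by auto
  also have "\<dots> \<in> sets P"
  proof (rule sets.finite_UN)
    fix j assume "j \<in> {1..m}"
    then have [measurable]: "\<xi> j \<in> borel_measurable P" using \<xi> by simp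
    show "{\<omega> \<in> space P. \<bar>\<xi> j \<omega>\<bar> > x * a n} \<in> sets P" by measurable
  qed simp
  finally show ?thesis .
qed

lemma abs_scaled: assumes "1 \<le> n" shows "\<bar>ereal (\<xi> j \<omega> / a n)\<bar> = ereal (\<bar>\<xi> j \<omega>\<bar> / a n)"
  using a_pos[OF assms] by simp

lemma scaled_gt_iff: assumes "1 \<le> n" shows "ereal x < \<bar>ereal (\<xi> j \<omega> / a n)\<bar> \<longleftrightarrow> x * a n < \<bar>\<xi> j \<omega>\<bar>"
  unfolding abs_scaled[OF assms] using a_pos[OF assms] by (simp add: pos_less_divide_eq)

lemma S_off_exceed:
  assumes n: "1 \<le> n" and \<omega>: "\<omega> \<in> space P" "\<omega> \<notin> exceed m n x" and mn: "m \<le> n"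
    and f: "\<And>y. y \<in> E \<Longrightarrow> \<bar>y\<bar> \<le> ereal x \<Longrightarrow> f y = 0"
  shows "S m n f \<omega> = 0"
  unfolding S_def
proof (rule sum.neutral, rule ballI)
  fix j assume j: "j \<in> {1..m}"
  then have "\<not> x * a n < \<bar>\<xi> j \<omega>\<bar>" using \<omega> unfolding exceed_def by blast
  then have "\<bar>ereal (\<xi> j \<omega> / a n)\<bar> \<le> ereal x" unfolding scaled_gt_iff[OF n, symmetric] by (simp only: not_less)
  then show "f (ereal (\<xi> j \<omega> / a n)) = 0" using f in_E[of j n \<omega>] j mn \<omega>(1) by simp
qed

lemma S_on_exceed:
  assumes n: "1 \<le> n" and \<omega>: "\<omega> \<in> exceed m n x" and mn: "m \<le> n"
    and f: "f \<in> C_K_plus E" "\<And>y. y \<in> E \<Longrightarrow> ereal x < \<bar>y\<bar> \<Longrightarrow> c \<le> f y"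
  shows "c \<le> S m n f \<omega>"
proof -
  obtain j where j: "j \<in> {1..m}" "x * a n < \<bar>\<xi> j \<omega>\<bar>" and s: "\<omega> \<in> space P"
    using \<omega> unfolding exceed_def by blast
  have "c \<le> f (ereal (\<xi> j \<omega> / a n))"
    using j mn s by (intro f(2) in_E) (auto simp only: scaled_gt_iff[OF n] atLeastAtMost_iff)
  also have "\<dots> \<le> S m n f \<omega>" unfolding S_def
  proof (rule member_le_sum[OF j(1)])
    fix i assume "i \<in> {1..m} - {j}"
    then show "0 \<le> f (ereal (\<xi> i \<omega> / a n))"
      using f(1) in_E[of i n \<omega>] mn s unfolding C_K_plus_def by auto
  qed simp
  finally show ?thesis .
qed

lemma PP_above_iff:
  assumes n: "1 \<le> n" and \<omega>: "\<omega> \<in> space P" and mn: "m \<le> n" and x: "x > 0"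
  shows "PP m n \<omega> \<in> M_above E x \<longleftrightarrow> \<omega> \<in> exceed m n x"
proof -
  have C: "ramp x (x + 1) \<in> C_K_plus E" using x by (simp add: ramp_C_K_plus)
  have "PP m n \<omega> \<in> M_above E x \<longleftrightarrow> 0 < S m n (ramp x (x + 1)) \<omega>"
    unfolding M_above_eq[OF x] using PP_Mp[OF mn \<omega>] integral_PP[OF mn \<omega> C] by simp
  also have "\<dots> \<longleftrightarrow> \<omega> \<in> exceed m n x"
  proof
    assume "0 < S m n (ramp x (x + 1)) \<omega>"
    then show "\<omega> \<in> exceed m n x"
      using S_off_exceed[OF n \<omega> _ mn, of x "ramp x (x + 1)"] ramp_eq_0[of x "x + 1"] by force
  next
    assume e: "\<omega> \<in> exceed m n x"
    then obtain j where j: "j \<in> {1..m}" "x * a n < \<bar>\<xi> j \<omega>\<bar>" unfolding exceed_def by blast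
    have "0 < ramp x (x + 1) (ereal (\<xi> j \<omega> / a n))"
      using j(2) ramp_pos_iff[of x "x + 1"] by (simp only: scaled_gt_iff[OF n])
    also have "\<dots> \<le> S m n (ramp x (x + 1)) \<omega>"
      unfolding S_def by (rule member_le_sum[OF j(1)]) (auto intro: ramp_bounds)
    finally show "0 < S m n (ramp x (x + 1)) \<omega>" .
  qed
  finally show ?thesis .
qed

lemma laplace_S_integrable:
  assumes "m \<le> n" "f \<in> C_K_plus E"
  shows "integrable P (\<lambda>\<omega>. exp (- S m n f \<omega>))"
proof (rule integrable_const_bound[of _ 1])
  show "(\<lambda>\<omega>. exp (- S m n f \<omega>)) \<in> borel_measurable P"
    by (rule borel_measurable_exp_uminus[OF S_measurable[OF assms]])
  show "AE \<omega> in P. norm (exp (- S m n f \<omega>)) \<le> 1"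
    using S_nonneg[OF assms(1) _ assms(2)] by (intro AE_I2) simp
qed

lemma laplace_PP:
  assumes "m \<le> n" "f \<in> C_K_plus E"
  shows "(\<integral>M. exp (- (\<integral>x. f x \<partial>M)) \<partial>distr P (Mp_borel E) (PP m n)) = (\<integral>\<omega>. exp (- S m n f \<omega>) \<partial>P)"
proof -
  have "(\<integral>M. exp (- (\<integral>x. f x \<partial>M)) \<partial>distr P (Mp_borel E) (PP m n)) =
      (\<integral>\<omega>. exp (- (\<integral>x. f x \<partial>PP m n \<omega>)) \<partial>P)"
    by (rule integral_distr[OF PP_measurable[OF assms(1)] borel_measurable_exp_uminus[OF measurable_integral[OF assms(2)]]])
  also have "\<dots> = (\<integral>\<omega>. exp (- S m n f \<omega>) \<partial>P)"
    by (rule Bochner_Integration.integral_cong) (simp_all add: integral_PP[OF assms(1) _ assms(2)])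
  finally show ?thesis .
qed

text \<open>In (1 - q) ^ k this plays the role of the small success probability of a single
  block.\<close>

definition q :: "(ereal \<Rightarrow> real) \<Rightarrow> nat \<Rightarrow> real" where
  "q f n = (\<integral>\<omega>. 1 - exp (- S (R n) n f \<omega>) \<partial>P)"

lemma q_eq: "f \<in> C_K_plus E \<Longrightarrow> q f n = 1 - (\<integral>\<omega>. exp (- S (R n) n f \<omega>) \<partial>P)"
  unfolding q_def using laplace_S_integrable[OF R_le, of f n] by (simp add: prob_space)

lemma q_bounds: assumes f: "f \<in> C_K_plus E" shows "0 \<le> q f n" "q f n \<le> 1"
proof -
  show "0 \<le> q f n" unfolding q_def
    by (rule Bochner_Integration.integral_nonneg) (use S_nonneg[OF R_le _ f] in simp)
  show "q f n \<le> 1" unfolding q_eq[OF f] by (simp add: Bochner_Integration.integral_nonneg)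
qed

text \<open>By the mixing condition the Laplace functional of all n points and (1 - q f n) ^ k n
  have the same limit; for the power, the limit exp (- c) amounts to the limit c of k * q.\<close>

lemma laplace_iff_q:
  assumes f: "f \<in> C_K_plus E"
  shows "(\<lambda>n. \<integral>\<omega>. exp (- S n n f \<omega>) \<partial>P) \<longlonglongrightarrow> exp (- c) \<longleftrightarrow> (\<lambda>n. real (k n) * q f n) \<longlonglongrightarrow> c"
proof -
  let ?u = "\<lambda>n. \<integral>\<omega>. exp (- S n n f \<omega>) \<partial>P"
  let ?v = "\<lambda>n. (1 - q f n) ^ k n"
  have "(\<lambda>n. \<bar>?u n - (\<integral>\<omega>. exp (- S (r n) n f \<omega>) \<partial>P) ^ k n\<bar>) \<longlonglongrightarrow> 0"
    using mixing[OF f] unfolding S_def .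
  moreover have "\<forall>\<^sub>F n in sequentially. \<bar>?u n - (\<integral>\<omega>. exp (- S (r n) n f \<omega>) \<partial>P) ^ k n\<bar> = \<bar>?u n - ?v n\<bar>"
    using eventually_block by eventually_elim (simp add: q_eq[OF f])
  ultimately have "(\<lambda>n. \<bar>?u n - ?v n\<bar>) \<longlonglongrightarrow> 0" by (simp add: tendsto_cong)
  then have d: "(\<lambda>n. ?u n - ?v n) \<longlonglongrightarrow> 0" by (simp only: tendsto_rabs_zero_iff)
  have "?u \<longlonglongrightarrow> exp (- c) \<longleftrightarrow> ?v \<longlonglongrightarrow> exp (- c)"
    using tendsto_diff[OF _ d, of ?u "exp (- c)"] tendsto_add[OF _ d, of ?v "exp (- c)"] by auto
  then show ?thesis using power_tendsto_exp_iff[OF k_lim q_bounds[OF f]] by simp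
qed

text \<open>One direction tests with exp (- M(f)), which is bounded and vaguely continuous; the
  other is \<open>weakly_convergesI\<close>.\<close>

lemma weakly_converges_iff:
  "weakly_converges (vague_topology E) (\<lambda>n. distr P (Mp_borel E) (PP n n)) L \<longleftrightarrow>
    (\<forall>f\<in>C_K_plus E. (\<lambda>n. real (k n) * q f n) \<longlonglongrightarrow> cumulant f)"
proof -
  have lap: "(\<lambda>n. \<integral>M. exp (- (\<integral>x. f x \<partial>M)) \<partial>distr P (Mp_borel E) (PP n n)) \<longlonglongrightarrow> (\<integral>M. exp (- (\<integral>x. f x \<partial>M)) \<partial>L) \<longleftrightarrow>
      (\<lambda>n. real (k n) * q f n) \<longlonglongrightarrow> cumulant f" if f: "f \<in> C_K_plus E" for f
    unfolding laplace_PP[OF order_refl f] laplace_L[OF f] by (rule laplace_iff_q[OF f])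
  show ?thesis
  proof
    assume w: "weakly_converges (vague_topology E) (\<lambda>n. distr P (Mp_borel E) (PP n n)) L"
    show "\<forall>f\<in>C_K_plus E. (\<lambda>n. real (k n) * q f n) \<longlonglongrightarrow> cumulant f"
    proof
      fix f assume f: "f \<in> C_K_plus E"
      have "continuous_map (vague_topology E) euclideanreal ((\<lambda>t. exp (- t)) \<circ> (\<lambda>M. \<integral>x. f x \<partial>M))"
        by (rule continuous_map_compose[OF vague_continuous_integral[OF f]])
          (auto intro!: continuous_intros)
      then have "continuous_map (vague_topology E) euclideanreal (\<lambda>M. exp (- (\<integral>x. f x \<partial>M)))"
        by (simp only: comp_def)
      moreover have "bounded ((\<lambda>M. exp (- (\<integral>x. f x \<partial>M))) ` topspace (vague_topology E))"
        unfolding bounded_iff topspace_vague using integral_C_K_plus_nonneg[OF _ f]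
        by (intro exI[of _ 1]) simp
      ultimately show "(\<lambda>n. real (k n) * q f n) \<longlonglongrightarrow> cumulant f"
        using w unfolding weakly_converges_def lap[OF f, symmetric] by blast
    qed
  next
    assume *: "\<forall>f\<in>C_K_plus E. (\<lambda>n. real (k n) * q f n) \<longlonglongrightarrow> cumulant f"
    show "weakly_converges (vague_topology E) (\<lambda>n. distr P (Mp_borel E) (PP n n)) L"
    proof (rule weakly_convergesI)
      show "prob_space (distr P (Mp_borel E) (PP n n))" for n
        by (rule prob_space_distr[OF PP_measurable]) simp
      show "sets (distr P (Mp_borel E) (PP n n)) = sets (Mp_borel E)" for n by simp
      show "(\<lambda>n. \<integral>M. exp (- (\<integral>x. f x \<partial>M)) \<partial>distr P (Mp_borel E) (PP n n)) \<longlonglongrightarrow> (\<integral>M. exp (- (\<integral>x. f x \<partial>M)) \<partial>L)"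
        if "f \<in> C_K_plus E" for f
        using * that lap by blast
    qed (rule prob_L L_sets)+
  qed
qed

text \<open>Its value at M is the left-hand side of condition (b), see
  \<open>measure_block_law\<close>. Reweighting before the push-forward makes it a finite measure to
  which the portmanteau argument applies.\<close>

definition block_law :: "real \<Rightarrow> nat \<Rightarrow> ereal measure measure" where
  "block_law x n = distr (density P (\<lambda>\<omega>. ennreal (real (k n) * indicator (exceed (R n) n x) \<omega>)))
     (Mp_borel E) (PP (R n) n)"

lemma sets_block_law [simp]: "sets (block_law x n) = sets (Mp_borel E)"
  by (simp add: block_law_def)

lemma space_block_law [simp]: "space (block_law x n) = Mp E"
  by (simp add: block_law_def)

lemma integral_block_law:
  fixes h :: "ereal measure \<Rightarrow> real"
  assumes h: "h \<in> borel_measurable (Mp_borel E)"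
  shows "(\<integral>M. h M \<partial>block_law x n) =
    real (k n) * (\<integral>\<omega>. indicator (exceed (R n) n x) \<omega> * h (PP (R n) n \<omega>) \<partial>P)"
proof -
  let ?g = "\<lambda>\<omega>. real (k n) * indicator (exceed (R n) n x) \<omega>"
  note [measurable] = exceed_sets[OF R_le, of n x] PP_measurable[OF R_le, of n] h
  have "(\<integral>M. h M \<partial>block_law x n) = (\<integral>\<omega>. h (PP (R n) n \<omega>) \<partial>density P (\<lambda>\<omega>. ennreal (?g \<omega>)))"
    unfolding block_law_def by (rule integral_distr) (simp_all add: h PP_measurable[OF R_le])
  also have "\<dots> = (\<integral>\<omega>. ?g \<omega> *\<^sub>R h (PP (R n) n \<omega>) \<partial>P)"
  proof (rule integral_density)
    show "(\<lambda>\<omega>. h (PP (R n) n \<omega>)) \<in> borel_measurable P" by measurable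
    show "?g \<in> borel_measurable P" by measurable
  qed simp
  also have "\<dots> = (\<integral>\<omega>. real (k n) * (indicator (exceed (R n) n x) \<omega> * h (PP (R n) n \<omega>)) \<partial>P)"
    by (simp add: mult.assoc)
  finally show ?thesis by simp
qed

lemma finite_block_law: "finite_measure (block_law x n)"
proof (rule finite_measureI)
  note [measurable] = exceed_sets[OF R_le, of n x] PP_measurable[OF R_le, of n]
  have "emeasure (block_law x n) (space (block_law x n)) =
      emeasure (density P (\<lambda>\<omega>. ennreal (real (k n) * indicator (exceed (R n) n x) \<omega>))) (space P)"
    unfolding block_law_def by (subst emeasure_distr) (use sets.top[of "Mp_borel E"] in \<open>auto intro!: arg_cong2[where f=emeasure] PP_Mp[OF R_le]\<close>)
  also have "\<dots> = (\<integral>\<^sup>+\<omega>. ennreal (real (k n) * indicator (exceed (R n) n x) \<omega>) * indicator (space P) \<omega> \<partial>P)"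
    by (rule emeasure_density) auto
  also have "\<dots> \<le> (\<integral>\<^sup>+\<omega>. ennreal (real (k n)) \<partial>P)"
    by (rule nn_integral_mono) (auto simp: indicator_def)
  also have "\<dots> < \<infinity>" by (simp add: emeasure_space_1)
  finally show "emeasure (block_law x n) (space (block_law x n)) \<noteq> \<infinity>" by simp
qed

lemma measure_block_law:
  assumes M: "M \<in> sets (Mp_borel E)"
  shows "measure (block_law x n) M =
    real (k n) * prob {\<omega> \<in> space P. \<omega> \<in> exceed (R n) n x \<and> PP (R n) n \<omega> \<in> M}"
proof -
  let ?B = "{\<omega> \<in> space P. \<omega> \<in> exceed (R n) n x \<and> PP (R n) n \<omega> \<in> M}"
  note [measurable] = exceed_sets[OF R_le, of n x] PP_measurable[OF R_le, of n] M
  have B: "?B \<in> sets P" by measurable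
  have "measure (block_law x n) M = (\<integral>m. indicat_real M m \<partial>block_law x n)"
    using sets.sets_into_space[OF M] by (simp add: Int_absorb2)
  also have "\<dots> = real (k n) * (\<integral>\<omega>. indicator (exceed (R n) n x) \<omega> * indicat_real M (PP (R n) n \<omega>) \<partial>P)"
    by (rule integral_block_law) measurable
  also have "(\<integral>\<omega>. indicator (exceed (R n) n x) \<omega> * indicat_real M (PP (R n) n \<omega>) \<partial>P) = (\<integral>\<omega>. indicat_real ?B \<omega> \<partial>P)"
    by (rule Bochner_Integration.integral_cong) (auto simp: indicator_def)
  also have "\<dots> = prob ?B" using B by simp
  finally show ?thesis .
qed

definition limit_law :: "real \<Rightarrow> ereal measure measure" where
  "limit_law x = density \<Lambda> (indicator (M_above E x))"

lemma sets_limit_law [simp]: "sets (limit_law x) = sets (Mp_borel E)"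
  by (simp add: limit_law_def sets_Lam)

lemma space_limit_law [simp]: "space (limit_law x) = Mp E"
  by (simp add: limit_law_def)

lemma emeasure_limit_law:
  assumes x: "x > 0" and M: "M \<in> sets (Mp_borel E)"
  shows "emeasure (limit_law x) M = emeasure \<Lambda> (M \<inter> M_above E x)"
  unfolding limit_law_def using M_above_sets[OF x] M sets_Lam
  by (subst emeasure_restricted) (auto simp: Int_commute)

lemma finite_limit_law: assumes x: "x > 0" shows "finite_measure (limit_law x)"
proof (rule finite_measureI)
  have "emeasure (limit_law x) (Mp E) = emeasure \<Lambda> (Mp E \<inter> M_above E x)"
    using emeasure_limit_law[OF x sets.top[of "Mp_borel E"]] by simp
  also have "\<dots> \<le> emeasure \<Lambda> (M_above E x)"
    by (rule emeasure_mono) (use M_above_sets[OF x] sets_Lam in auto)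
  also have "\<dots> < \<infinity>" by (rule M_above_finite[OF x])
  finally show "emeasure (limit_law x) (space (limit_law x)) \<noteq> \<infinity>" by simp
qed

lemma integral_limit_law:
  fixes h :: "ereal measure \<Rightarrow> real"
  assumes x: "x > 0" and h: "h \<in> borel_measurable (Mp_borel E)"
  shows "(\<integral>M. h M \<partial>limit_law x) = (\<integral>M. indicat_real (M_above E x) M * h M \<partial>\<Lambda>)"
proof -
  have [measurable]: "M_above E x \<in> sets \<Lambda>" using M_above_sets[OF x] sets_Lam by simp
  note [measurable] = meas_Lam[OF h]
  have eq: "limit_law x = density \<Lambda> (\<lambda>M. ennreal (indicator (M_above E x) M))"
    unfolding limit_law_def by (simp add: ennreal_indicator)
  have "(\<integral>M. h M \<partial>limit_law x) = (\<integral>M. indicat_real (M_above E x) M *\<^sub>R h M \<partial>\<Lambda>)"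
    unfolding eq
  proof (rule integral_density)
    show "h \<in> borel_measurable \<Lambda>" by (rule meas_Lam[OF h])
    show "indicat_real (M_above E x) \<in> borel_measurable \<Lambda>" by measurable
  qed simp
  then show ?thesis by (simp only: real_scaleR_def)
qed

end

text \<open>An interchange of limits: for fixed i the bounds are apart by \<open>err i\<close>, and
  the gap closes only when first n and then i tends to infinity.\<close>

lemma tendsto_squeeze_family:
  fixes J :: "nat \<Rightarrow> real" and lo err :: "nat \<Rightarrow> nat \<Rightarrow> real"
  assumes J: "\<And>i. \<forall>\<^sub>F n in sequentially. lo i n \<le> J n \<and> J n \<le> lo i n + err i n"
    and lo: "\<And>i. lo i \<longlonglongrightarrow> lo' i" and err: "\<And>i. err i \<longlonglongrightarrow> err' i"
    and J': "\<And>i. lo' i \<le> J'" "\<And>i. J' \<le> lo' i + err' i" and err': "err' \<longlonglongrightarrow> 0"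
  shows "J \<longlonglongrightarrow> J'"
proof (rule order_tendstoI)
  fix b assume "b < J'"
  then have "\<forall>\<^sub>F i in sequentially. err' i < J' - b" by (intro order_tendstoD(2)[OF err']) simp
  then obtain i where "err' i < J' - b" by (auto simp: eventually_sequentially)
  then have "b < lo' i" using J'(2)[of i] by linarith
  from order_tendstoD(1)[OF lo this] J[of i] show "\<forall>\<^sub>F n in sequentially. b < J n"
    by eventually_elim linarith
next
  fix b assume "J' < b"
  then have "\<forall>\<^sub>F i in sequentially. err' i < b - J'" by (intro order_tendstoD(2)[OF err']) simp
  then obtain i where "err' i < b - J'" by (auto simp: eventually_sequentially)
  then have "lo' i + err' i < b" using J'(1)[of i] by linarith
  from order_tendstoD(2)[OF tendsto_add[OF lo err] this] J[of i] show "\<forall>\<^sub>F n in sequentially. J n < b"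
    by eventually_elim linarith
qed

lemma (in punctured_space) level_sets:
  fixes h :: "ereal measure \<Rightarrow> real"
  assumes "h \<in> borel_measurable (Mp_borel E)"
  shows "{m \<in> Mp E. h m > t} \<in> sets (Mp_borel E)" "{m \<in> Mp E. h m = t} \<in> sets (Mp_borel E)"
  using measurable_sets[OF assms, of "{t<..}"] measurable_sets[OF assms, of "{t}"]
  by (simp_all add: vimage_def Int_def conj_commute)

section \<open>Exceedances, block laws and cumulants\<close>

context rare_events
begin

text \<open>Supported beyond x, so that 1 - exp (- S) never exceeds the indicator of an exceedance
  of x.\<close>

lemma high_ramp:
  assumes "x > 0"
  shows "(\<lambda>y. real i * ramp x (x + 1) y) \<in> C_K_plus E"
    "\<And>y. \<bar>y\<bar> \<le> ereal x \<Longrightarrow> real i * ramp x (x + 1) y = 0"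
  using assms by (auto intro!: C_K_plus_scale ramp_C_K_plus simp: ramp_eq_0)

text \<open>Full height beyond x, so that an exceedance of x makes exp (- S) at most exp (- i); the
  price is a support reaching down to y < x.\<close>

lemma low_ramp:
  assumes "0 < y" "y < x"
  shows "(\<lambda>z. real i * ramp y x z) \<in> C_K_plus E"
    "\<And>z. \<bar>z\<bar> \<le> ereal y \<Longrightarrow> real i * ramp y x z = 0"
    "\<And>z. ereal x < \<bar>z\<bar> \<Longrightarrow> real i \<le> real i * ramp y x z"
  using assms by (auto intro!: C_K_plus_scale ramp_C_K_plus simp: ramp_eq_0 ramp_eq_1)

text \<open>The probability of no exceedance is compared with Laplace functionals of ramps. Without
  exceedance of x a ramp starting at x sums to 0, which yields
  \<open>above_mass x \<le> \<tau> x\<close>. A ramp from x to full height at z > x yields the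
  converse with \<tau> z and an error exp (- i); continuity lets z decrease to x.\<close>

lemma above_mass_eq_limit:
  assumes W: "\<And>f. f \<in> C_K_plus E \<Longrightarrow> (\<lambda>n. real (k n) * q f n) \<longlonglongrightarrow> cumulant f"
    and maxlim: "\<And>x. x > 0 \<Longrightarrow> (\<lambda>n. prob (space P - exceed n n x)) \<longlonglongrightarrow> exp (- \<tau> x)"
    and \<tau>: "\<And>x. x > 0 \<Longrightarrow> isCont \<tau> x" and x: "x > 0"
  shows "above_mass x = \<tau> x"
proof -
  have lim: "(\<lambda>n. \<integral>\<omega>. exp (- S n n f \<omega>) \<partial>P) \<longlonglongrightarrow> exp (- cumulant f)" if "f \<in> C_K_plus E" for f
    using W[OF that] laplace_iff_q[OF that] by simp
  have prob_eq: "prob (space P - exceed n n z) = (\<integral>\<omega>. indicat_real (space P - exceed n n z) \<omega> \<partial>P)" for n z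
    using exceed_sets[of n n z] by (simp add: Int_absorb2)
  have ind_int: "integrable P (indicat_real (space P - exceed n n z))" for n z
    using exceed_sets[of n n z] by (intro integrable_real_indicator) (auto simp: emeasure_eq_measure)
  have "cumulant (\<lambda>y. real i * ramp x (x + 1) y) \<le> \<tau> x" for i
  proof -
    let ?f = "\<lambda>y. real i * ramp x (x + 1) y"
    note f = high_ramp[OF x, where i=i]
    have "exp (- \<tau> x) \<le> exp (- cumulant ?f)"
    proof (rule tendsto_le[OF sequentially_bot lim[OF f(1)] maxlim[OF x]])
      show "\<forall>\<^sub>F n in sequentially. prob (space P - exceed n n x) \<le> (\<integral>\<omega>. exp (- S n n ?f \<omega>) \<partial>P)"
        using eventually_ge_at_top[of 1]
      proof eventually_elim
        case (elim n)
        show ?case unfolding prob_eq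
        proof (rule integral_mono[OF ind_int laplace_S_integrable[OF order_refl f(1)]])
          fix \<omega> assume "\<omega> \<in> space P"
          then show "indicat_real (space P - exceed n n x) \<omega> \<le> exp (- S n n ?f \<omega>)"
            using S_off_exceed[OF elim _ _ order_refl f(2), of \<omega>] by (auto simp: indicator_def)
        qed
      qed
    qed
    then show ?thesis by simp
  qed
  then have upper: "above_mass x \<le> \<tau> x"
    by (intro LIMSEQ_le_const2[OF cumulant_tendsto_above_mass[OF x]]) blast
  have "exp (- above_mass x) \<le> exp (- \<tau> (x + 1 / real (Suc i))) + exp (- real i)" for i
  proof -
    \<comment> \<open>Level and height share the index i, so one limit removes both the shift from x
      to z and the error exp (- i).\<close>
    define z where "z = x + 1 / real (Suc i)"
    have z: "x < z" "0 < z" using x by (auto simp: z_def add_pos_pos)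
    let ?f = "\<lambda>y. real i * ramp x z y"
    note f = low_ramp[OF x z(1), where i=i]
    have "exp (- cumulant ?f) \<le> exp (- \<tau> z) + exp (- real i)"
    proof (rule tendsto_le[OF sequentially_bot tendsto_add[OF maxlim[OF z(2)] tendsto_const] lim[OF f(1)]])
      show "\<forall>\<^sub>F n in sequentially. (\<integral>\<omega>. exp (- S n n ?f \<omega>) \<partial>P) \<le> prob (space P - exceed n n z) + exp (- real i)"
        using eventually_ge_at_top[of 1]
      proof eventually_elim
        case (elim n)
        have "(\<integral>\<omega>. exp (- S n n ?f \<omega>) \<partial>P) \<le> (\<integral>\<omega>. indicat_real (space P - exceed n n z) \<omega> + exp (- real i) \<partial>P)"
        proof (rule integral_mono[OF laplace_S_integrable[OF order_refl f(1)]])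
          show "integrable P (\<lambda>\<omega>. indicat_real (space P - exceed n n z) \<omega> + exp (- real i))"
            using ind_int by simp
          fix \<omega> assume \<omega>: "\<omega> \<in> space P"
          show "exp (- S n n ?f \<omega>) \<le> indicat_real (space P - exceed n n z) \<omega> + exp (- real i)"
          proof (cases "\<omega> \<in> exceed n n z")
            case True
            have "real i \<le> S n n ?f \<omega>" by (rule S_on_exceed[OF elim True order_refl f(1)]) (rule f(3))
            then show ?thesis using True by simp
          next
            case False
            then show ?thesis using \<omega> S_nonneg[OF order_refl \<omega> f(1)] by (simp add: add_increasing2)
          qed
        qed
        also have "\<dots> = prob (space P - exceed n n z) + exp (- real i)"
          unfolding prob_eq using ind_int by (simp add: prob_space)
        finally show ?case .
      qed
    qed
    moreover have "cumulant ?f \<le> above_mass x"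
      by (rule cumulant_le_above_mass[OF x f(1)]) (rule f(2))
    ultimately show ?thesis unfolding z_def by (smt (verit) exp_le_cancel_iff)
  qed
  moreover have "(\<lambda>i. exp (- \<tau> (x + 1 / real (Suc i))) + exp (- real i)) \<longlonglongrightarrow> exp (- \<tau> x) + 0"
  proof (intro tendsto_add tendsto_exp tendsto_minus)
    have "(\<lambda>i. x + 1 / real (Suc i)) \<longlonglongrightarrow> x + 0"
      by (intro tendsto_add tendsto_const LIMSEQ_Suc[OF lim_1_over_n])
    then show "(\<lambda>i. \<tau> (x + 1 / real (Suc i))) \<longlonglongrightarrow> \<tau> x"
      using isCont_tendsto_compose[OF \<tau>[OF x]] by simp
    have "filterlim (\<lambda>i. - real i) at_bot sequentially"
      using filterlim_real_sequentially by (simp only: filterlim_uminus_at_bot minus_minus)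
    then show "(\<lambda>i. exp (- real i)) \<longlonglongrightarrow> 0" by (rule filterlim_compose[OF exp_at_bot])
  qed
  ultimately have "exp (- above_mass x) \<le> exp (- \<tau> x) + 0"
    by (intro LIMSEQ_le_const) auto
  then show ?thesis using upper by simp
qed

text \<open>The same comparison for a single block. A ramp starting at x gives the lower bound; one
  that starts at y < x and is full at x gives an upper bound by the mass at y, and continuity lets y
  increase to x.\<close>

lemma block_exceed_tendsto:
  assumes W: "\<And>f. f \<in> C_K_plus E \<Longrightarrow> (\<lambda>n. real (k n) * q f n) \<longlonglongrightarrow> cumulant f"
    and x: "x > 0" and cont: "isCont above_mass x"
  shows "(\<lambda>n. real (k n) * prob (exceed (R n) n x)) \<longlonglongrightarrow> above_mass x"
proof (rule order_tendstoI)
  have prob_eq: "prob (exceed (R n) n x) = (\<integral>\<omega>. indicat_real (exceed (R n) n x) \<omega> \<partial>P)" for n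
    using exceed_sets[OF R_le, of n x] sets.sets_into_space[OF exceed_sets[OF R_le, of n x]] by (simp add: Int_absorb2)
  have ind_int: "integrable P (indicat_real (exceed (R n) n x))" for n
    using exceed_sets[OF R_le, of n x] by (intro integrable_real_indicator) (auto simp: emeasure_eq_measure)
  have q_int: "integrable P (\<lambda>\<omega>. 1 - exp (- S (R n) n f \<omega>))" if "f \<in> C_K_plus E" for f n
    using laplace_S_integrable[OF R_le that] by simp
  {
    fix b assume "b < above_mass x"
    from order_tendstoD(1)[OF cumulant_tendsto_above_mass[OF x] this]
    obtain i where i: "b < cumulant (\<lambda>y. real i * ramp x (x + 1) y)" by (auto simp: eventually_sequentially)
    let ?f = "\<lambda>y. real i * ramp x (x + 1) y"
    note f = high_ramp[OF x, where i=i]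
    from order_tendstoD(1)[OF W[OF f(1)] i] eventually_ge_at_top[of 1]
    show "\<forall>\<^sub>F n in sequentially. b < real (k n) * prob (exceed (R n) n x)"
    proof eventually_elim
      case (elim n)
      have "q ?f n \<le> prob (exceed (R n) n x)"
        unfolding q_def prob_eq
      proof (rule integral_mono[OF q_int[OF f(1)] ind_int])
        fix \<omega> assume "\<omega> \<in> space P"
        then show "1 - exp (- S (R n) n ?f \<omega>) \<le> indicat_real (exceed (R n) n x) \<omega>"
          using S_off_exceed[OF elim(2) _ _ R_le f(2), of \<omega>] by (auto simp: indicator_def)
      qed
      then show ?case using elim(1) by (meson less_le_trans mult_left_mono of_nat_0_le_iff)
    qed
  }
  {
    fix b assume b: "above_mass x < b"
    have "(\<lambda>i. above_mass (x - x / real (Suc (Suc i))) / (1 - exp (- real (Suc i)))) \<longlonglongrightarrow> above_mass x / (1 - 0)"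
    proof (intro tendsto_divide tendsto_diff tendsto_const)
      have "(\<lambda>i. x - x * (1 / real (Suc (Suc i)))) \<longlonglongrightarrow> x - x * 0"
        by (intro tendsto_diff tendsto_mult tendsto_const LIMSEQ_Suc[OF LIMSEQ_Suc[OF lim_1_over_n]])
      then show "(\<lambda>i. above_mass (x - x / real (Suc (Suc i)))) \<longlonglongrightarrow> above_mass x"
        using isCont_tendsto_compose[OF cont] by simp
      have "filterlim (\<lambda>i. - real i) at_bot sequentially"
        using filterlim_real_sequentially by (simp only: filterlim_uminus_at_bot minus_minus)
      then have "(\<lambda>i. exp (- real i)) \<longlonglongrightarrow> 0" by (rule filterlim_compose[OF exp_at_bot])
      then show "(\<lambda>i. exp (- real (Suc i))) \<longlonglongrightarrow> 0" by (rule LIMSEQ_Suc)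
    qed simp
    then have "(\<lambda>i. above_mass (x - x / real (Suc (Suc i))) / (1 - exp (- real (Suc i)))) \<longlonglongrightarrow> above_mass x"
      by simp
    from order_tendstoD(2)[OF this b]
    obtain i where i: "above_mass (x - x / real (Suc (Suc i))) / (1 - exp (- real (Suc i))) < b"
      by (auto simp: eventually_sequentially)
    \<comment> \<open>The denominator i + 2 keeps y positive already for i = 0, and the height i + 1
      keeps the divisor c positive.\<close>
    define y where "y = x - x / real (Suc (Suc i))"
    define c where "c = 1 - exp (- real (Suc i))"
    have c: "c > 0" by (simp add: c_def)
    have y: "0 < y" "y < x" using x by (auto simp: y_def field_simps intro: add_pos_nonneg)
    let ?f = "\<lambda>z. real (Suc i) * ramp y x z"
    note f = low_ramp[OF y, where i="Suc i"]
    have "cumulant ?f \<le> above_mass y" by (rule cumulant_le_above_mass[OF y(1) f(1)]) (rule f(2))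
    then have "cumulant ?f < b * c"
      using i c unfolding y_def[symmetric] c_def[symmetric] by (simp add: pos_divide_less_eq)
    from order_tendstoD(2)[OF W[OF f(1)] this] eventually_ge_at_top[of 1]
    show "\<forall>\<^sub>F n in sequentially. real (k n) * prob (exceed (R n) n x) < b"
    proof eventually_elim
      case (elim n)
      have "(\<integral>\<omega>. c * indicat_real (exceed (R n) n x) \<omega> \<partial>P) \<le> q ?f n"
        unfolding q_def
      proof (rule integral_mono[OF _ q_int[OF f(1)]])
        show "integrable P (\<lambda>\<omega>. c * indicat_real (exceed (R n) n x) \<omega>)" using ind_int by simp
        fix \<omega> assume \<omega>: "\<omega> \<in> space P"
        show "c * indicat_real (exceed (R n) n x) \<omega> \<le> 1 - exp (- S (R n) n ?f \<omega>)"
        proof (cases "\<omega> \<in> exceed (R n) n x")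
          case True
          have "real (Suc i) \<le> S (R n) n ?f \<omega>" by (rule S_on_exceed[OF elim(2) True R_le f(1)]) (rule f(3))
          then have "exp (- S (R n) n ?f \<omega>) \<le> exp (- real (Suc i))" by simp
          then show ?thesis using True unfolding c_def by simp
        next
          case False
          then show ?thesis using S_nonneg[OF R_le \<omega> f(1)] by simp
        qed
      qed
      then have "c * prob (exceed (R n) n x) \<le> q ?f n" unfolding prob_eq by simp
      then have "real (k n) * (c * prob (exceed (R n) n x)) \<le> real (k n) * q ?f n"
        by (intro mult_left_mono) auto
      then have "real (k n) * prob (exceed (R n) n x) * c < b * c" using elim(1) by (simp add: mult_ac)
      then show ?case using c by simp
    qed
  }
qed

text \<open>Restriction to exceedances is not visible to Laplace functionals, but its substitute 1 -
  exp (- M(g)) is: times exp (- M(f)) it is a difference of the functionals of f and f + g. Letting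
  the height i of the ramp g grow recovers the indicator, for the blocks and for \<Lambda>
  alike.\<close>

lemma block_law_laplace:
  assumes W: "\<And>f. f \<in> C_K_plus E \<Longrightarrow> (\<lambda>n. real (k n) * q f n) \<longlonglongrightarrow> cumulant f"
    and x: "x > 0" and mass: "(\<lambda>n. real (k n) * prob (exceed (R n) n x)) \<longlonglongrightarrow> above_mass x"
    and f: "f \<in> C_K_plus E"
  shows "(\<lambda>n. \<integral>M. exp (- (\<integral>y. f y \<partial>M)) \<partial>block_law x n) \<longlonglongrightarrow> (\<integral>M. exp (- (\<integral>y. f y \<partial>M)) \<partial>limit_law x)"
proof -
  have hm: "(\<lambda>M. exp (- (\<integral>y. f y \<partial>M))) \<in> borel_measurable (Mp_borel E)"
    by (rule borel_measurable_exp_uminus[OF measurable_integral[OF f]])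
  define g where "g i = (\<lambda>y. real i * ramp x (x + 1) y)" for i :: nat
  have g: "g i \<in> C_K_plus E" "\<And>y. \<bar>y\<bar> \<le> ereal x \<Longrightarrow> g i y = 0" for i
    using high_ramp[OF x, where i=i] by (auto simp: g_def)
  define fg where "fg i = (\<lambda>y. f y + g i y)" for i
  have fg: "fg i \<in> C_K_plus E" for i unfolding fg_def by (rule C_K_plus_add[OF f g(1)])
  \<comment> \<open>Here u = exp (- M(g)), v = exp (- M(f)), and s is the indicator of an exceedance
    or of \<open>M_above E x\<close>; the error s - (1 - u) does not involve f.\<close>
  have bound: "(1 - u) * v \<le> s * v \<and> s * v \<le> (1 - u) * v + (s - (1 - u))"
    if "0 \<le> u" "u \<le> 1" "0 \<le> v" "v \<le> 1" "s = 1 \<or> s = 0 \<and> u = 1" for u v s :: real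
    using that(5)
  proof
    assume "s = 1"
    moreover have "(1 - u) * v \<le> 1 * v" by (rule mult_right_mono) (use that in auto)
    moreover have "u * v \<le> u" using that by (simp add: mult_left_le)
    ultimately show ?thesis by (simp add: left_diff_distrib)
  qed simp
  show ?thesis
  proof (rule tendsto_squeeze_family[where lo = "\<lambda>i n. real (k n) * q (fg i) n - real (k n) * q f n"
        and lo' = "\<lambda>i. cumulant (fg i) - cumulant f"
        and err = "\<lambda>i n. real (k n) * prob (exceed (R n) n x) - real (k n) * q (g i) n"
        and err' = "\<lambda>i. above_mass x - cumulant (g i)"])
    show "(\<lambda>n. real (k n) * q (fg i) n - real (k n) * q f n) \<longlonglongrightarrow> cumulant (fg i) - cumulant f" for i
      by (intro tendsto_diff W fg f)
    show "(\<lambda>n. real (k n) * prob (exceed (R n) n x) - real (k n) * q (g i) n) \<longlonglongrightarrow> above_mass x - cumulant (g i)" for i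
      by (intro tendsto_diff W g mass)
    have "(\<lambda>i. above_mass x - cumulant (g i)) \<longlonglongrightarrow> above_mass x - above_mass x"
      unfolding g_def by (intro tendsto_diff tendsto_const cumulant_tendsto_above_mass x)
    then show "(\<lambda>i. above_mass x - cumulant (g i)) \<longlonglongrightarrow> 0" by simp
    fix i
    let ?s = "indicat_real (M_above E x)"
    let ?u = "\<lambda>M. exp (- (\<integral>y. g i y \<partial>M))" and ?v = "\<lambda>M. exp (- (\<integral>y. f y \<partial>M))"
    have uv: "(1 - ?u M) * ?v M = (1 - exp (- (\<integral>y. fg i y \<partial>M))) - (1 - ?v M)" if "M \<in> Mp E" for M
      using C_K_plus_integrable[OF that f] C_K_plus_integrable[OF that g(1)]
      by (simp add: fg_def left_diff_distrib exp_add[symmetric])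
    have b: "(1 - ?u M) * ?v M \<le> ?s M * ?v M \<and> ?s M * ?v M \<le> (1 - ?u M) * ?v M + (?s M - (1 - ?u M))"
      if "M \<in> Mp E" for M
    proof (rule bound)
      show "?s M = 1 \<or> ?s M = 0 \<and> ?u M = 1"
        using vanish_off_M_above[OF x g(1) g(2) that, of i] by (cases "M \<in> M_above E x") auto
    qed (use integral_C_K_plus_nonneg[OF that f] integral_C_K_plus_nonneg[OF that g(1)] in auto)
    note int_fg = cumulant_integrable[OF fg, of i] and int_f = cumulant_integrable[OF f]
      and int_g = cumulant_integrable[OF g(1), of i] and int_s = integrable_indicator_M_above[OF x]
    have int_sv: "integrable \<Lambda> (\<lambda>M. ?s M * ?v M)"
    proof (rule Bochner_Integration.integrable_bound[OF int_s])
      show "(\<lambda>M. ?s M * ?v M) \<in> borel_measurable \<Lambda>"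
        by (intro borel_measurable_times meas_Lam borel_measurable_indicator M_above_sets x hm)
      show "AE M in \<Lambda>. norm (?s M * ?v M) \<le> norm (?s M)"
        using integral_C_K_plus_nonneg[OF _ f] by (intro AE_I2) (simp add: indicator_def)
    qed
    have lim_eq: "(\<integral>M. ?v M \<partial>limit_law x) = (\<integral>M. ?s M * ?v M \<partial>\<Lambda>)" by (rule integral_limit_law[OF x hm])
    have "cumulant (fg i) - cumulant f = (\<integral>M. (1 - exp (- (\<integral>y. fg i y \<partial>M))) - (1 - ?v M) \<partial>\<Lambda>)"
      unfolding cumulant_def by (rule Bochner_Integration.integral_diff[symmetric, OF int_fg int_f])
    also have "\<dots> \<le> (\<integral>M. ?s M * ?v M \<partial>\<Lambda>)"
    proof (rule integral_mono[OF Bochner_Integration.integrable_diff[OF int_fg int_f] int_sv])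
      fix M assume "M \<in> space \<Lambda>"
      then have M: "M \<in> Mp E" by simp
      show "(1 - exp (- (\<integral>y. fg i y \<partial>M))) - (1 - ?v M) \<le> ?s M * ?v M"
        using b[OF M] unfolding uv[OF M] by blast
    qed
    finally show "cumulant (fg i) - cumulant f \<le> (\<integral>M. ?v M \<partial>limit_law x)" unfolding lim_eq .
    have "(\<integral>M. ?s M * ?v M \<partial>\<Lambda>) \<le>
        (\<integral>M. ((1 - exp (- (\<integral>y. fg i y \<partial>M))) - (1 - ?v M)) + (?s M - (1 - ?u M)) \<partial>\<Lambda>)"
    proof (rule integral_mono[OF int_sv])
      show "integrable \<Lambda> (\<lambda>M. ((1 - exp (- (\<integral>y. fg i y \<partial>M))) - (1 - ?v M)) + (?s M - (1 - ?u M)))"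
        by (intro Bochner_Integration.integrable_add Bochner_Integration.integrable_diff int_fg int_f int_s int_g)
      fix M assume "M \<in> space \<Lambda>"
      then have M: "M \<in> Mp E" by simp
      show "?s M * ?v M \<le> ((1 - exp (- (\<integral>y. fg i y \<partial>M))) - (1 - ?v M)) + (?s M - (1 - ?u M))"
        using b[OF M] unfolding uv[OF M] by blast
    qed
    also have "\<dots> = cumulant (fg i) - cumulant f + (above_mass x - cumulant (g i))"
      unfolding cumulant_def above_mass_eq[OF x, symmetric]
      by (simp only: Bochner_Integration.integral_add[OF Bochner_Integration.integrable_diff[OF int_fg int_f]
            Bochner_Integration.integrable_diff[OF int_s int_g]]
          Bochner_Integration.integral_diff[OF int_fg int_f] Bochner_Integration.integral_diff[OF int_s int_g])
    finally show "(\<integral>M. ?v M \<partial>limit_law x) \<le> cumulant (fg i) - cumulant f + (above_mass x - cumulant (g i))"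
      unfolding lim_eq .
    show "\<forall>\<^sub>F n in sequentially. real (k n) * q (fg i) n - real (k n) * q f n \<le> (\<integral>M. ?v M \<partial>block_law x n) \<and>
       (\<integral>M. ?v M \<partial>block_law x n) \<le> real (k n) * q (fg i) n - real (k n) * q f n +
         (real (k n) * prob (exceed (R n) n x) - real (k n) * q (g i) n)"
      using eventually_ge_at_top[of 1]
    proof eventually_elim
      case (elim n)
      let ?s = "\<lambda>\<omega>. indicat_real (exceed (R n) n x) \<omega>"
      let ?u = "\<lambda>\<omega>. exp (- S (R n) n (g i) \<omega>)" and ?v = "\<lambda>\<omega>. exp (- S (R n) n f \<omega>)"
      have uv: "(1 - ?u \<omega>) * ?v \<omega> = ?v \<omega> - exp (- S (R n) n (fg i) \<omega>)" for \<omega>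
        by (simp add: fg_def S_def sum.distrib left_diff_distrib exp_add[symmetric] add.commute)
      have b: "(1 - ?u \<omega>) * ?v \<omega> \<le> ?s \<omega> * ?v \<omega> \<and> ?s \<omega> * ?v \<omega> \<le> (1 - ?u \<omega>) * ?v \<omega> + (?s \<omega> - (1 - ?u \<omega>))"
        if "\<omega> \<in> space P" for \<omega>
      proof (rule bound)
        show "?s \<omega> = 1 \<or> ?s \<omega> = 0 \<and> ?u \<omega> = 1"
          using S_off_exceed[OF elim that, of "R n" x "g i"] R_le g(2) by (cases "\<omega> \<in> exceed (R n) n x") auto
      qed (use S_nonneg[OF R_le that f] S_nonneg[OF R_le that g(1)] in auto)
      note int_fg = laplace_S_integrable[OF R_le fg, of n i] and int_f = laplace_S_integrable[OF R_le f, of n]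
        and int_g = laplace_S_integrable[OF R_le g(1), of n i]
      note ex = exceed_sets[OF R_le, of n x]
      have int_s: "integrable P ?s" using ex by (intro integrable_real_indicator) (auto simp: emeasure_eq_measure)
      have prob_eq: "prob (exceed (R n) n x) = (\<integral>\<omega>. ?s \<omega> \<partial>P)"
        using ex sets.sets_into_space[OF ex] by (simp add: Int_absorb2)
      have int_sv: "integrable P (\<lambda>\<omega>. ?s \<omega> * ?v \<omega>)"
      proof (rule Bochner_Integration.integrable_bound[OF int_s])
        show "(\<lambda>\<omega>. ?s \<omega> * ?v \<omega>) \<in> borel_measurable P"
          by (rule borel_measurable_times[OF borel_measurable_indicator[OF ex] borel_measurable_integrable[OF int_f]])
        show "AE \<omega> in P. norm (?s \<omega> * ?v \<omega>) \<le> norm (?s \<omega>)"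
          using S_nonneg[OF R_le _ f] by (intro AE_I2) (simp add: indicator_def)
      qed
      have J: "(\<integral>M. exp (- (\<integral>y. f y \<partial>M)) \<partial>block_law x n) = real (k n) * (\<integral>\<omega>. ?s \<omega> * ?v \<omega> \<partial>P)"
        unfolding integral_block_law[OF hm]
        by (intro arg_cong2[where f="(*)"] refl Bochner_Integration.integral_cong)
          (simp add: integral_PP[OF R_le _ f])
      have qd: "q (fg i) n - q f n = (\<integral>\<omega>. ?v \<omega> - exp (- S (R n) n (fg i) \<omega>) \<partial>P)"
        unfolding q_eq[OF fg] q_eq[OF f] using int_f int_fg by simp
      have lower: "q (fg i) n - q f n \<le> (\<integral>\<omega>. ?s \<omega> * ?v \<omega> \<partial>P)"
        unfolding qd
      proof (rule integral_mono[OF Bochner_Integration.integrable_diff[OF int_f int_fg] int_sv])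
        fix \<omega> assume \<omega>: "\<omega> \<in> space P"
        show "?v \<omega> - exp (- S (R n) n (fg i) \<omega>) \<le> ?s \<omega> * ?v \<omega>" using b[OF \<omega>] unfolding uv by blast
      qed
      have "(\<integral>\<omega>. ?s \<omega> * ?v \<omega> \<partial>P) \<le>
          (\<integral>\<omega>. (?v \<omega> - exp (- S (R n) n (fg i) \<omega>)) + (?s \<omega> - (1 - ?u \<omega>)) \<partial>P)"
      proof (rule integral_mono[OF int_sv])
        show "integrable P (\<lambda>\<omega>. (?v \<omega> - exp (- S (R n) n (fg i) \<omega>)) + (?s \<omega> - (1 - ?u \<omega>)))"
          using int_f int_fg int_s int_g by simp
        fix \<omega> assume \<omega>: "\<omega> \<in> space P"
        show "?s \<omega> * ?v \<omega> \<le> (?v \<omega> - exp (- S (R n) n (fg i) \<omega>)) + (?s \<omega> - (1 - ?u \<omega>))"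
          using b[OF \<omega>] unfolding uv by blast
      qed
      also have "\<dots> = (q (fg i) n - q f n) + (prob (exceed (R n) n x) - q (g i) n)"
        unfolding qd q_eq[OF g(1)] prob_eq using int_f int_fg int_s int_g by (simp add: prob_space)
      finally have upper: "(\<integral>\<omega>. ?s \<omega> * ?v \<omega> \<partial>P) \<le> (q (fg i) n - q f n) + (prob (exceed (R n) n x) - q (g i) n)" .
      show ?case
        unfolding J using mult_left_mono[OF lower, of "real (k n)"] mult_left_mono[OF upper, of "real (k n)"]
        by (simp add: algebra_simps)
    qed
  qed
qed

text \<open>The limit law is \<Lambda> restricted to \<open>M_above E x\<close>, so only the part of
  the frontier inside this set has to be null.\<close>

lemma block_sets_tendsto:
  assumes W: "\<And>f. f \<in> C_K_plus E \<Longrightarrow> (\<lambda>n. real (k n) * q f n) \<longlonglongrightarrow> cumulant f"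
    and x: "x > 0" and mass: "(\<lambda>n. real (k n) * prob (exceed (R n) n x)) \<longlonglongrightarrow> above_mass x"
    and M: "M \<in> sets (Mp_borel E)"
    and fr: "emeasure \<Lambda> ((vague_topology E frontier_of M) \<inter> M_above E x) = 0"
  shows "(\<lambda>n. ennreal (real (k n) * prob {\<omega> \<in> space P. \<omega> \<in> exceed (R n) n x \<and> PP (R n) n \<omega> \<in> M}))
    \<longlonglongrightarrow> emeasure \<Lambda> (M \<inter> M_above E x)"
proof -
  interpret laplace_convergence E "block_law x" "limit_law x"
    by (intro laplace_convergence.intro laplace_convergence_axioms.intro punctured_space_axioms
        finite_block_law finite_limit_law x sets_block_law sets_limit_law block_law_laplace[OF W x mass])
  have "measure (limit_law x) (vague_topology E frontier_of M) = 0"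
    unfolding measure_def emeasure_limit_law[OF x vague_closed_sets[OF closedin_frontier_of]] fr by simp
  from set_tendsto[OF M this]
  have "(\<lambda>n. ennreal (measure (block_law x n) M)) \<longlonglongrightarrow> ennreal (measure (limit_law x) M)"
    by (rule tendsto_ennrealI)
  moreover have "ennreal (measure (limit_law x) M) = emeasure \<Lambda> (M \<inter> M_above E x)"
    unfolding emeasure_limit_law[OF x M, symmetric]
    by (rule finite_measure.emeasure_eq_measure[OF finite_limit_law[OF x], symmetric])
  ultimately show ?thesis unfolding measure_block_law[OF M] by simp
qed

text \<open>For x below the support of f, the functional h = 1 - exp (- M(f)) vanishes off
  \<open>M_above E x\<close>, so k * q and the cumulant are its integrals against the block law and
  the limit law. All but countably many level sets of h are admissible in (b).\<close>

lemma block_sets_imp_cumulant: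
  assumes b: "\<And>x M. x > 0 \<Longrightarrow> M \<in> M0_sets E \<Longrightarrow>
      emeasure \<Lambda> ((vague_topology E frontier_of M) \<inter> M_above E x) = 0 \<Longrightarrow>
      (\<lambda>n. ennreal (real (k n) * prob {\<omega> \<in> space P. \<omega> \<in> exceed (R n) n x \<and> PP (R n) n \<omega> \<in> M}))
        \<longlonglongrightarrow> emeasure \<Lambda> (M \<inter> M_above E x)"
    and f: "f \<in> C_K_plus E"
  shows "(\<lambda>n. real (k n) * q f n) \<longlonglongrightarrow> cumulant f"
proof -
  obtain e :: real where e: "e > 0" "\<And>y. y \<in> E \<Longrightarrow> \<bar>y\<bar> < ereal e \<Longrightarrow> f y = 0"
    using C_K_plusD[OF f] by blast
  \<comment> \<open>Halving e turns vanishing for |y| < e into vanishing for |y| \<le> x.\<close>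
  define x where "x = e / 2"
  have x: "x > 0" using e(1) by (simp add: x_def)
  have f0: "f y = 0" if "y \<in> E" "\<bar>y\<bar> \<le> ereal x" for y
  proof (rule e(2)[OF that(1)])
    have "ereal x < ereal e" using e(1) by (simp add: x_def)
    with that(2) show "\<bar>y\<bar> < ereal e" by (rule le_less_trans)
  qed
  interpret F: finite_measure "limit_law x" by (rule finite_limit_law[OF x])
  have sets_b: "(\<lambda>n. measure (block_law x n) M) \<longlonglongrightarrow> measure (limit_law x) M"
    if M: "M \<in> M0_sets E" and fr: "emeasure \<Lambda> ((vague_topology E frontier_of M) \<inter> M_above E x) = 0" for M
  proof -
    have M': "M \<in> sets (Mp_borel E)" using M by (simp add: M0_sets_def)
    have "ennreal (measure (limit_law x) M) = emeasure \<Lambda> (M \<inter> M_above E x)"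
      unfolding emeasure_limit_law[OF x M', symmetric] by (rule F.emeasure_eq_measure[symmetric])
    with b[OF x M fr] have "(\<lambda>n. ennreal (measure (block_law x n) M)) \<longlonglongrightarrow> ennreal (measure (limit_law x) M)"
      unfolding measure_block_law[OF M'] by simp
    then show ?thesis by (rule tendsto_ennrealD) auto
  qed
  let ?h = "\<lambda>M. 1 - exp (- (\<integral>y. f y \<partial>M))"
  have hm: "?h \<in> borel_measurable (Mp_borel E)" by (rule one_minus_laplace_measurable[OF f])
  have hc: "continuous_map (vague_topology E) euclideanreal ?h"
  proof -
    have "continuous_map (vague_topology E) euclideanreal ((\<lambda>t. 1 - exp (- t)) \<circ> (\<lambda>M. \<integral>x. f x \<partial>M))"
      by (rule continuous_map_compose[OF vague_continuous_integral[OF f]])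
        (auto intro!: continuous_intros)
    then show ?thesis by (simp only: comp_def)
  qed
  have "(\<lambda>n. \<integral>M. ?h M \<partial>block_law x n) \<longlonglongrightarrow> (\<integral>M. ?h M \<partial>limit_law x)"
  proof -
    \<comment> \<open>\<open>M_above E x\<close> is open and thus disjoint from its frontier, so it
      is itself admissible. For n \<ge> 1 it carries the block law, which bounds the masses.\<close>
    have above: "M_above E x \<in> M0_sets E"
      using M_above_sets[OF x] unfolding M0_sets_def M_above_def by auto
    have "(vague_topology E frontier_of M_above E x) \<inter> M_above E x = {}"
      unfolding frontier_of_def interior_of_openin[OF openin_M_above[OF x]] by blast
    then have conv: "convergent (\<lambda>n. measure (block_law x n) (M_above E x))"
      using sets_b[OF above] by (intro convergentI) simp
    obtain C where C: "\<And>n. norm (measure (block_law x n) (M_above E x)) \<le> C"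
      by (rule BseqE[OF convergent_imp_Bseq[OF conv]]) blast
    \<comment> \<open>\<open>PP_above_iff\<close> needs a positive scale \<open>a n\<close>, so n =
      0 gets a bound of its own.\<close>
    obtain C0 where C0: "measure (block_law x 0) (Mp E) \<le> C0" by blast
    have C': "measure (block_law x n) (Mp E) \<le> max C C0" for n
    proof (cases "n = 0")
      case False
      then have n: "1 \<le> n" by simp
      have "measure (block_law x n) (Mp E) = measure (block_law x n) (M_above E x)"
        unfolding measure_block_law[OF M_above_sets[OF x]] measure_block_law[OF sets.top[of "Mp_borel E", simplified]]
        using PP_above_iff[OF n _ R_le x] PP_Mp[OF R_le]
        by (intro arg_cong2[where f="(*)"] refl arg_cong[where f=prob]) auto
      then show ?thesis using C[of n] by simp
    qed (use C0 in simp)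
    show ?thesis
    proof (rule integral_tendsto_of_level_sets[OF finite_block_law finite_limit_law[OF x]])
      fix t :: real assume t: "t > 0" "measure (limit_law x) {m \<in> space (limit_law x). ?h m = t} = 0"
      have m: "{m \<in> Mp E. ?h m > t} \<in> sets (Mp_borel E)" "{m \<in> Mp E. ?h m = t} \<in> sets (Mp_borel E)"
        by (rule level_sets[OF hm])+
      \<comment> \<open>At the null measure h is 0 < t, so the level set avoids it.\<close>
      have M0: "{m \<in> Mp E. ?h m > t} \<in> M0_sets E"
        using m(1) t(1) unfolding M0_sets_def M0_def by auto
      have "emeasure \<Lambda> ((vague_topology E frontier_of {m \<in> Mp E. ?h m > t}) \<inter> M_above E x) \<le>
          emeasure \<Lambda> ({m \<in> Mp E. ?h m = t} \<inter> M_above E x)"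
        using frontier_of_level_set[OF hc, of t] m(2) M_above_sets[OF x] sets_Lam
        by (intro emeasure_mono) (auto simp: topspace_vague)
      also have "\<dots> = 0"
        using t(2) unfolding emeasure_limit_law[OF x m(2), symmetric] by (simp add: F.emeasure_eq_measure)
      finally show "(\<lambda>n. measure (block_law x n) {m \<in> space (limit_law x). t < ?h m})
          \<longlonglongrightarrow> measure (limit_law x) {m \<in> space (limit_law x). t < ?h m}"
        using sets_b[OF M0] by simp
    next
      show "?h \<in> borel_measurable (limit_law x)" using hm measurable_cong_sets[OF sets_limit_law refl] by blast
      show "0 \<le> ?h m \<and> ?h m \<le> 1" if "m \<in> space (limit_law x)" for m
        using that integral_C_K_plus_nonneg[OF _ f] by simp
    qed (use C' in simp_all)
  qed
  moreover have "(\<integral>M. ?h M \<partial>limit_law x) = cumulant f"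
    unfolding integral_limit_law[OF x hm] cumulant_def
    using vanish_off_M_above[OF x f f0]
    by (intro Bochner_Integration.integral_cong) (auto simp: indicator_def)
  moreover have "\<forall>\<^sub>F n in sequentially. (\<integral>M. ?h M \<partial>block_law x n) = real (k n) * q f n"
    using eventually_ge_at_top[of 1]
  proof eventually_elim
    case (elim n)
    have "indicator (exceed (R n) n x) \<omega> * ?h (PP (R n) n \<omega>) = 1 - exp (- S (R n) n f \<omega>)" if "\<omega> \<in> space P" for \<omega>
      using integral_PP[OF R_le that f] S_off_exceed[OF elim that _ R_le f0]
      by (cases "\<omega> \<in> exceed (R n) n x") auto
    then show ?case unfolding integral_block_law[OF hm] q_def
      by (intro arg_cong2[where f="(*)"] refl Bochner_Integration.integral_cong) auto
  qed
  ultimately show ?thesis by (simp add: tendsto_cong)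
qed

end

section \<open>The state space and the tail of \<mu>\<close>

lemma punctured_shape:
  fixes E :: "ereal set"
  assumes "E = {..<0} \<union> {0<..} \<or> E = {0<..} \<or> E = {..<0}"
  shows "punctured_space E"
proof
  show "open E" "0 \<notin> E" using assms by auto
  fix e :: real assume e: "e > 0"
  \<comment> \<open>As the infinities belong to the extended rays, the part away from 0 is a closed
    ray on either side.\<close>
  have pos: "{0<..} \<inter> {y. ereal e \<le> \<bar>y\<bar>} = {ereal e..}"
  proof (intro set_eqI)
    fix y :: ereal
    show "y \<in> {0<..} \<inter> {y. ereal e \<le> \<bar>y\<bar>} \<longleftrightarrow> y \<in> {ereal e..}"
      using e by (cases y) auto
  qed
  have neg: "{..<0} \<inter> {y. ereal e \<le> \<bar>y\<bar>} = {..- ereal e}"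
  proof (intro set_eqI)
    fix y :: ereal
    show "y \<in> {..<0} \<inter> {y. ereal e \<le> \<bar>y\<bar>} \<longleftrightarrow> y \<in> {..- ereal e}"
      using e by (cases y) auto
  qed
  show "closed (E \<inter> {y. ereal e \<le> \<bar>y\<bar>})"
    using assms by (elim disjE) (simp_all only: Int_Un_distrib2 pos neg closed_atLeast closed_atMost closed_Un)
qed

lemma tail_vanishes:
  fixes \<mu> :: "real measure"
  assumes sets: "sets \<mu> = sets (restrict_space borel {0<..})"
    and fin: "\<And>x. x > 0 \<Longrightarrow> emeasure \<mu> {x<..} < \<infinity>"
  shows "((\<lambda>x. measure \<mu> {x<..}) \<longlongrightarrow> 0) at_top"
proof (rule order_tendstoI)
  have s: "{x<..} \<in> sets \<mu>" if "x \<ge> 0" for x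
    using that unfolding sets by (subst sets_restrict_space_iff) auto
  fix b :: real assume b: "0 < b"
  have "(\<lambda>n. measure \<mu> {real (Suc n)<..}) \<longlonglongrightarrow> measure \<mu> (\<Inter>n. {real (Suc n)<..})"
  proof (rule Lim_measure_decseq)
    show "range (\<lambda>n. {real (Suc n)<..}) \<subseteq> sets \<mu>" using s by auto
    show "decseq (\<lambda>n. {real (Suc n)<..})" by (auto simp: decseq_def)
    show "emeasure \<mu> {real (Suc n)<..} \<noteq> \<infinity>" for n using fin[of "real (Suc n)"] by simp
  qed
  moreover have "(\<Inter>n. {real (Suc n)<..}) = {}"
  proof -
    have "\<exists>n. \<not> real (Suc n) < y" for y
      using reals_Archimedean2[of y] by (metis less_SucI not_less_iff_gr_or_eq of_nat_less_iff less_trans lessI)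
    then show ?thesis by auto
  qed
  ultimately have "(\<lambda>n. measure \<mu> {real (Suc n)<..}) \<longlonglongrightarrow> 0" by simp
  from order_tendstoD(2)[OF this b] obtain n where n: "measure \<mu> {real (Suc n)<..} < b"
    by (auto simp: eventually_sequentially)
  show "\<forall>\<^sub>F x in at_top. measure \<mu> {x<..} < b"
    using eventually_ge_at_top[of "real (Suc n)"]
  proof eventually_elim
    case (elim x)
    have "measure \<mu> {x<..} \<le> measure \<mu> {real (Suc n)<..}"
      using elim s fin[of "real (Suc n)"] by (intro measure_mono_fmeasurable) (auto simp: fmeasurable_def)
    then show ?case using n by simp
  qed
qed (auto intro!: always_eventually less_le_trans[OF _ measure_nonneg])

lemma tail_positive:
  fixes \<mu> :: "real measure"
  assumes sets: "sets \<mu> = sets (restrict_space borel {0<..})"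
    and fin: "\<And>x. x > 0 \<Longrightarrow> emeasure \<mu> {x<..} < \<infinity>" and nz: "emeasure \<mu> {0<..} \<noteq> 0"
  obtains x where "x > 0" "measure \<mu> {x<..} > 0"
proof -
  have s: "{x<..} \<in> sets \<mu>" if "x \<ge> 0" for x
    using that unfolding sets by (subst sets_restrict_space_iff) auto
  have "\<exists>n. emeasure \<mu> {1 / real (Suc n)<..} \<noteq> 0"
  proof (rule ccontr)
    assume "\<not> ?thesis"
    then have "emeasure \<mu> (\<Union>n. {1 / real (Suc n)<..}) = 0"
      using s by (intro emeasure_UN_eq_0) auto
    moreover have "(\<Union>n. {1 / real (Suc n)<..}) = {0<..}"
    proof (intro set_eqI iffI)
      fix y :: real assume "y \<in> {0<..}"
      then obtain n where "inverse (real (Suc n)) < y" using reals_Archimedean[of y] by auto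
      then show "y \<in> (\<Union>n. {1 / real (Suc n)<..})" by (auto simp: inverse_eq_divide)
    next
      fix y :: real assume "y \<in> (\<Union>n. {1 / real (Suc n)<..})"
      then obtain n where "1 / real (Suc n) < y" by auto
      moreover have "0 < 1 / real (Suc n)" by simp
      ultimately show "y \<in> {0<..}" unfolding greaterThan_iff by linarith
    qed
    ultimately show False using nz by simp
  qed
  then obtain n where n: "emeasure \<mu> {1 / real (Suc n)<..} \<noteq> 0" by blast
  show ?thesis
  proof (rule that)
    show "0 < 1 / real (Suc n)" by simp
    then show "0 < measure \<mu> {1 / real (Suc n)<..}"
      using n fin[of "1 / real (Suc n)"] by (simp add: measure_def enn2real_positive_iff zero_less_iff_neq_zero)
  qed
qed

text \<open>The power law carries a constant c because the scale of \<open>a n\<close> is free: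
  replacing \<open>a n\<close> by s * a n turns \<mu>(x, \<infinity>) into \<mu>(s * x, \<infinity>)
  and so multiplies c by s powr (- \<alpha>).\<close>

theorem corollary2p7:
  fixes E :: "ereal set"
    and P :: "'a measure" and \<xi> :: "nat \<Rightarrow> 'a \<Rightarrow> real"
    and \<theta> :: real and a :: "nat \<Rightarrow> real" and \<mu> :: "real measure" and r :: "nat \<Rightarrow> nat"
    and P' :: "'b measure" and N :: "'b \<Rightarrow> ereal measure" and \<Lambda> :: "ereal measure measure"
  defines "k \<equiv> \<lambda>n. n div r n"
    and "PP \<equiv> \<lambda>m n \<omega>. dirac_sum E {1..m} (\<lambda>j. ereal (\<xi> j \<omega> / a n))"
    and "D' \<equiv> {x :: real. x > 0 \<and> (ereal x \<in> fixed_atoms E P' N \<or> ereal (- x) \<in> fixed_atoms E P' N)}"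
  assumes E: "state_space E"
    and P: "prob_space P"
    and \<xi>: "\<And>j. 1 \<le> j \<Longrightarrow> \<xi> j \<in> borel_measurable P"
    and stat: "stationary P \<xi>"
    and ext: "has_extremal_index P (\<lambda>j \<omega>. \<bar>\<xi> j \<omega>\<bar>) \<theta>" and \<theta>: "\<theta> > 0"
    and a: "\<And>n. 1 \<le> n \<Longrightarrow> a n > 0"
    and \<mu>_sets: "sets \<mu> = sets (restrict_space borel {0<..})"
    and \<mu>_nonzero: "emeasure \<mu> {0<..} \<noteq> 0"
    and \<mu>_finite: "\<And>x. x > 0 \<Longrightarrow> emeasure \<mu> {x<..} < \<infinity>"
    and tail: "\<And>x. x > 0 \<Longrightarrow>
      (\<lambda>n. real n * measure P {\<omega>\<in>space P. \<bar>\<xi> 1 \<omega>\<bar> > x * a n}) \<longlonglongrightarrow> measure \<mu> {x<..}"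
    and in_E: "\<And>n j \<omega>. 1 \<le> j \<Longrightarrow> j \<le> n \<Longrightarrow> \<omega> \<in> space P \<Longrightarrow> ereal (\<xi> j \<omega> / a n) \<in> E"
    and r: "\<And>n. 1 \<le> n \<Longrightarrow> r n > 0"
    and k: "filterlim k at_top sequentially"
    and mixing: "\<And>f. f \<in> C_K_plus E \<Longrightarrow>
      (\<lambda>n. \<bar>(\<integral>\<omega>. exp (- (\<Sum>j=1..n. f (ereal (\<xi> j \<omega> / a n)))) \<partial>P)
            - (\<integral>\<omega>. exp (- (\<Sum>j=1..r n. f (ereal (\<xi> j \<omega> / a n)))) \<partial>P) ^ k n\<bar>) \<longlonglongrightarrow> 0"
    and P': "prob_space P'"
    and N: "N \<in> measurable P' (Mp_borel E)"
    and N_id: "infinitely_divisible E (pp_law E P' N)"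
    and N_can: "canonical_measure E (pp_law E P' N) \<Lambda>"
    and N_inf: "AE \<omega> in P'. emeasure (N \<omega>) (E \<inter> {-\<infinity>, \<infinity>}) = 0"
  shows
    "(weakly_converges (vague_topology E) (\<lambda>n. pp_law E P (PP n n)) (pp_law E P' N)
      \<longleftrightarrow>
      (\<forall>x>0. x \<notin> D' \<longrightarrow>
         (\<lambda>n. real (k n) * measure P {\<omega>\<in>space P. Max ((\<lambda>j. \<bar>\<xi> j \<omega>\<bar>) ` {1..r n}) > x * a n})
           \<longlonglongrightarrow> \<theta> * measure \<mu> {x<..}) \<and>
      (\<forall>x>0. measure \<mu> {x<..} > 0 \<longrightarrow>
         (\<forall>M\<in>M0_sets E. emeasure \<Lambda> ((vague_topology E frontier_of M) \<inter> M_above E x) = 0 \<longrightarrow>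
            (\<lambda>n. ennreal (real (k n) *
                   measure P {\<omega>\<in>space P. Max ((\<lambda>j. \<bar>\<xi> j \<omega>\<bar>) ` {1..r n}) > x * a n \<and>
                                          PP (r n) n \<omega> \<in> M}))
              \<longlonglongrightarrow> emeasure \<Lambda> (M \<inter> M_above E x)))) \<and>
     (weakly_converges (vague_topology E) (\<lambda>n. pp_law E P (PP n n)) (pp_law E P' N)
      \<longrightarrow>
      regularly_varying (\<lambda>x. measure P {\<omega>\<in>space P. \<bar>\<xi> 1 \<omega>\<bar> > x}) \<and>
      (\<exists>c>0. \<exists>\<alpha>>0. \<forall>x>0. measure \<mu> {x<..} = c * x powr (- \<alpha>)))"
proof -
  interpret P: prob_space P by (rule P)
  define U where "U x = measure P {\<omega>\<in>space P. \<bar>\<xi> 1 \<omega>\<bar> > x}" for x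
  define T where "T x = measure \<mu> {x<..}" for x
  have [measurable]: "\<xi> (Suc 0) \<in> borel_measurable P" by (rule \<xi>) simp
  have antiU: "antimono U"
    unfolding U_def by (intro antimonoI P.finite_measure_mono) auto
  have U0: "U x \<ge> 0" for x by (simp add: U_def)
  have tailU: "(\<lambda>n. real n * U (x * a n)) \<longlonglongrightarrow> T x" if "x > 0" for x
    using tail[OF that] by (simp add: U_def T_def)
  have T0: "(T \<longlongrightarrow> 0) at_top"
    unfolding T_def using \<mu>_sets \<mu>_finite by (rule tail_vanishes)
  obtain x0 where x0: "x0 > 0" "T x0 > 0"
    unfolding T_def using tail_positive[OF \<mu>_sets \<mu>_finite \<mu>_nonzero] by blast
  note rv = tail_regular_variation[OF antiU U0 a tailU T0 x0]
  obtain C \<alpha> where C: "C > 0" and \<alpha>: "\<alpha> > 0" and T: "\<And>x. x > 0 \<Longrightarrow> T x = C * x powr (- \<alpha>)"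
    and U_rv: "\<And>x. x > 0 \<Longrightarrow> ((\<lambda>t. U (t * x) / U t) \<longlongrightarrow> x powr (- \<alpha>)) at_top"
    using rv(1) by blast
  have Upos: "U z > 0" for z by (rule rv(2))
  have Tpos: "T x > 0" if "x > 0" for x using T[OF that] C that by simp
  \<comment> \<open>A bounded space would bound \<xi> 1 already through the single scale
    \<open>a 1\<close>, whereas the tail U is positive everywhere.\<close>
  have not_bounded: False if bd: "\<And>\<omega>. \<omega> \<in> space P \<Longrightarrow> \<bar>\<xi> 1 \<omega> / a 1\<bar> \<le> b" for b
  proof -
    have "\<bar>\<xi> 1 \<omega>\<bar> \<le> b * a 1" if "\<omega> \<in> space P" for \<omega>
      using bd[OF that] a[of 1] by (simp add: pos_divide_le_eq)
    then have "{\<omega>\<in>space P. \<bar>\<xi> 1 \<omega>\<bar> > b * a 1} = {}" by (auto simp: not_less)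
    then have "U (b * a 1) = 0" unfolding U_def by (simp only: measure_empty)
    then show False using Upos[of "b * a 1"] by simp
  qed
  \<comment> \<open>A space with a gap of radius c > 0 around 0 makes every scaled point exceed c;
    then n * U (c * a n) = n diverges instead of converging to T c.\<close>
  have not_away: "c = 0" if c: "c \<ge> 0" "\<And>n \<omega>. 1 \<le> n \<Longrightarrow> \<omega> \<in> space P \<Longrightarrow> c * a n < \<bar>\<xi> 1 \<omega>\<bar>" for c
  proof (rule ccontr)
    assume "c \<noteq> 0"
    then have "c > 0" using c by simp
    have "\<forall>\<^sub>F n in sequentially. real n * U (c * a n) = real n"
      using eventually_ge_at_top[of 1]
    proof eventually_elim
      case (elim n)
      have "{\<omega>\<in>space P. \<bar>\<xi> 1 \<omega>\<bar> > c * a n} = space P" using c(2)[OF elim] by auto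
      then show ?case unfolding U_def by (simp add: P.prob_space)
    qed
    with tailU[OF \<open>c > 0\<close>] have "(\<lambda>n. real n) \<longlonglongrightarrow> T c" by (rule Lim_transform_eventually)
    then show False
      using not_tendsto_and_filterlim_at_infinity[OF sequentially_bot _ tendsto_of_nat] by blast
  qed
  have shape: "E = {..<0} \<union> {0<..} \<or> E = {0<..} \<or> E = {..<0}"
  proof -
    have pts: "ereal (\<xi> 1 \<omega> / a n) \<in> E" if "1 \<le> n" "\<omega> \<in> space P" for n \<omega>
      using in_E[of 1 n \<omega>] that by simp
    from E[unfolded state_space_def] show ?thesis
    proof (elim disjE exE conjE)
      fix c b :: real
      assume cb: "0 \<le> c" "c < b" and Eq: "E = {- ereal b..<- ereal c} \<union> {ereal c<..ereal b}"
      have "\<bar>\<xi> 1 \<omega> / a 1\<bar> \<le> b" if "\<omega> \<in> space P" for \<omega>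
        using pts[of 1 \<omega>] that cb unfolding Eq by (auto simp: abs_le_iff)
      then show ?thesis using not_bounded by blast
    next
      fix c b :: real
      assume cb: "0 \<le> c" "c < b" and Eq: "E = {ereal c<..ereal b}"
      have "\<bar>\<xi> 1 \<omega> / a 1\<bar> \<le> b" if "\<omega> \<in> space P" for \<omega>
        using pts[of 1 \<omega>] that cb unfolding Eq by (auto simp: abs_le_iff)
      then show ?thesis using not_bounded by blast
    next
      fix c b :: real
      assume cb: "0 \<le> c" "c < b" and Eq: "E = {- ereal b..<- ereal c}"
      have "\<bar>\<xi> 1 \<omega> / a 1\<bar> \<le> b" if "\<omega> \<in> space P" for \<omega>
        using pts[of 1 \<omega>] that cb unfolding Eq by (auto simp: abs_le_iff)
      then show ?thesis using not_bounded by blast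
    next
      fix c :: real
      assume c: "0 \<le> c" and Eq: "E = {- \<infinity>..<- ereal c} \<union> {ereal c<..\<infinity>}"
      have "c = 0"
      proof (rule not_away[OF c])
        show "c * a n < \<bar>\<xi> 1 \<omega>\<bar>" if "1 \<le> n" "\<omega> \<in> space P" for n \<omega>
          using pts[OF that] a[OF that(1)] unfolding Eq by (auto simp: field_simps)
      qed
      then show ?thesis unfolding Eq by (auto simp: zero_ereal_def)
    next
      fix c :: real
      assume c: "0 \<le> c" and Eq: "E = {ereal c<..\<infinity>}"
      have "c = 0"
      proof (rule not_away[OF c])
        show "c * a n < \<bar>\<xi> 1 \<omega>\<bar>" if "1 \<le> n" "\<omega> \<in> space P" for n \<omega>
          using pts[OF that] a[OF that(1)] unfolding Eq by (auto simp: field_simps)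
      qed
      then show ?thesis unfolding Eq by (auto simp: zero_ereal_def)
    next
      fix c :: real
      assume c: "0 \<le> c" and Eq: "E = {- \<infinity>..<- ereal c}"
      have "c = 0"
      proof (rule not_away[OF c])
        show "c * a n < \<bar>\<xi> 1 \<omega>\<bar>" if "1 \<le> n" "\<omega> \<in> space P" for n \<omega>
          using pts[OF that] a[OF that(1)] unfolding Eq by (auto simp: field_simps)
      qed
      then show ?thesis unfolding Eq by (auto simp: zero_ereal_def)
    qed
  qed
  interpret punctured_space E by (rule punctured_shape[OF shape])
  have prob_N: "prob_space (pp_law E P' N)"
    unfolding pp_law_def by (rule prob_space.prob_space_distr[OF P' N])
  interpret RE: rare_events E "pp_law E P' N" \<Lambda> P \<xi> a r k
    by (intro rare_events.intro rare_events_axioms.intro canonical.intro canonical_axioms.intro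
        punctured_space_axioms P N_can prob_N \<xi> a in_E k mixing) (simp_all add: pp_law_def k_def)
  have PP: "PP = RE.PP" by (simp add: fun_eq_iff PP_def RE.PP_def)
  have W_iff: "weakly_converges (vague_topology E) (\<lambda>n. pp_law E P (PP n n)) (pp_law E P' N) \<longleftrightarrow>
      (\<forall>f\<in>C_K_plus E. (\<lambda>n. real (k n) * RE.q f n) \<longlonglongrightarrow> RE.cumulant f)"
    using RE.weakly_converges_iff unfolding PP pp_law_def[of E P] .
  \<comment> \<open>\<open>Max\<close> needs a nonempty index set, hence 1 \<le> m; for the blocks
    \<open>eventually_block\<close> supplies it.\<close>
  have max_iff: "x * a n < Max ((\<lambda>j. \<bar>\<xi> j \<omega>\<bar>) ` {1..m}) \<longleftrightarrow> (\<exists>j\<in>{1..m}. x * a n < \<bar>\<xi> j \<omega>\<bar>)"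
    if "1 \<le> m" for m n x \<omega>
    using that by (subst Max_gr_iff) auto
  have block_eq: "\<forall>\<^sub>F n in sequentially. {\<omega>\<in>space P. Max ((\<lambda>j. \<bar>\<xi> j \<omega>\<bar>) ` {1..r n}) > x * a n \<and> PP (r n) n \<omega> \<in> M} =
      {\<omega>\<in>space P. \<omega> \<in> RE.exceed (RE.R n) n x \<and> RE.PP (RE.R n) n \<omega> \<in> M}" for x M
    using RE.eventually_block
  proof eventually_elim
    case (elim n)
    then have "1 \<le> r n" by simp
    from max_iff[OF this] show ?case using elim unfolding PP RE.exceed_def by auto
  qed
  have max_eq: "\<forall>\<^sub>F n in sequentially. {\<omega>\<in>space P. Max ((\<lambda>j. \<bar>\<xi> j \<omega>\<bar>) ` {1..r n}) > x * a n} = RE.exceed (RE.R n) n x" for x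
    using RE.eventually_block
  proof eventually_elim
    case (elim n)
    then have "1 \<le> r n" by simp
    from max_iff[OF this] show ?case using elim unfolding RE.exceed_def by auto
  qed
  have block_tendsto: "((\<lambda>n. ennreal (real (k n) *
        measure P {\<omega>\<in>space P. Max ((\<lambda>j. \<bar>\<xi> j \<omega>\<bar>) ` {1..r n}) > x * a n \<and> PP (r n) n \<omega> \<in> M})) \<longlonglongrightarrow> l) \<longleftrightarrow>
      ((\<lambda>n. ennreal (real (k n) *
        measure P {\<omega>\<in>space P. \<omega> \<in> RE.exceed (RE.R n) n x \<and> RE.PP (RE.R n) n \<omega> \<in> M})) \<longlonglongrightarrow> l)" for x M l
    by (rule tendsto_cong) (use block_eq[of x M] in eventually_elim, simp)
  \<comment> \<open>The levels u n = x * a n are admissible in the definition of the extremal index,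
    with \<tau> = \<mu>(x, \<infinity>) > 0.\<close>
  have maxlim: "(\<lambda>n. measure P (space P - RE.exceed n n x)) \<longlonglongrightarrow> exp (- (\<theta> * (C * x powr - \<alpha>)))" if x: "x > 0" for x
  proof -
    have "(\<lambda>n. measure P {\<omega>\<in>space P. Max ((\<lambda>j. \<bar>\<xi> j \<omega>\<bar>) ` {1..n}) \<le> x * a n}) \<longlonglongrightarrow> exp (- \<theta> * T x)"
    proof (rule ext[unfolded has_extremal_index_def, THEN conjunct2, THEN spec, THEN mp,
          THEN conjunct2, THEN spec, THEN mp])
      show "T x > 0" by (rule Tpos[OF x])
      show "(\<lambda>n. real n * measure P {\<omega>\<in>space P. \<bar>\<xi> 1 \<omega>\<bar> > x * a n}) \<longlonglongrightarrow> T x"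
        unfolding T_def by (rule tail[OF x])
    qed
    moreover have "\<forall>\<^sub>F n in sequentially. {\<omega>\<in>space P. Max ((\<lambda>j. \<bar>\<xi> j \<omega>\<bar>) ` {1..n}) \<le> x * a n} = space P - RE.exceed n n x"
      using eventually_ge_at_top[of 1]
    proof eventually_elim
      case (elim n)
      show ?case unfolding not_less[symmetric] max_iff[OF elim] RE.exceed_def by auto
    qed
    then have "\<forall>\<^sub>F n in sequentially. measure P {\<omega>\<in>space P. Max ((\<lambda>j. \<bar>\<xi> j \<omega>\<bar>) ` {1..n}) \<le> x * a n} =
        measure P (space P - RE.exceed n n x)"
      by eventually_elim simp
    ultimately show ?thesis by (simp add: tendsto_cong T[OF x])
  qed
  have contT: "isCont (\<lambda>x. \<theta> * (C * x powr - \<alpha>)) x" if "x > 0" for x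
    using that by (intro continuous_intros) auto
  have forward: "(\<forall>x>0. (\<lambda>n. real (k n) * measure P {\<omega>\<in>space P. Max ((\<lambda>j. \<bar>\<xi> j \<omega>\<bar>) ` {1..r n}) > x * a n})
           \<longlonglongrightarrow> \<theta> * measure \<mu> {x<..}) \<and>
      (\<forall>x>0. \<forall>M\<in>M0_sets E. emeasure \<Lambda> ((vague_topology E frontier_of M) \<inter> M_above E x) = 0 \<longrightarrow>
            (\<lambda>n. ennreal (real (k n) *
                   measure P {\<omega>\<in>space P. Max ((\<lambda>j. \<bar>\<xi> j \<omega>\<bar>) ` {1..r n}) > x * a n \<and>
                                          PP (r n) n \<omega> \<in> M}))
              \<longlonglongrightarrow> emeasure \<Lambda> (M \<inter> M_above E x))"
    if W: "\<forall>f\<in>C_K_plus E. (\<lambda>n. real (k n) * RE.q f n) \<longlonglongrightarrow> RE.cumulant f"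
  proof -
    have am: "RE.above_mass x = \<theta> * (C * x powr - \<alpha>)" if "x > 0" for x
      by (rule RE.above_mass_eq_limit[OF _ maxlim contT that]) (use W in blast)
    \<comment> \<open>\<open>above_mass\<close> agrees with a continuous function on all positive
      reals, hence near x.\<close>
    have cont: "isCont RE.above_mass x" if x: "x > 0" for x
    proof -
      have "\<forall>\<^sub>F y in nhds x. RE.above_mass y = \<theta> * (C * y powr - \<alpha>)"
        using eventually_nhds_in_open[of "{0<..}" x] x by (auto elim: eventually_mono simp: am)
      then show ?thesis using contT[OF x] isCont_cong by metis
    qed
    have mass: "(\<lambda>n. real (k n) * measure P (RE.exceed (RE.R n) n x)) \<longlonglongrightarrow> RE.above_mass x" if "x > 0" for x
      by (rule RE.block_exceed_tendsto[OF _ that cont[OF that]]) (use W in blast)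
    show ?thesis
    proof (intro conjI allI ballI impI)
      fix x :: real assume x: "x > 0"
      have "\<forall>\<^sub>F n in sequentially. real (k n) * measure P (RE.exceed (RE.R n) n x) =
          real (k n) * measure P {\<omega>\<in>space P. Max ((\<lambda>j. \<bar>\<xi> j \<omega>\<bar>) ` {1..r n}) > x * a n}"
        using max_eq[of x] by eventually_elim simp
      with mass[OF x] have "(\<lambda>n. real (k n) * measure P {\<omega>\<in>space P. Max ((\<lambda>j. \<bar>\<xi> j \<omega>\<bar>) ` {1..r n}) > x * a n})
           \<longlonglongrightarrow> RE.above_mass x"
        by (rule Lim_transform_eventually)
      then show "(\<lambda>n. real (k n) * measure P {\<omega>\<in>space P. Max ((\<lambda>j. \<bar>\<xi> j \<omega>\<bar>) ` {1..r n}) > x * a n})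
           \<longlonglongrightarrow> \<theta> * measure \<mu> {x<..}"
        using T[OF x] unfolding am[OF x] T_def by simp
    next
      fix x :: real and M assume x: "x > 0" and M: "M \<in> M0_sets E"
        and fr: "emeasure \<Lambda> ((vague_topology E frontier_of M) \<inter> M_above E x) = 0"
      have "M \<in> sets (Mp_borel E)" using M by (simp add: M0_sets_def)
      then show "(\<lambda>n. ennreal (real (k n) *
                   measure P {\<omega>\<in>space P. Max ((\<lambda>j. \<bar>\<xi> j \<omega>\<bar>) ` {1..r n}) > x * a n \<and>
                                          PP (r n) n \<omega> \<in> M}))
              \<longlonglongrightarrow> emeasure \<Lambda> (M \<inter> M_above E x)"
        unfolding block_tendsto by (intro RE.block_sets_tendsto x mass fr) (use W in blast)
    qed
  qed
  \<comment> \<open>\<mu>(x, \<infinity>) is positive at every x > 0, so (b) is available at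
    whichever level the support of f dictates.\<close>
  have backward: "\<forall>f\<in>C_K_plus E. (\<lambda>n. real (k n) * RE.q f n) \<longlonglongrightarrow> RE.cumulant f"
    if b: "\<forall>x>0. measure \<mu> {x<..} > 0 \<longrightarrow>
         (\<forall>M\<in>M0_sets E. emeasure \<Lambda> ((vague_topology E frontier_of M) \<inter> M_above E x) = 0 \<longrightarrow>
            (\<lambda>n. ennreal (real (k n) *
                   measure P {\<omega>\<in>space P. Max ((\<lambda>j. \<bar>\<xi> j \<omega>\<bar>) ` {1..r n}) > x * a n \<and>
                                          PP (r n) n \<omega> \<in> M}))
              \<longlonglongrightarrow> emeasure \<Lambda> (M \<inter> M_above E x))"
    by (intro ballI RE.block_sets_imp_cumulant)
      (use b Tpos in \<open>simp_all only: block_tendsto T_def\<close>)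
  have reg: "regularly_varying (\<lambda>x. measure P {\<omega>\<in>space P. \<bar>\<xi> 1 \<omega>\<bar> > x})"
  proof -
    have "mono (\<lambda>x. - U x)" using antiU by (auto simp: mono_def antimono_def)
    then have "(\<lambda>x. - (- U x)) \<in> borel_measurable borel"
      by (intro borel_measurable_uminus borel_measurable_mono)
    then have "regularly_varying U"
      unfolding regularly_varying_def using Upos U_rv by auto
    then show ?thesis unfolding U_def .
  qed
  have "\<exists>c>0. \<exists>\<alpha>>0. \<forall>x>0. measure \<mu> {x<..} = c * x powr (- \<alpha>)"
    using C \<alpha> T unfolding T_def by blast
  then show ?thesis
    unfolding W_iff using forward backward reg by blast
qed

end
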